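(* Let $V=\bigoplus_{n\ge0}V_n$ be a $C_2$-cofinite vertex operator algebra such that $V_0$ is one-dimensional. Assume that the Zhu algebra $A(V)$ is semisimple and that any $V$-module generated by an irreducible $A(V)$-module is irreducible. Then $V$ is a rational vertex operator algebra.
   Context: Write $Y(v,z)=\sum_nv_nz^{-n-1}$. $V$ is $C_2$-cofinite if $V/C_2(V)$ is finite dimensional, where $C_2(V)$ is spanned by $u_{-2}v$, $u,v\in V$. An admissible $V$-module is a weak module $Z=\bigoplus_{n\ge0}Z(n)$ with $u_mZ(n)\subset Z(n+\mathrm{wt}\,u-m-1)$ for homogeneous $u\in V$. $V$ is rational if every admissible $V$-module is completely reducible. The Zhu algebra is $A(V)=V/O(V)$, with product induced by $u*v=\sum_{i\ge0}\binom{\mathrm{wt}\,u}{i}u_{i-1}v$ and $O(V)$ spanned by $\sum_{i\ge0}\binom{\mathrm{wt}\,u}{i}u_{i-2}v$ ($u$ homogeneous). The top level $Z(0)$ of an admissible module is an $A(V)$-module, $[u]$ acting as $u_{\mathrm{wt}\,u-1}$. A "$V$-module generated by an irreducible $A(V)$-module $U$" means an admissible $V$-module $Z$ whose top level is $Z(0)=U$, irreducible as an $A(V)$-module, and which is generated by $U$ as a $V$-module. *)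

theory Defs
  imports
    Complex_Main
    "HOL-Library.Groups_Big_Fun"
    "HOL-Computational_Algebra.Polynomial"
    "HOL-Algebra.AbelCoset"
begin

section \<open>Direct sums inside an ambient complex vector space\<close>

definition direct_sum_of ::
  "(complex \<Rightarrow> 'm \<Rightarrow> 'm) \<Rightarrow> 'm::ab_group_add set \<Rightarrow> 'i set \<Rightarrow> ('i \<Rightarrow> 'm set) \<Rightarrow> bool" where
  "direct_sum_of s W I G \<longleftrightarrow>
     (\<forall>i\<in>I. module.subspace s (G i)) \<and>
     W = module.span s (\<Union>i\<in>I. G i) \<and>
     (\<forall>J f. finite J \<and> J \<subseteq> I \<and> (\<forall>j\<in>J. f j \<in> G j) \<and> (\<Sum>j\<in>J. f j) = 0 \<longrightarrow> (\<forall>j\<in>J. f j = 0))"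


section \<open>Vertex operator algebras\<close>

text \<open>
  \<open>vmode V u n v\<close> is $u_n v$, where $Y(u,z) = \sum_n u_n z^{-n-1}$. The underlying space of a
  vertex operator algebra is a whole type; modules have a carrier \<open>mspace Z\<close>, a subspace of
  an ambient vector space, so that modules of every size up to that of the ambient type occur.
\<close>

record 'v voa =
  vscale :: "complex \<Rightarrow> 'v \<Rightarrow> 'v"
  vmode :: "'v \<Rightarrow> int \<Rightarrow> 'v \<Rightarrow> 'v"
  vacuum :: 'v
  conformal :: 'v
  vgrade :: "nat \<Rightarrow> 'v set"

record ('v, 'm) vmod =
  mscale :: "complex \<Rightarrow> 'm \<Rightarrow> 'm"
  mspace :: "'m set"
  mmode :: "'v \<Rightarrow> int \<Rightarrow> 'm \<Rightarrow> 'm"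
  mgrade :: "nat \<Rightarrow> 'm set"

text \<open>
  The Jacobi identity in components (Borcherds identity), for the action \<open>act\<close> of $V$
  on a space with scalar multiplication \<open>s\<close>, evaluated at $u, v \in V$ and a vector $w$:
  \[ \sum_{i\ge0} {m \choose i} (u_{l+i}v)_{m+n-i} w =
     \sum_{i\ge0} (-1)^i {l \choose i} (u_{m+l-i}v_{n+i} w - (-1)^l v_{n+l-i}u_{m+i} w). \]
  By truncation all but finitely many terms vanish on either side, so that
  \<open>Sum_any\<close> (the sum over the support) is the intended sum.
\<close>

definition borcherds_identity ::
  "('v \<Rightarrow> int \<Rightarrow> 'v \<Rightarrow> 'v) \<Rightarrow> (complex \<Rightarrow> 'm \<Rightarrow> 'm) \<Rightarrow> ('v \<Rightarrow> int \<Rightarrow> 'm \<Rightarrow> 'm)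
    \<Rightarrow> 'v \<Rightarrow> 'v \<Rightarrow> 'm::ab_group_add \<Rightarrow> bool" where
  "borcherds_identity Y s act u v w \<longleftrightarrow>
     (\<forall>l m n :: int.
        Sum_any (\<lambda>i::nat. s (of_int m gchoose i) (act (Y u (l + int i) v) (m + n - int i) w)) =
        Sum_any (\<lambda>i::nat. s ((-1) ^ i * (of_int l gchoose i))
            (act u (m + l - int i) (act v (n + int i) w)
             - s ((-1) powi l) (act v (n + l - int i) (act u (m + int i) w)))))"

locale vertex_operator_algebra = vector_space "vscale V"
  for V :: "'v::ab_group_add voa" +
  assumes mode_linear: "Vector_Spaces.linear (vscale V) (vscale V) (vmode V u n)"
    and mode_linear_left: "Vector_Spaces.linear (vscale V) (vscale V) (\<lambda>u. vmode V u n v)"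
    and truncation: "\<exists>N. \<forall>n\<ge>N. vmode V u n v = 0"
    and vacuum_mode: "vmode V (vacuum V) n v = (if n = -1 then v else 0)"
    and creation: "vmode V u (-1) (vacuum V) = u" "n \<ge> 0 \<Longrightarrow> vmode V u n (vacuum V) = 0"
    and borcherds: "borcherds_identity (vmode V) (vscale V) (vmode V) u v w"
    and grading: "direct_sum_of (vscale V) UNIV UNIV (vgrade V)"
    and grade_finite_dim: "\<exists>B. finite B \<and> vgrade V k = span B"
    and vacuum_grade: "vacuum V \<in> vgrade V 0"
    and conformal_grade: "conformal V \<in> vgrade V 2"
      \<comment> \<open>$L(m) = \omega_{m+1}$, with some central charge \<open>c\<close>\<close>
    and virasoro: "\<exists>c. \<forall>m n v.
        vmode V (conformal V) (m + 1) (vmode V (conformal V) (n + 1) v)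
        - vmode V (conformal V) (n + 1) (vmode V (conformal V) (m + 1) v)
        = vscale V (of_int (m - n)) (vmode V (conformal V) (m + n + 1) v)
          + (if m + n = 0 then vscale V (of_int (m ^ 3 - m) / 12 * c) v else 0)"
    and L0_grade: "u \<in> vgrade V k \<Longrightarrow> vmode V (conformal V) 1 u = vscale V (of_nat k) u"
    and L_minus1_derivative:
      "vmode V (vmode V (conformal V) 0 u) n v = vscale V (- of_int n) (vmode V u (n - 1) v)"

definition C2 :: "'v::ab_group_add voa \<Rightarrow> 'v set" where
  "C2 V = module.span (vscale V) {vmode V u (-2) v | u v. True}"

text \<open>The classes of finitely many vectors span the quotient of $V$ by \<open>C2 V\<close>.\<close>

definition C2_cofinite :: "'v::ab_group_add voa \<Rightarrow> bool" where
  "C2_cofinite V \<longleftrightarrow> (\<exists>B. finite B \<and> (\<forall>v. \<exists>b\<in>module.span (vscale V) B. v - b \<in> C2 V))"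


section \<open>The Zhu algebra\<close>

definition hcomp :: "'v::ab_group_add voa \<Rightarrow> 'v \<Rightarrow> nat \<Rightarrow> 'v" where
  "hcomp V u = (THE f. (\<forall>k. f k \<in> vgrade V k) \<and> finite {k. f k \<noteq> 0} \<and> u = Sum_any f)"

text \<open>
  The product $u * v$ is given for homogeneous $u$ and extended linearly in $u$. The sums over
  $i$ stop at the weight of $u$, beyond which the binomial coefficients vanish.
\<close>

definition zhu_prod :: "'v::ab_group_add voa \<Rightarrow> 'v \<Rightarrow> 'v \<Rightarrow> 'v" where
  "zhu_prod V u v =
     Sum_any (\<lambda>k. \<Sum>i\<le>k. vscale V (of_nat (k choose i)) (vmode V (hcomp V u k) (int i - 1) v))"

definition zhu_O :: "'v::ab_group_add voa \<Rightarrow> 'v set" where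
  "zhu_O V = module.span (vscale V)
     {\<Sum>i\<le>k. vscale V (of_nat (k choose i)) (vmode V u (int i - 2) v) | k u v. u \<in> vgrade V k}"

definition zhu_class :: "'v::ab_group_add voa \<Rightarrow> 'v \<Rightarrow> 'v set" where
  "zhu_class V u = {v. v - u \<in> zhu_O V}"

text \<open>
  Operations on classes are unions over all representatives; as the operations are
  well defined, every member of such a union is the same class.
\<close>

definition zhu_algebra :: "'v::ab_group_add voa \<Rightarrow> 'v set ring" where
  "zhu_algebra V =
     \<lparr>carrier = range (zhu_class V),
      mult = (\<lambda>A B. \<Union>u\<in>A. \<Union>v\<in>B. zhu_class V (zhu_prod V u v)),
      one = zhu_class V (vacuum V),
      zero = zhu_class V 0,
      add = (\<lambda>A B. \<Union>u\<in>A. \<Union>v\<in>B. zhu_class V (u + v))\<rparr>"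

definition left_ideal :: "'r set \<Rightarrow> ('r, 'x) ring_scheme \<Rightarrow> bool" where
  "left_ideal I R \<longleftrightarrow>
     additive_subgroup I R \<and> (\<forall>a\<in>carrier R. \<forall>x\<in>I. a \<otimes>\<^bsub>R\<^esub> x \<in> I)"

text \<open>
  The left regular module is semisimple. In a unital algebra over a field, such as the
  Zhu algebra, left ideals are subspaces, so scalars need not be mentioned.
\<close>

definition semisimple_ring :: "('r, 'x) ring_scheme \<Rightarrow> bool" where
  "semisimple_ring R \<longleftrightarrow> Ring.ring R \<and>
     (\<forall>I. left_ideal I R \<longrightarrow>
        (\<exists>J. left_ideal J R \<and> I \<inter> J = {\<zero>\<^bsub>R\<^esub>} \<and> I <+>\<^bsub>R\<^esub> J = carrier R))"


section \<open>Modules\<close>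

locale weak_module = vector_space "mscale Z"
  for V :: "'v::ab_group_add voa" and Z :: "('v, 'm::ab_group_add) vmod" +
  assumes space_subspace: "subspace (mspace Z)"
    and mode_closed: "w \<in> mspace Z \<Longrightarrow> mmode Z u n w \<in> mspace Z"
    and mode_add: "w \<in> mspace Z \<Longrightarrow> w' \<in> mspace Z \<Longrightarrow>
        mmode Z u n (w + w') = mmode Z u n w + mmode Z u n w'"
    and mode_scale: "w \<in> mspace Z \<Longrightarrow>
        mmode Z u n (mscale Z a w) = mscale Z a (mmode Z u n w)"
    and mode_add_left: "w \<in> mspace Z \<Longrightarrow>
        mmode Z (u + u') n w = mmode Z u n w + mmode Z u' n w"
    and mode_scale_left: "w \<in> mspace Z \<Longrightarrow>
        mmode Z (vscale V a u) n w = mscale Z a (mmode Z u n w)"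
    and truncation: "w \<in> mspace Z \<Longrightarrow> \<exists>N. \<forall>n\<ge>N. mmode Z u n w = 0"
    and vacuum_mode: "w \<in> mspace Z \<Longrightarrow>
        mmode Z (vacuum V) n w = (if n = -1 then w else 0)"
    and borcherds: "w \<in> mspace Z \<Longrightarrow>
        borcherds_identity (vmode V) (mscale Z) (mmode Z) u v w"

locale admissible_module = weak_module V Z
  for V :: "'v::ab_group_add voa" and Z :: "('v, 'm::ab_group_add) vmod" +
  assumes grading: "direct_sum_of (mscale Z) (mspace Z) UNIV (mgrade Z)"
    and mode_grade: "u \<in> vgrade V k \<Longrightarrow> w \<in> mgrade Z n \<Longrightarrow> int n + int k - m - 1 \<ge> 0 \<Longrightarrow>
        mmode Z u m w \<in> mgrade Z (nat (int n + int k - m - 1))"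
    and mode_grade_neg: "u \<in> vgrade V k \<Longrightarrow> w \<in> mgrade Z n \<Longrightarrow> int n + int k - m - 1 < 0 \<Longrightarrow>
        mmode Z u m w = 0"

definition submodule :: "('v, 'm::ab_group_add) vmod \<Rightarrow> 'm set \<Rightarrow> bool" where
  "submodule Z S \<longleftrightarrow> module.subspace (mscale Z) S \<and> S \<subseteq> mspace Z \<and>
     (\<forall>u n. \<forall>w\<in>S. mmode Z u n w \<in> S)"

definition admissible_submodule :: "('v, 'm::ab_group_add) vmod \<Rightarrow> 'm set \<Rightarrow> bool" where
  "admissible_submodule Z S \<longleftrightarrow> submodule Z S \<and>
     direct_sum_of (mscale Z) S UNIV (\<lambda>n. S \<inter> mgrade Z n)"

definition restrict_module ::
  "('v, 'm::ab_group_add) vmod \<Rightarrow> 'm set \<Rightarrow> ('v, 'm) vmod" where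
  "restrict_module Z S = Z\<lparr>mspace := S, mgrade := (\<lambda>n. S \<inter> mgrade Z n)\<rparr>"

definition irreducible_module ::
  "'v::ab_group_add voa \<Rightarrow> ('v, 'm::ab_group_add) vmod \<Rightarrow> bool" where
  "irreducible_module V Z \<longleftrightarrow> admissible_module V Z \<and> mspace Z \<noteq> {0} \<and>
     (\<forall>S. admissible_submodule Z S \<longrightarrow> S = {0} \<or> S = mspace Z)"

definition completely_reducible ::
  "'v::ab_group_add voa \<Rightarrow> ('v, 'm::ab_group_add) vmod \<Rightarrow> bool" where
  "completely_reducible V Z \<longleftrightarrow>
     (\<exists>\<S>. (\<forall>S\<in>\<S>. admissible_submodule Z S \<and> irreducible_module V (restrict_module Z S)) \<and>
          direct_sum_of (mscale Z) (mspace Z) \<S> (\<lambda>S. S))"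

text \<open>
  HOL cannot quantify over types inside a formula: this speaks about the admissible modules
  carried by subspaces of vector space structures on \<open>'m\<close>. Rationality of \<open>V\<close> is
  \<open>rational TYPE('m) V\<close> for every type \<open>'m\<close>.
\<close>

definition rational :: "'m::ab_group_add itself \<Rightarrow> 'v::ab_group_add voa \<Rightarrow> bool" where
  "rational _ V \<longleftrightarrow>
     (\<forall>Z :: ('v, 'm) vmod. admissible_module V Z \<longrightarrow> completely_reducible V Z)"

text \<open>
  The action of the class of $u$ in the Zhu algebra on the top level: $u_{\mathrm{wt}\,u-1}$,
  extended linearly from homogeneous $u$.
\<close>

definition zero_mode ::
  "'v::ab_group_add voa \<Rightarrow> ('v, 'm::ab_group_add) vmod \<Rightarrow> 'v \<Rightarrow> 'm \<Rightarrow> 'm" where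
  "zero_mode V Z u w = Sum_any (\<lambda>k. mmode Z (hcomp V u k) (int k - 1) w)"

definition irreducible_top_level ::
  "'v::ab_group_add voa \<Rightarrow> ('v, 'm::ab_group_add) vmod \<Rightarrow> bool" where
  "irreducible_top_level V Z \<longleftrightarrow> mgrade Z 0 \<noteq> {0} \<and>
     (\<forall>S. module.subspace (mscale Z) S \<and> S \<subseteq> mgrade Z 0 \<and> (\<forall>u. \<forall>w\<in>S. zero_mode V Z u w \<in> S)
        \<longrightarrow> S = {0} \<or> S = mgrade Z 0)"

text \<open>
  Such a module has countable dimension: $V$ does, hence so does the irreducible top level
  (it is cyclic over the Zhu algebra), and the module is spanned by iterated modes of elements
  of a basis of $V$ applied to a single vector. So each of them is isomorphic to one
  carried by a subspace of \<open>complex poly\<close>, a complex space of countably infinite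
  dimension, and a statement about all of them need only consider that ambient type.
\<close>

definition generated_by_irreducible_top ::
  "'v::ab_group_add voa \<Rightarrow> ('v, 'm::ab_group_add) vmod \<Rightarrow> bool" where
  "generated_by_irreducible_top V Z \<longleftrightarrow> admissible_module V Z \<and>
     irreducible_top_level V Z \<and>
     (\<forall>S. submodule Z S \<and> mgrade Z 0 \<subseteq> S \<longrightarrow> S = mspace Z)"

end

theory Submission
  imports
    Defs
    "HOL-Library.Function_Algebras"
    "HOL-Library.Countable_Set"
    "HOL-Computational_Algebra.Formal_Power_Series"
begin

text \<open>
  A vector $t$ of degree $j$ that is killed by all modes lowering the degree generates a
  finite-dimensional module over the semisimple Zhu algebra. It is therefore a sum of vectors generating
  irreducible modules over the Zhu algebra, and so by hypothesis lies in the socle.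

  Let $x$ be of degree $n$ and let $j < n$ be the lowest degree of the submodule $X$ that $x$ generates.
  The bottom $X(j)$ consists of such vectors, so the submodule $Q$ it generates lies in the socle. Some
  $w \in Q(n)$ has the same images in $X(j)$ as $x$ under all modes: otherwise, $Q(n)$ being
  finite-dimensional, there is a nonzero $g$ in the submodule $D$ of the contragredient module $X'$
  generated by $X(j)^*$ that vanishes on $Q(n)$. Then no mode takes $g$ to a nonzero
  element of $X(j)^*$, but $D$ is a sum of irreducible modules with nonzero component of degree $j$.
  Replacing $x$ by $x - w$ and repeating this, $x$ becomes a vector killed by all lowering modes
  after subtracting an element of the socle, so $x$ is in the socle.

  The spaces $X(j)$ and $Q(n)$ are finite-dimensional because $C_2$-cofiniteness implies that
  the span of all $u_{-N}v$ has finite codimension for every $N \ge 2$.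
\<close>


section \<open>Graded vector spaces\<close>

text \<open>The hypotheses control what is generated from a lowest degree upwards, whereas a vector
  \<open>x\<close> that reaches a lower degree poses an extension problem in the opposite direction.
  Transposition reverses the direction: the modes that take \<open>x\<close> down to degree
  \<open>j\<close> become modes that lead upwards from functionals of degree \<open>j\<close>, and
  these generate a module to which the same hypotheses apply.

  Homogeneous parts of \<open>Z\<close> may have infinite dimension, so \<open>Z\<close> cannot be
  recovered from its dual. Hence the dual serves only to solve finitely many linear equations, and
  the finite spanning sets provided by cofiniteness are carried through the argument.

  The price is the Borcherds identity for the transposed modes. It is obtained from finite sums and
  binomial identities, by a Leibniz rule for the divided powers of L(1).

  The hypothesis on generated modules concerns subspaces of \<open>complex poly\<close> only, but is
  applied inside \<open>Z\<close> and inside a space of functions on \<open>Z\<close>. A cyclic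
  submodule has countable dimension, so it embeds into the polynomials; its grading is shifted to
  start at 0.\<close>

lemma Sum_any_eq_sum_lessThan:
  fixes f :: "nat \<Rightarrow> 'a::comm_monoid_add"
  assumes "\<And>i. i \<ge> K \<Longrightarrow> f i = 0"
  shows "Sum_any f = sum f {..<K}"
  by (rule Sum_any.expand_superset) (use assms in \<open>auto simp: not_less[symmetric]\<close>)

text \<open>This is \<open>hcomp\<close> for an arbitrary grading, so that one set of lemmas serves
  the degrees of \<open>V\<close>, of modules and of their duals.\<close>

definition gcomp :: "(nat \<Rightarrow> 'm::ab_group_add set) \<Rightarrow> 'm \<Rightarrow> nat \<Rightarrow> 'm" where
  "gcomp G u = (THE f. (\<forall>k. f k \<in> G k) \<and> finite {k. f k \<noteq> 0} \<and> u = Sum_any f)"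

lemma hcomp_eq_gcomp: "hcomp V u = gcomp (vgrade V) u"
  by (simp add: hcomp_def gcomp_def)

locale graded_space = vector_space s
  for s :: "complex \<Rightarrow> 'm::ab_group_add \<Rightarrow> 'm" +
  fixes W :: "'m set" and G :: "nat \<Rightarrow> 'm set"
  assumes direct: "direct_sum_of s W UNIV G"
begin

lemma subspace_grade: "subspace (G k)"
  using direct by (simp add: direct_sum_of_def)

lemma space_eq: "W = span (\<Union>k. G k)"
  using direct by (simp add: direct_sum_of_def)

lemma subspace_space: "subspace W"
  by (simp add: space_eq)

lemma grade_subset: "G k \<subseteq> W"
  by (auto simp: space_eq intro: span_base)

lemma grade_independent:
  assumes "finite J" "\<And>j. j \<in> J \<Longrightarrow> f j \<in> G j" "(\<Sum>j\<in>J. f j) = 0" "j \<in> J"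
  shows "f j = 0"
proof -
  have "\<forall>J f. finite J \<and> J \<subseteq> UNIV \<and> (\<forall>j\<in>J. f j \<in> G j) \<and> (\<Sum>j\<in>J. f j) = 0 \<longrightarrow> (\<forall>j\<in>J. f j = 0)"
    using direct unfolding direct_sum_of_def by blast
  then show ?thesis using assms by blast
qed

lemma decomposition_unique:
  assumes f: "\<And>k. f k \<in> G k" "finite {k. f k \<noteq> 0}"
    and g: "\<And>k. g k \<in> G k" "finite {k. g k \<noteq> 0}"
    and eq: "Sum_any f = Sum_any g"
  shows "f = g"
proof -
  define J where "J = {k. f k \<noteq> 0} \<union> {k. g k \<noteq> 0}"
  have J: "finite J" using f g by (simp add: J_def)
  have "Sum_any f = sum f J" "Sum_any g = sum g J"
    by (rule Sum_any.expand_superset[OF J], force simp: J_def)+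
  then have "(\<Sum>j\<in>J. f j - g j) = 0" using eq by (simp add: sum_subtractf)
  then have "f j - g j = 0" if "j \<in> J" for j
    using grade_independent[OF J, of "\<lambda>j. f j - g j"] f g subspace_grade subspace_diff that by blast
  moreover have "f j = g j" if "j \<notin> J" for j using that by (auto simp: J_def)
  ultimately show ?thesis by (metis eq_iff_diff_eq_0 ext)
qed

lemma gcomp_eqI:
  assumes "\<And>k. f k \<in> G k" "finite {k. f k \<noteq> 0}" "u = Sum_any f"
  shows "gcomp G u = f"
  unfolding gcomp_def
  by (rule the_equality) (use assms decomposition_unique in blast)+

lemma finite_support_add:
  fixes f g :: "nat \<Rightarrow> 'm"
  assumes "finite {k. f k \<noteq> 0}" "finite {k. g k \<noteq> 0}"
  shows "finite {k. f k + g k \<noteq> 0}"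
  by (rule finite_subset[OF _ finite_UnI[OF assms]]) auto

lemma decomposition_exists:
  assumes "u \<in> W"
  shows "\<exists>f. (\<forall>k. f k \<in> G k) \<and> finite {k. f k \<noteq> 0} \<and> u = Sum_any f"
  using assms unfolding space_eq
proof (induction rule: span_induct_alt)
  case base
  show ?case by (rule exI[of _ "\<lambda>_. 0"]) (simp add: subspace_0[OF subspace_grade])
next
  case (step c x y)
  then obtain j f where x: "x \<in> G j" and f: "\<forall>k. f k \<in> G k" "finite {k. f k \<noteq> 0}" "y = Sum_any f" by blast
  let ?d = "\<lambda>k. if k = j then s c x else 0"
  let ?g = "\<lambda>k. ?d k + f k"
  have d: "finite {k. ?d k \<noteq> 0}" by (rule finite_subset[of _ "{j}"]) auto
  have "Sum_any ?g = Sum_any ?d + Sum_any f" by (rule Sum_any.distrib[OF d f(2)])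
  also have "Sum_any ?d = s c x" by (rule Sum_any.delta)
  finally have "s c x + y = Sum_any ?g" using f by simp
  moreover have "\<forall>k. ?g k \<in> G k"
    using f x subspace_grade subspace_add subspace_scale by auto
  moreover have "finite {k. ?g k \<noteq> 0}" by (rule finite_support_add[OF d f(2)])
  ultimately show ?case by (intro exI[of _ ?g]) blast
qed

lemma gcomp_props:
  assumes "u \<in> W"
  shows gcomp_in: "gcomp G u k \<in> G k" and gcomp_finite: "finite {k. gcomp G u k \<noteq> 0}"
    and gcomp_sum_any: "Sum_any (gcomp G u) = u"
proof -
  obtain f where f: "\<forall>k. f k \<in> G k" "finite {k. f k \<noteq> 0}" "u = Sum_any f"
    using decomposition_exists[OF assms] by blast
  then have "gcomp G u = f" by (intro gcomp_eqI) auto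
  then show "gcomp G u k \<in> G k" "finite {k. gcomp G u k \<noteq> 0}" "Sum_any (gcomp G u) = u"
    using f by auto
qed

lemma gcomp_in_space: "u \<in> W \<Longrightarrow> gcomp G u k \<in> W"
  using gcomp_in grade_subset by blast

lemma gcomp_sum: "u \<in> W \<Longrightarrow> (\<Sum>k | gcomp G u k \<noteq> 0. gcomp G u k) = u"
  using gcomp_sum_any by (simp add: Sum_any.expand_set)

lemma gcomp_bounded: "u \<in> W \<Longrightarrow> \<exists>K. \<forall>k\<ge>K. gcomp G u k = 0"
proof -
  assume "u \<in> W"
  then have "finite {k. gcomp G u k \<noteq> 0}" by (rule gcomp_finite)
  then obtain K where "\<forall>k\<in>{k. gcomp G u k \<noteq> 0}. k < K" using finite_nat_set_iff_bounded by auto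
  then show ?thesis by (intro exI[of _ K]) (auto simp: not_less[symmetric])
qed

lemma gcomp_add:
  assumes "u \<in> W" "v \<in> W"
  shows "gcomp G (u + v) k = gcomp G u k + gcomp G v k"
proof -
  have "gcomp G (u + v) = (\<lambda>k. gcomp G u k + gcomp G v k)"
    using assms by (intro gcomp_eqI finite_support_add subspace_add[OF subspace_grade])
      (simp_all add: gcomp_in gcomp_finite gcomp_sum_any Sum_any.distrib)
  then show ?thesis by simp
qed

lemma gcomp_hom: "u \<in> G j \<Longrightarrow> gcomp G u k = (if k = j then u else 0)"
proof -
  assume u: "u \<in> G j"
  have "gcomp G u = (\<lambda>k. if k = j then u else 0)"
    by (rule gcomp_eqI)
      (use u subspace_0[OF subspace_grade] in \<open>auto intro: finite_subset[of _ "{j}"]\<close>)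
  then show ?thesis by simp
qed

lemma gcomp_0 [simp]: "gcomp G 0 k = 0"
  using gcomp_hom[of 0 k k] subspace_0[OF subspace_grade] by simp

lemma gcomp_scale:
  assumes "u \<in> W"
  shows "gcomp G (s c u) k = s c (gcomp G u k)"
proof -
  have fin: "finite {k. s c (gcomp G u k) \<noteq> 0}"
    by (rule finite_subset[OF _ gcomp_finite[OF assms]]) auto
  have "gcomp G (s c u) = (\<lambda>k. s c (gcomp G u k))"
  proof (rule gcomp_eqI)
    show "s c (gcomp G u k) \<in> G k" for k
      using assms by (intro subspace_scale[OF subspace_grade] gcomp_in)
    show "finite {k. s c (gcomp G u k) \<noteq> 0}" by (rule fin)
    have "Sum_any (\<lambda>k. s c (gcomp G u k)) = (\<Sum>k | gcomp G u k \<noteq> 0. s c (gcomp G u k))"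
      by (rule Sum_any.expand_superset[OF gcomp_finite[OF assms]]) auto
    then show "s c u = Sum_any (\<lambda>k. s c (gcomp G u k))"
      by (simp add: scale_sum_right[symmetric] gcomp_sum[OF assms])
  qed
  then show ?thesis by simp
qed

lemma gcomp_neg: "u \<in> W \<Longrightarrow> gcomp G (- u) k = - gcomp G u k"
  using gcomp_scale[of u "-1" k] by simp

lemma gcomp_diff: "u \<in> W \<Longrightarrow> v \<in> W \<Longrightarrow> gcomp G (u - v) k = gcomp G u k - gcomp G v k"
  using gcomp_add[of u "-v" k] gcomp_neg[of v k] subspace_neg[OF subspace_space] by simp

text \<open>The components of a homogeneous generator are itself and 0, so taking components never
  leaves a span of homogeneous vectors.\<close>

lemma gcomp_span:
  assumes A: "A \<subseteq> (\<Union>k. G k)" and x: "x \<in> span A"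
  shows "gcomp G x k \<in> span (A \<inter> G k)"
proof -
  have "x \<in> W \<and> gcomp G x k \<in> span (A \<inter> G k)"
    using x
  proof (induction rule: span_induct_alt)
    case base show ?case by (simp add: span_zero subspace_0[OF subspace_space])
  next
    case (step c a y)
    obtain j where j: "a \<in> G j" using A step by blast
    have W: "a \<in> W" using j grade_subset by blast
    have y: "y \<in> W" using step by blast
    have "gcomp G (s c a + y) k = s c (if k = j then a else 0) + gcomp G y k"
      using W y j subspace_scale[OF subspace_space W] by (simp add: gcomp_add gcomp_scale gcomp_hom)
    also have "\<dots> \<in> span (A \<inter> G k)"
      using step j by (cases "k = j") (simp_all add: span_add span_scale span_base)
    finally show ?case
      using W y by (simp add: subspace_add[OF subspace_space] subspace_scale[OF subspace_space])
  qed
  then show ?thesis ..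
qed

lemma span_Int_grade:
  assumes "A \<subseteq> (\<Union>k. G k)"
  shows "span A \<inter> G k = span (A \<inter> G k)"
proof
  show "span A \<inter> G k \<subseteq> span (A \<inter> G k)"
    using gcomp_span[OF assms, of _ k] gcomp_hom by fastforce
  have "span (A \<inter> G k) \<subseteq> G k" by (rule span_minimal) (auto simp: subspace_grade)
  then show "span (A \<inter> G k) \<subseteq> span A \<inter> G k" using span_mono[of "A \<inter> G k" A] by blast
qed

text \<open>Closure under components passes at once to sums and intersections of submodules, which
  the formulation by direct sums does not show.\<close>

lemma graded_subspace_iff:
  assumes S: "subspace S" "S \<subseteq> W"
  shows "direct_sum_of s S UNIV (\<lambda>n. S \<inter> G n) \<longleftrightarrow> (\<forall>x\<in>S. \<forall>k. gcomp G x k \<in> S)"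
proof
  assume D: "direct_sum_of s S UNIV (\<lambda>n. S \<inter> G n)"
  show "\<forall>x\<in>S. \<forall>k. gcomp G x k \<in> S"
  proof (intro ballI allI)
    fix x k assume "x \<in> S"
    then have x: "x \<in> span (\<Union>n. S \<inter> G n)" using D by (simp add: direct_sum_of_def)
    have "gcomp G x k \<in> span ((\<Union>n. S \<inter> G n) \<inter> G k)" by (rule gcomp_span[OF _ x]) blast
    also have "\<dots> \<subseteq> S" by (rule span_minimal) (use S in auto)
    finally show "gcomp G x k \<in> S" .
  qed
next
  assume c: "\<forall>x\<in>S. \<forall>k. gcomp G x k \<in> S"
  have "x \<in> span (\<Union>n. S \<inter> G n)" if x: "x \<in> S" for x
  proof -
    have xW: "x \<in> W" using x S by blast
    have "(\<Sum>k | gcomp G x k \<noteq> 0. gcomp G x k) \<in> span (\<Union>n. S \<inter> G n)"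
      by (rule span_sum, rule span_base) (use c x gcomp_in[OF xW] in blast)
    then show ?thesis using gcomp_sum[OF xW] by simp
  qed
  moreover have "span (\<Union>n. S \<inter> G n) \<subseteq> S" by (rule span_minimal) (use S in auto)
  moreover have "subspace (S \<inter> G n)" for n using S(1) subspace_grade by (rule subspace_inter)
  ultimately show "direct_sum_of s S UNIV (\<lambda>n. S \<inter> G n)"
    unfolding direct_sum_of_def using grade_independent by blast
qed

end

lemma direct_sum_ofI:
  assumes "vector_space s" "\<And>i. module.subspace s (G i)" "W = module.span s (\<Union>i. G i)"
    and "\<And>J f j. finite J \<Longrightarrow> (\<And>j. j \<in> J \<Longrightarrow> f j \<in> G j) \<Longrightarrow> (\<Sum>j\<in>J. f j) = 0 \<Longrightarrow> j \<in> J \<Longrightarrow> f j = 0"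
  shows "direct_sum_of s W UNIV G"
  unfolding direct_sum_of_def using assms by blast

section \<open>Consequences of the Borcherds identity\<close>

text \<open>The summands get names because \<open>Sum_any\<close> is 0 for infinite support: each
  use of the identity bounds both supports and then compares ordinary finite sums.\<close>

definition borcherds_lhs where
  "borcherds_lhs Y s act u v w l m n i =
     s (of_int m gchoose i) (act (Y u (l + int i) v) (m + n - int i) w)"

definition borcherds_rhs where
  "borcherds_rhs s act u v w l m n i =
     s ((-1) ^ i * (of_int l gchoose i))
       (act u (m + l - int i) (act v (n + int i) w)
        - s ((-1) powi l) (act v (n + l - int i) (act u (m + int i) w)))"

lemma borcherds_identity_alt:
  "borcherds_identity Y s act u v w \<longleftrightarrow>
     (\<forall>l m n. Sum_any (borcherds_lhs Y s act u v w l m n) = Sum_any (borcherds_rhs s act u v w l m n))"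
  by (simp add: borcherds_identity_def borcherds_lhs_def[abs_def] borcherds_rhs_def[abs_def])

lemma borcherds_identityI:
  assumes "\<And>l m n. \<exists>K. (\<forall>i\<ge>K. borcherds_lhs Y s act u v w l m n i = 0) \<and>
      (\<forall>i\<ge>K. borcherds_rhs s act u v w l m n i = 0) \<and>
      (\<Sum>i<K. borcherds_lhs Y s act u v w l m n i) = (\<Sum>i<K. borcherds_rhs s act u v w l m n i)"
  shows "borcherds_identity Y s act u v w"
  unfolding borcherds_identity_alt
proof (intro allI)
  fix l m n :: int
  obtain K where "\<forall>i\<ge>K. borcherds_lhs Y s act u v w l m n i = 0"
    "\<forall>i\<ge>K. borcherds_rhs s act u v w l m n i = 0"
    "(\<Sum>i<K. borcherds_lhs Y s act u v w l m n i) = (\<Sum>i<K. borcherds_rhs s act u v w l m n i)"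
    using assms by blast
  then show "Sum_any (borcherds_lhs Y s act u v w l m n) = Sum_any (borcherds_rhs s act u v w l m n)"
    using Sum_any_eq_sum_lessThan[of K "borcherds_lhs Y s act u v w l m n"]
      Sum_any_eq_sum_lessThan[of K "borcherds_rhs s act u v w l m n"] by simp
qed

section \<open>Weak modules: finite sums, commutators and cyclic submodules\<close>

locale voa_weak_module = V: vertex_operator_algebra V + weak_module V Z
  for V :: "'v::ab_group_add voa" and Z :: "('v, 'm::ab_group_add) vmod"
begin

abbreviation "mode \<equiv> mmode Z"
abbreviation "lhs \<equiv> borcherds_lhs (vmode V) (mscale Z) (mmode Z)"
abbreviation "rhs \<equiv> borcherds_rhs (mscale Z) (mmode Z)"

lemma mode_zero [simp]: "mode u n 0 = 0"
  using mode_scale[of 0 u n 0] subspace_0[OF space_subspace] by simp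

lemma mode_zero_left [simp]: "w \<in> mspace Z \<Longrightarrow> mode 0 n w = 0"
  using mode_scale_left[of w 0 0 n] by simp

lemma mode_sum: "(\<And>a. a \<in> A \<Longrightarrow> f a \<in> mspace Z) \<Longrightarrow> mode u n (sum f A) = (\<Sum>a\<in>A. mode u n (f a))"
  by (induction A rule: infinite_finite_induct)
    (simp_all add: mode_add subspace_sum[OF space_subspace])

lemma mode_sum_left: "w \<in> mspace Z \<Longrightarrow> mode (sum f A) n w = (\<Sum>a\<in>A. mode (f a) n w)"
  by (induction A rule: infinite_finite_induct) (simp_all add: mode_add_left)

lemma borcherds_support:
  assumes w: "w \<in> mspace Z"
  shows "\<exists>K. \<forall>i\<ge>K. lhs u v w l m n i = 0 \<and> rhs u v w l m n i = 0"
proof -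
  obtain N1 where N1: "\<forall>k\<ge>N1. vmode V u k v = 0" using V.truncation by blast
  obtain N2 where N2: "\<forall>k\<ge>N2. mode v k w = 0" using truncation[OF w] by blast
  obtain N3 where N3: "\<forall>k\<ge>N3. mode u k w = 0" using truncation[OF w] by blast
  have "lhs u v w l m n i = 0 \<and> rhs u v w l m n i = 0"
    if "i \<ge> nat (max (N1 - l) (max (N2 - n) (N3 - m)))" for i
  proof -
    have "l + int i \<ge> N1" "n + int i \<ge> N2" "m + int i \<ge> N3" using that by linarith+
    then show ?thesis using N1 N2 N3 w by (simp add: borcherds_lhs_def borcherds_rhs_def)
  qed
  then show ?thesis by blast
qed

text \<open>Every sufficiently large bound works, so several instances can share one, and a bound
  can be enlarged to expose a chosen summand.\<close>

lemma borcherds_sums: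
  assumes w: "w \<in> mspace Z"
  shows "\<exists>K0. \<forall>K\<ge>K0. (\<Sum>i<K. lhs u v w l m n i) = (\<Sum>i<K. rhs u v w l m n i)"
proof -
  obtain K0 where K0: "\<forall>i\<ge>K0. lhs u v w l m n i = 0 \<and> rhs u v w l m n i = 0"
    using borcherds_support[OF w] by blast
  have "(\<Sum>i<K. lhs u v w l m n i) = (\<Sum>i<K. rhs u v w l m n i)" if K: "K \<ge> K0" for K
  proof -
    have "Sum_any (lhs u v w l m n) = sum (lhs u v w l m n) {..<K}"
      by (rule Sum_any_eq_sum_lessThan) (use K0 K in force)
    moreover have "Sum_any (rhs u v w l m n) = sum (rhs u v w l m n) {..<K}"
      by (rule Sum_any_eq_sum_lessThan) (use K0 K in force)
    moreover have "Sum_any (lhs u v w l m n) = Sum_any (rhs u v w l m n)"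
      using borcherds[OF w, of u v] by (simp add: borcherds_identity_alt)
    ultimately show ?thesis by simp
  qed
  then show ?thesis by blast
qed

text \<open>The case l = 0: the binomial coefficient of 0 over i removes all of the right side but i
  = 0.\<close>

lemma commutator:
  assumes w: "w \<in> mspace Z"
  shows "\<exists>K0. \<forall>K\<ge>K0. mode u m (mode v n w) - mode v n (mode u m w) =
      (\<Sum>i<K. mscale Z (of_int m gchoose i) (mode (vmode V u (int i) v) (m + n - int i) w))"
proof -
  obtain K0 where K0: "\<forall>K\<ge>K0. (\<Sum>i<K. lhs u v w 0 m n i) = (\<Sum>i<K. rhs u v w 0 m n i)"
    using borcherds_sums[OF w] by blast
  have "mode u m (mode v n w) - mode v n (mode u m w) =
      (\<Sum>i<K. mscale Z (of_int m gchoose i) (mode (vmode V u (int i) v) (m + n - int i) w))"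
    if K: "K \<ge> max 1 K0" for K
  proof -
    have "(\<Sum>i<K. rhs u v w 0 m n i) = (\<Sum>i<K. if i = 0 then mode u m (mode v n w) - mode v n (mode u m w) else 0)"
      by (rule sum.cong) (auto simp: borcherds_rhs_def gbinomial_0_left)
    also have "\<dots> = mode u m (mode v n w) - mode v n (mode u m w)" using K by simp
    finally show ?thesis using K0 K by (simp add: borcherds_lhs_def)
  qed
  then show ?thesis by blast
qed

text \<open>Single modes suffice: \<open>mode_mode_in_gen\<close> shows that their span is already
  closed under all modes.\<close>

definition gen :: "'m \<Rightarrow> 'm set" where
  "gen w = span {mode u n w | u n. True}"

lemma mode_in_gen: "mode u n w \<in> gen w"
  unfolding gen_def by (rule span_base) blast

lemma subspace_gen [simp]: "subspace (gen w)"
  by (simp add: gen_def)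

lemma self_in_gen: "w \<in> mspace Z \<Longrightarrow> w \<in> gen w"
  using vacuum_mode[of w "-1"] mode_in_gen[of "vacuum V" "-1" w] by simp

lemma gen_subset: "w \<in> mspace Z \<Longrightarrow> gen w \<subseteq> mspace Z"
  unfolding gen_def by (rule span_minimal) (auto simp: space_subspace mode_closed)

text \<open>The Borcherds identity rewrites a product of two modes by single modes and by products
  with a larger index on \<open>v\<close>. Those vanish once the index reaches \<open>N\<close>, so
  induction on the distance N - b finishes.\<close>

lemma mode_mode_in_gen:
  assumes w: "w \<in> mspace Z"
  shows "mode u a (mode v b w) \<in> gen w"
proof -
  obtain N where N: "\<forall>k\<ge>N. mode v k w = 0" using truncation[OF w] by blast
  obtain M where M: "\<forall>k\<ge>M. mode u k w = 0" using truncation[OF w] by blast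
  have "mode u a (mode v b w) \<in> gen w" if "k = nat (N - b)" for k a b
    using that
  proof (induction k arbitrary: a b rule: less_induct)
    case (less k)
    \<comment> \<open>With m = M the products in which \<open>u\<close> acts first vanish, and l = a
      - M makes m + l = a, so that the summand i = 0 is the product in question.\<close>
    obtain K0 where K0: "\<forall>K\<ge>K0. (\<Sum>i<K. lhs u v w (a - M) M b i) = (\<Sum>i<K. rhs u v w (a - M) M b i)"
      using borcherds_sums[OF w] by blast
    define K where "K = Suc K0"
    have r: "rhs u v w (a - M) M b i =
        mscale Z ((-1) ^ i * (of_int (a - M) gchoose i)) (mode u (a - int i) (mode v (b + int i) w))" for i
      using M by (simp add: borcherds_rhs_def)
    have "(\<Sum>i<K. lhs u v w (a - M) M b i) = (\<Sum>i<K. rhs u v w (a - M) M b i)"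
      by (rule K0[rule_format]) (simp add: K_def)
    also have "\<dots> = rhs u v w (a - M) M b 0 + (\<Sum>i<K0. rhs u v w (a - M) M b (Suc i))"
      unfolding K_def by (rule sum.lessThan_Suc_shift)
    also have "rhs u v w (a - M) M b 0 = mode u a (mode v b w)" by (simp add: r)
    finally have eq: "mode u a (mode v b w) =
       (\<Sum>i<K. lhs u v w (a - M) M b i) - (\<Sum>i<K0. rhs u v w (a - M) M b (Suc i))" by simp
    have "lhs u v w (a - M) M b i \<in> gen w" for i
      unfolding borcherds_lhs_def by (rule subspace_scale[OF subspace_gen mode_in_gen])
    moreover have "rhs u v w (a - M) M b (Suc i) \<in> gen w" for i
    proof (cases "b \<ge> N")
      case True
      then show ?thesis unfolding r using N by (simp add: subspace_0)
    next
      case False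
      then have "nat (N - (b + int (Suc i))) < k" using less.prems by simp
      then show ?thesis unfolding r by (intro subspace_scale less.IH) auto
    qed
    ultimately show ?case unfolding eq by (intro subspace_diff subspace_sum) auto
  qed
  then show ?thesis by blast
qed

lemma mode_gen: "w \<in> mspace Z \<Longrightarrow> x \<in> gen w \<Longrightarrow> mode u n x \<in> gen w"
proof -
  assume w: "w \<in> mspace Z" and x: "x \<in> gen w"
  have "x \<in> mspace Z \<and> mode u n x \<in> gen w"
    using x unfolding gen_def
  proof (induction rule: span_induct_alt)
    case base
    then show ?case by (simp add: span_zero subspace_0[OF space_subspace])
  next
    case (step c x y)
    then obtain v b where x: "x = mode v b w" by blast
    have sx: "mscale Z c x \<in> mspace Z" using x w mode_closed subspace_scale[OF space_subspace] by blast
    have "mode u n (mscale Z c x) \<in> gen w"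
      using x w mode_mode_in_gen[OF w] by (simp add: mode_scale mode_closed subspace_scale)
    then show ?case using step sx
      by (simp add: mode_add subspace_add[OF space_subspace] gen_def span_add)
  qed
  then show ?thesis ..
qed

lemma submodule_gen: "w \<in> mspace Z \<Longrightarrow> submodule Z (gen w)"
  unfolding submodule_def using gen_subset mode_gen by auto

lemma gen_minimal: "submodule Z S \<Longrightarrow> w \<in> S \<Longrightarrow> gen w \<subseteq> S"
  unfolding gen_def submodule_def by (intro span_minimal) auto

end

section \<open>The algebra as a module over itself; weights of modes\<close>

context vertex_operator_algebra
begin

sublocale graded_space "vscale V" UNIV "vgrade V"
  by unfold_locales (rule grading)

definition adjoint_module :: "('v, 'v) vmod" where
  "adjoint_module = \<lparr>mscale = vscale V, mspace = UNIV, mmode = vmode V, mgrade = vgrade V\<rparr>"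

lemma adjoint_simps [simp]:
  "mscale adjoint_module = vscale V" "mspace adjoint_module = UNIV"
  "mmode adjoint_module = vmode V" "mgrade adjoint_module = vgrade V"
  by (simp_all add: adjoint_module_def)

lemma vmode_add: "vmode V u n (v + w) = vmode V u n v + vmode V u n w"
  using mode_linear[of u n] unfolding Vector_Spaces.linear_iff by blast

lemma vmode_scale: "vmode V u n (vscale V a v) = vscale V a (vmode V u n v)"
  using mode_linear[of u n] unfolding Vector_Spaces.linear_iff by blast

lemma vmode_add_left: "vmode V (u + u') n v = vmode V u n v + vmode V u' n v"
  using mode_linear_left[of n v] unfolding Vector_Spaces.linear_iff by blast

lemma vmode_scale_left: "vmode V (vscale V a u) n v = vscale V a (vmode V u n v)"
  using mode_linear_left[of n v] unfolding Vector_Spaces.linear_iff by blast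

lemma adjoint_weak_module: "weak_module V adjoint_module"
  by unfold_locales
    (simp_all add: scale_right_distrib scale_left_distrib vmode_add vmode_scale vmode_add_left vmode_scale_left truncation vacuum_mode borcherds)

lemma adjoint_voa_weak_module: "voa_weak_module V adjoint_module"
  by (rule voa_weak_module.intro[OF vertex_operator_algebra_axioms adjoint_weak_module])

lemma of_nat_gchoose_eq_0: "i > k \<Longrightarrow> (of_nat k gchoose i :: complex) = 0"
  by (simp add: binomial_gbinomial[symmetric])

text \<open>In the commutator with index 1 only L(-1) and L(0) acting on \<open>v\<close> survive,
  and they contribute -(n + 1) and p.\<close>

lemma L0_commutator:
  assumes v: "v \<in> vgrade V p"
  shows "vmode V (conformal V) 1 (vmode V v n w) =
    vmode V v n (vmode V (conformal V) 1 w) + vscale V (of_int (int p - n - 1)) (vmode V v n w)"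
proof -
  interpret A: voa_weak_module V adjoint_module by (rule adjoint_voa_weak_module)
  obtain K0 where K0: "\<And>K. K \<ge> K0 \<Longrightarrow>
      vmode V (conformal V) 1 (vmode V v n w) - vmode V v n (vmode V (conformal V) 1 w) =
      (\<Sum>i<K. vscale V (of_int 1 gchoose i) (vmode V (vmode V (conformal V) (int i) v) (1 + n - int i) w))"
    using A.commutator[of w "conformal V" 1 v n] by auto
  define f where "f i = vscale V (of_int 1 gchoose i) (vmode V (vmode V (conformal V) (int i) v) (1 + n - int i) w)" for i
  have f: "f i = 0" if "i \<ge> 2" for i
    using of_nat_gchoose_eq_0[of 1 i] that by (simp add: f_def)
  have "vmode V (conformal V) 1 (vmode V v n w) - vmode V v n (vmode V (conformal V) 1 w) = sum f {..<2 + K0}"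
    using K0[of "2 + K0"] by (simp add: f_def)
  also have "\<dots> = sum f {..<2}" by (rule sum.mono_neutral_right) (auto intro: f)
  also have "\<dots> = f 0 + f 1" by (simp add: numeral_2_eq_2)
  also have "f 0 = vscale V (- of_int (n + 1)) (vmode V v n w)"
    by (simp add: f_def L_minus1_derivative algebra_simps)
  also have "f 1 = vscale V (of_nat p) (vmode V v n w)"
    by (simp add: f_def L0_grade[OF v] vmode_scale_left)
  finally show ?thesis by (simp add: algebra_simps scale_left_distrib[symmetric])
qed

text \<open>The grading is the eigenspace decomposition of L(0): comparing components, only the one
  of weight \<open>k\<close> can be nonzero, and for negative \<open>k\<close> none is left.\<close>

lemma L0_eigenvector:
  assumes "vmode V (conformal V) 1 x = vscale V (of_int k) x"
  shows "if k \<ge> 0 then x \<in> vgrade V (nat k) else x = 0"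
proof -
  interpret A: voa_weak_module V adjoint_module by (rule adjoint_voa_weak_module)
  define g where "g = gcomp (vgrade V) x"
  define J where "J = {j. g j \<noteq> 0}"
  have g: "g j \<in> vgrade V j" for j by (simp add: g_def gcomp_in)
  have J: "finite J" by (simp add: J_def g_def gcomp_finite)
  have x: "(\<Sum>j\<in>J. g j) = x" using gcomp_sum[of x] by (simp add: J_def g_def)
  have "vmode V (conformal V) 1 (\<Sum>j\<in>J. g j) = (\<Sum>j\<in>J. vmode V (conformal V) 1 (g j))"
    using A.mode_sum[of J g "conformal V" 1] by simp
  also have "\<dots> = (\<Sum>j\<in>J. vscale V (of_nat j) (g j))"
    by (rule sum.cong) (simp_all add: L0_grade[OF g])
  finally have "vmode V (conformal V) 1 x = (\<Sum>j\<in>J. vscale V (of_nat j) (g j))" unfolding x .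
  then have "(\<Sum>j\<in>J. vscale V (of_nat j) (g j)) = (\<Sum>j\<in>J. vscale V (of_int k) (g j))"
    using assms x[symmetric] by (simp add: scale_sum_right)
  then have "(\<Sum>j\<in>J. vscale V (of_nat j - of_int k) (g j)) = 0"
    by (simp add: scale_left_diff_distrib sum_subtractf)
  then have z: "vscale V (of_nat j - of_int k) (g j) = 0" if "j \<in> J" for j
    using grade_independent[OF J, of "\<lambda>j. vscale V (of_nat j - of_int k) (g j)" j] that
    by (simp add: g subspace_scale[OF subspace_grade])
  have jk: "int j = k" if "j \<in> J" for j
  proof -
    have "(of_nat j :: complex) = of_int k" using z[OF that] that by (simp add: J_def)
    then show ?thesis by (metis of_int_eq_iff of_int_of_nat_eq)
  qed
  show ?thesis
  proof (cases "k \<ge> 0")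
    case True
    have "(\<Sum>j\<in>J. g j) \<in> vgrade V (nat k)"
    proof (rule subspace_sum[OF subspace_grade])
      fix j assume "j \<in> J"
      then have "j = nat k" using jk by fastforce
      then show "g j \<in> vgrade V (nat k)" using g by blast
    qed
    then show ?thesis using True x by simp
  next
    case False
    then have "J = {}" using jk by fastforce
    then show ?thesis using x False by simp
  qed
qed

text \<open>The axioms give only the eigenvalues of L(0) on the homogeneous parts; that modes
  respect weights follows from its commutator with a mode.\<close>

lemma vmode_grade:
  assumes u: "u \<in> vgrade V p" and v: "v \<in> vgrade V q"
  shows "if int p + int q - n - 1 \<ge> 0 then vmode V u n v \<in> vgrade V (nat (int p + int q - n - 1))
    else vmode V u n v = 0"
proof (rule L0_eigenvector)
  have "vmode V (conformal V) 1 (vmode V u n v) =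
      vscale V (of_nat q + of_int (int p - n - 1)) (vmode V u n v)"
    using L0_commutator[OF u, of n v] L0_grade[OF v] by (simp only: vmode_scale scale_left_distrib)
  also have "of_nat q + of_int (int p - n - 1) = (of_int (int p + int q - n - 1) :: complex)" by simp
  finally show "vmode V (conformal V) 1 (vmode V u n v) =
      vscale V (of_int (int p + int q - n - 1)) (vmode V u n v)" .
qed

lemma vmode_grade':
  assumes "u \<in> vgrade V p" "v \<in> vgrade V q"
  shows "vmode V u n v \<in> vgrade V (nat (int p + int q - n - 1))"
  using vmode_grade[OF assms, of n] subspace_0[OF subspace_grade] by (auto split: if_splits)

text \<open>Homogeneous vectors span \<open>V\<close>, so properties linear in \<open>u\<close> need
  a proof only where the formulas that mention a weight apply.\<close>

lemma homogeneous_induct [case_names add scale hom]: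
  assumes "\<And>u v. P u \<Longrightarrow> P v \<Longrightarrow> P (u + v)" "\<And>c u. P u \<Longrightarrow> P (vscale V c u)" "\<And>p u. u \<in> vgrade V p \<Longrightarrow> P u"
  shows "P u"
proof -
  have "u \<in> span (\<Union>k. vgrade V k)" using space_eq by blast
  then show ?thesis
    by (induction rule: span_induct_alt) (use assms subspace_0[OF subspace_grade] in blast)+
qed

end

section \<open>Cofiniteness of the spans of $u_{-N}v$\<close>

context vertex_operator_algebra
begin

lemma vmode_zero [simp]: "vmode V u n 0 = 0"
  using vmode_scale[of u n 0 0] by simp

lemma vmode_zero_left [simp]: "vmode V 0 n v = 0"
  using vmode_scale_left[of 0 0 n v] by simp

text \<open>For N = 2 this is \<open>C2 V\<close>. Larger N is needed because the index used in
  \<open>gen_part_finite\<close> grows with the degrees involved.\<close>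

definition CN :: "nat \<Rightarrow> 'v set" where
  "CN N = span {vmode V u (- int N) v | u v. True}"

lemma subspace_CN [simp]: "subspace (CN N)"
  by (simp add: CN_def)

text \<open>By the derivative property the mode of L(-1)u of index -k is k times the mode of u of
  index -k - 1, so lower modes are modes of index -N of other vectors.\<close>

lemma vmode_in_CN:
  assumes "1 \<le> N" "n \<le> - int N"
  shows "vmode V u n v \<in> CN N"
proof -
  have "vmode V u (- int k) v \<in> CN N" if "k \<ge> N" for k u
    using that
  proof (induction k arbitrary: u rule: dec_induct)
    case base
    then show ?case unfolding CN_def by (intro span_base) blast
  next
    case (step k)
    have "vscale V (of_nat k) (vmode V u (- int (Suc k)) v) = vmode V (vmode V (conformal V) 0 u) (- int k) v"
    proof -
      have "- int (Suc k) = - int k - 1" by simp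
      then show ?thesis by (simp only: L_minus1_derivative) simp
    qed
    then have "vmode V u (- int (Suc k)) v =
        vscale V (1 / of_nat k) (vmode V (vmode V (conformal V) 0 u) (- int k) v)"
      using step assms by (metis divide_self_if le_zero_eq not_one_le_zero of_nat_eq_0_iff scale_one scale_scale times_divide_eq_left
          mult_1 order_trans)
    then show ?case using step.IH by (simp add: subspace_scale)
  qed
  from this[of "nat (- n)" u] assms show ?thesis by simp
qed

lemma gbinomial_minus_1: "(-1) ^ i * (of_int (-1) gchoose i :: complex) = 1"
  using gbinomial_minus[of "1::complex" i] by (simp add: binomial_gbinomial[symmetric] power_mult_distrib[symmetric] mult.assoc[symmetric])

lemma lhs_m0:
  "(\<Sum>i<Suc K. borcherds_lhs (vmode V) s act u v w l 0 n i) = s 1 (act (vmode V u l v) n w)"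
  if "\<And>x. s 0 x = 0"
proof -
  have "(\<Sum>i<Suc K. borcherds_lhs (vmode V) s act u v w l 0 n i) =
      (\<Sum>i<Suc K. if i = 0 then s 1 (act (vmode V u l v) n w) else 0)"
    by (rule sum.cong) (auto simp: borcherds_lhs_def gbinomial_0_left that)
  then show ?thesis by (simp add: sum.delta)
qed

text \<open>The mode of index n of a_{-1}c, applied to d, lies in \<open>CN (Suc N)\<close> and
  expands into terms a_{-1-i} c_{n+i} d and c_{n-1-i} a_i d. Those of the second kind lie there too.
  Of the first kind, i >= N has a low outer index, and for i <= N - 2 the low inner index moves
  outside at the cost of commutators of total index at most -2N. Only i = N - 1 remains.\<close>

lemma CN_step_right:
  assumes N: "N \<ge> 2"
  shows "vmode V a (- int N) (vmode V c (- int N) d) \<in> CN (Suc N)"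
proof -
  interpret A: voa_weak_module V adjoint_module by (rule adjoint_voa_weak_module)
  have CNI: "vmode V u n v \<in> CN (Suc N)" if "n \<le> - int (Suc N)" for u v n
    using vmode_in_CN[of "Suc N"] that by simp
  \<comment> \<open>For i = N - 1 both indices then equal -N, and \<open>n\<close> itself is at most
    -N - 1 because N >= 2.\<close>
  define n where "n = - 2 * int N + 1"
  obtain K0 where K0: "\<And>K. K \<ge> K0 \<Longrightarrow> (\<Sum>i<K. A.lhs a c d (-1) 0 n i) = (\<Sum>i<K. A.rhs a c d (-1) 0 n i)"
    using A.borcherds_sums[of d a c "-1" 0 n] by auto
  define K where "K = Suc (K0 + N)"
  have r: "A.rhs a c d (-1) 0 n i = vmode V a (- 1 - int i) (vmode V c (n + int i) d)
      + vmode V c (n - 1 - int i) (vmode V a (int i) d)" for i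
    unfolding borcherds_rhs_def adjoint_simps gbinomial_minus_1 by (simp add: algebra_simps)
  have r': "A.rhs a c d (-1) 0 n i \<in> CN (Suc N)" if i: "i \<noteq> N - 1" for i
  proof -
    have "vmode V c (n - 1 - int i) (vmode V a (int i) d) \<in> CN (Suc N)"
      by (rule CNI) (use N in \<open>simp add: n_def\<close>)
    moreover have "vmode V a (- 1 - int i) (vmode V c (n + int i) d) \<in> CN (Suc N)"
    proof (cases "i \<ge> N")
      case True
      then show ?thesis by (intro CNI) simp
    next
      case False
      have n: "n + int i \<le> - int (Suc N)" using i False N unfolding n_def by simp
      obtain L where L: "\<And>K. K \<ge> L \<Longrightarrow>
          vmode V a (- 1 - int i) (vmode V c (n + int i) d) - vmode V c (n + int i) (vmode V a (- 1 - int i) d) =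
          (\<Sum>j<K. vscale V (of_int (- 1 - int i) gchoose j)
             (vmode V (vmode V a (int j) c) (- 1 - int i + (n + int i) - int j) d))"
        using A.commutator[of d a "- 1 - int i" c "n + int i"] by auto
      have "(\<Sum>j<L. vscale V (of_int (- 1 - int i) gchoose j)
             (vmode V (vmode V a (int j) c) (- 1 - int i + (n + int i) - int j) d)) \<in> CN (Suc N)"
        by (intro subspace_sum subspace_scale subspace_CN CNI) (use N in \<open>simp add: n_def\<close>)
      then have "vmode V a (- 1 - int i) (vmode V c (n + int i) d) - vmode V c (n + int i) (vmode V a (- 1 - int i) d) \<in> CN (Suc N)"
        using L[of L] by simp
      then show ?thesis
        using subspace_add[OF subspace_CN, OF _ CNI[OF n, of c "vmode V a (- 1 - int i) d"]] by fastforce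
    qed
    ultimately show ?thesis unfolding r by (simp add: subspace_add)
  qed
  have "(\<Sum>i<K. A.lhs a c d (-1) 0 n i) = vmode V (vmode V a (-1) c) n d"
    unfolding K_def adjoint_simps by (subst lhs_m0) simp_all
  also have "\<dots> \<in> CN (Suc N)" by (rule CNI) (use N in \<open>simp add: n_def\<close>)
  finally have "(\<Sum>i<K. A.rhs a c d (-1) 0 n i) \<in> CN (Suc N)" using K0[of K] by (simp add: K_def)
  moreover have "(\<Sum>i<K. A.rhs a c d (-1) 0 n i) =
      A.rhs a c d (-1) 0 n (N - 1) + (\<Sum>i\<in>{..<K} - {N - 1}. A.rhs a c d (-1) 0 n i)"
    by (rule sum.remove) (use N in \<open>auto simp: K_def\<close>)
  moreover have "(\<Sum>i\<in>{..<K} - {N - 1}. A.rhs a c d (-1) 0 n i) \<in> CN (Suc N)"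
    by (intro subspace_sum[OF subspace_CN] r') auto
  ultimately have "A.rhs a c d (-1) 0 n (N - 1) \<in> CN (Suc N)"
    by (metis add_diff_cancel_right' subspace_CN subspace_diff)
  moreover have "vmode V c (n - 1 - int (N - 1)) (vmode V a (int (N - 1)) d) \<in> CN (Suc N)"
    by (rule CNI) (use N in \<open>simp add: n_def\<close>)
  ultimately have "vmode V a (- 1 - int (N - 1)) (vmode V c (n + int (N - 1)) d) \<in> CN (Suc N)"
    unfolding r by (metis add_diff_cancel_right' subspace_CN subspace_diff)
  moreover have "- 1 - int (N - 1) = - int N" "n + int (N - 1) = - int N" using N by (simp_all add: n_def)
  ultimately show ?thesis by (simp only:)
qed

text \<open>The identity with m = 0 turns the iterate into terms c_{-N-i} d_{-N+i} b and d_{-2N-i}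
  c_i b. All have outer index below -N except c_{-N} d_{-N} b, which \<open>CN_step_right\<close>
  covers.\<close>

lemma CN_step_left:
  assumes N: "N \<ge> 2"
  shows "vmode V (vmode V c (- int N) d) (- int N) b \<in> CN (Suc N)"
proof -
  interpret A: voa_weak_module V adjoint_module by (rule adjoint_voa_weak_module)
  have CNI: "vmode V u n v \<in> CN (Suc N)" if "n \<le> - int (Suc N)" for u v n
    using vmode_in_CN[of "Suc N"] that by simp
  obtain K where K: "\<And>K'. K' \<ge> K \<Longrightarrow> (\<Sum>i<K'. A.lhs c d b (- int N) 0 (- int N) i) = (\<Sum>i<K'. A.rhs c d b (- int N) 0 (- int N) i)"
    using A.borcherds_sums[of b c d "- int N" 0 "- int N"] by auto
  have "A.rhs c d b (- int N) 0 (- int N) i \<in> CN (Suc N)" for i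
    unfolding borcherds_rhs_def adjoint_simps
  proof (intro subspace_scale[OF subspace_CN] subspace_diff[OF subspace_CN])
    show "vmode V c (0 + - int N - int i) (vmode V d (- int N + int i) b) \<in> CN (Suc N)"
      by (cases "i = 0") (use CN_step_right[OF N] in \<open>auto intro: CNI\<close>)
    show "vmode V d (- int N + - int N - int i) (vmode V c (0 + int i) b) \<in> CN (Suc N)"
      by (rule CNI) (use N in simp)
  qed
  then have "(\<Sum>i<Suc K. A.rhs c d b (- int N) 0 (- int N) i) \<in> CN (Suc N)"
    by (intro subspace_sum[OF subspace_CN])
  then have "(\<Sum>i<Suc K. A.lhs c d b (- int N) 0 (- int N) i) \<in> CN (Suc N)"
    using K[of "Suc K"] by simp
  then show ?thesis unfolding adjoint_simps by (subst (asm) lhs_m0) simp_all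
qed

text \<open>By the two step lemmas u_{-N} v modulo \<open>CN (Suc N)\<close> depends only on
  \<open>u\<close> and \<open>v\<close> modulo \<open>CN N\<close>, so it can be computed from
  representatives in \<open>span B\<close>.\<close>

lemma CN_bilinear:
  assumes N: "N \<ge> 2" and B: "\<forall>v. \<exists>b\<in>span B. v - b \<in> CN N"
    and sub: "subspace Q" and Q1: "\<And>a b. a \<in> B \<Longrightarrow> b \<in> B \<Longrightarrow> vmode V a (- int N) b \<in> Q"
    and Q2: "CN (Suc N) \<subseteq> Q"
  shows "vmode V u (- int N) v \<in> Q"
proof -
  have R: "vmode V x (- int N) c \<in> CN (Suc N)" if "c \<in> CN N" for x c
    using that unfolding CN_def[of N]
  proof (induction rule: span_induct_alt)
    case base show ?case by (simp add: subspace_0)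
  next
    case (step k e y)
    then obtain c' d where "e = vmode V c' (- int N) d" by blast
    then show ?case using step CN_step_right[OF N] by (simp add: vmode_add vmode_scale subspace_add subspace_scale)
  qed
  have L: "vmode V c (- int N) x \<in> CN (Suc N)" if "c \<in> CN N" for x c
    using that unfolding CN_def[of N]
  proof (induction rule: span_induct_alt)
    case base show ?case by (simp add: subspace_0)
  next
    case (step k e y)
    then obtain c' d where "e = vmode V c' (- int N) d" by blast
    then show ?case using step CN_step_left[OF N] by (simp add: vmode_add_left vmode_scale_left subspace_add subspace_scale)
  qed
  have Q3: "vmode V a (- int N) y \<in> Q" if a: "a \<in> B" and y: "y \<in> span B" for a y
    using y
  proof (induction rule: span_induct_alt)
    case base
    show ?case using subspace_0[OF sub] by simp
  next
    case (step c x y)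
    then show ?case using Q1[OF a, of x] subspace_add[OF sub] subspace_scale[OF sub]
      by (simp only: vmode_add vmode_scale)
  qed
  have Q4: "vmode V x (- int N) y \<in> Q" if x: "x \<in> span B" and y: "y \<in> span B" for x y
    using x
  proof (induction rule: span_induct_alt)
    case base
    show ?case using subspace_0[OF sub] by simp
  next
    case (step c x z)
    then show ?case using Q3[OF _ y, of x] subspace_add[OF sub] subspace_scale[OF sub]
      by (simp only: vmode_add_left vmode_scale_left)
  qed
  obtain a b where a: "a \<in> span B" "u - a \<in> CN N" and b: "b \<in> span B" "v - b \<in> CN N" using B by blast
  have "u = a + (u - a)" "v = b + (v - b)" by simp_all
  then have "vmode V u (- int N) v = vmode V a (- int N) b + vmode V a (- int N) (v - b) + vmode V (u - a) (- int N) v"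
    by (metis vmode_add vmode_add_left)
  also have "\<dots> \<in> Q"
    by (intro subspace_add[OF sub] Q4 subsetD[OF Q2] L R a b)
  finally show ?thesis .
qed

text \<open>Passing from N to N + 1 adds only the finitely many products of representatives, which
  span \<open>CN N\<close> modulo \<open>CN (Suc N)\<close>.\<close>

lemma CN_cofinite:
  assumes "C2_cofinite V" "N \<ge> 2"
  shows "\<exists>B. finite B \<and> (\<forall>v. \<exists>b\<in>span B. v - b \<in> CN N)"
  using assms(2)
proof (induction N rule: dec_induct)
  case base
  have "C2 V = CN 2" by (simp add: C2_def CN_def)
  then show ?case using assms(1) by (simp add: C2_cofinite_def)
next
  case (step N)
  then obtain B where B: "finite B" "\<forall>v. \<exists>b\<in>span B. v - b \<in> CN N" by blast
  let ?P = "{vmode V a (- int N) b | a b. a \<in> B \<and> b \<in> B}"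
  let ?Q = "{x + y | x y. x \<in> span ?P \<and> y \<in> CN (Suc N)}"
  have sub: "subspace ?Q" by (rule subspace_sums) simp_all
  have fin: "finite ?P"
  proof -
    have "?P = (\<lambda>(a, b). vmode V a (- int N) b) ` (B \<times> B)" by auto
    then show ?thesis using B by simp
  qed
  have CN: "CN N \<subseteq> ?Q"
    unfolding CN_def[of N]
  proof (rule span_minimal[OF _ sub], safe)
    fix u v
    have "vmode V u (- int N) v \<in> ?Q"
    proof (rule CN_bilinear[OF step(1) B(2) sub])
      show "CN (Suc N) \<subseteq> ?Q" using span_zero[of ?P] by force
      show "vmode V a (- int N) b \<in> ?Q" if "a \<in> B" "b \<in> B" for a b
        using span_base[of "vmode V a (- int N) b" ?P] that subspace_0[OF subspace_CN, of "Suc N"] by force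
    qed
    then show "\<exists>x y. vmode V u (- int N) v = x + y \<and> x \<in> span ?P \<and> y \<in> CN (Suc N)" by blast
  qed
  have "\<exists>b\<in>span (B \<union> ?P). v - b \<in> CN (Suc N)" for v
  proof -
    obtain b where b: "b \<in> span B" "v - b \<in> CN N" using B by blast
    then obtain x y where xy: "v - b = x + y" "x \<in> span ?P" "y \<in> CN (Suc N)" using CN by blast
    have "b + x \<in> span (B \<union> ?P)"
      using b xy span_mono[of B "B \<union> ?P"] span_mono[of ?P "B \<union> ?P"] by (blast intro: span_add)
    moreover have "v - (b + x) \<in> CN (Suc N)" using xy by (metis add_diff_cancel_left' diff_diff_eq)
    ultimately show ?thesis by blast
  qed
  then show ?case using B(1) fin by (intro exI[of _ "B \<union> ?P"]) blast
qed

lemma CN_homogeneous: "CN N = span {vmode V u (- int N) v | u v p q. u \<in> vgrade V p \<and> v \<in> vgrade V q}" (is "_ = span ?A")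
proof
  have "vmode V u (- int N) v \<in> span ?A" for u v
  proof (induction u rule: homogeneous_induct)
    case (hom p u)
    show ?case
    proof (induction v rule: homogeneous_induct)
      case (hom q v)
      show ?case using \<open>u \<in> vgrade V p\<close> hom by (intro span_base) blast
    qed (simp_all add: vmode_add vmode_scale span_add span_scale)
  qed (simp_all add: vmode_add_left vmode_scale_left span_add span_scale)
  then show "CN N \<subseteq> span ?A" unfolding CN_def by (intro span_minimal) auto
  show "span ?A \<subseteq> CN N" unfolding CN_def by (rule span_mono) blast
qed

text \<open>Finitely many representatives have components only in bounded degrees; beyond these a
  homogeneous vector is a component of an element of \<open>CN N\<close>. A generator u_{-N} w has
  weight a + b + N - 1, whence the side condition.\<close>

lemma large_grades_in_CN:
  assumes "C2_cofinite V" "N \<ge> 2"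
  shows "\<exists>P. \<forall>p>P. \<forall>v\<in>vgrade V p. v \<in> span {vmode V u (- int N) w | u w a b.
            u \<in> vgrade V a \<and> w \<in> vgrade V b \<and> a + b + N = p + 1}"
proof -
  obtain B where B: "finite B" "\<forall>v. \<exists>b\<in>span B. v - b \<in> CN N" using CN_cofinite[OF assms] by blast
  obtain P where P: "\<And>b p. b \<in> B \<Longrightarrow> p > P \<Longrightarrow> gcomp (vgrade V) b p = 0"
  proof -
    have "\<forall>b\<in>B. \<exists>K. \<forall>k\<ge>K. gcomp (vgrade V) b k = 0" using gcomp_bounded by blast
    then obtain f where f: "\<forall>b\<in>B. \<forall>k\<ge>f b. gcomp (vgrade V) b k = 0" by metis
    have "f b \<le> Max (f ` B)" if "b \<in> B" for b using B that by simp
    then show ?thesis using f that[of "Max (f ` B)"] by (meson less_imp_le order_trans)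
  qed
  let ?A = "{vmode V u (- int N) v | u v p q. u \<in> vgrade V p \<and> v \<in> vgrade V q}"
  have "v \<in> span {vmode V u (- int N) w | u w a b. u \<in> vgrade V a \<and> w \<in> vgrade V b \<and> a + b + N = p + 1}"
    (is "_ \<in> span ?A'") if p: "p > P" and v: "v \<in> vgrade V p" for p v
  proof -
    obtain b where b: "b \<in> span B" "v - b \<in> CN N" using B by blast
    have "gcomp (vgrade V) b p = 0"
      using b(1) by (induction rule: span_induct_alt) (simp_all add: gcomp_add gcomp_scale P p)
    then have "gcomp (vgrade V) (v - b) p = v" by (simp add: gcomp_diff gcomp_hom[OF v])
    moreover have "gcomp (vgrade V) (v - b) p \<in> span (?A \<inter> vgrade V p)"
    proof (rule gcomp_span)
      show "?A \<subseteq> (\<Union>k. vgrade V k)" using vmode_grade' by blast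
      show "v - b \<in> span ?A" using b CN_homogeneous by blast
    qed
    moreover have "span (?A \<inter> vgrade V p) \<subseteq> span ?A'"
    proof (rule span_minimal)
      show "?A \<inter> vgrade V p \<subseteq> span ?A'"
      proof
        fix x assume "x \<in> ?A \<inter> vgrade V p"
        then obtain u w a c where x: "x = vmode V u (- int N) w" "u \<in> vgrade V a" "w \<in> vgrade V c" "x \<in> vgrade V p"
          by blast
        show "x \<in> span ?A'"
        proof (cases "x = 0")
          case False
          have "x \<in> vgrade V (a + c + N - 1)"
            using vmode_grade[OF x(2,3), of "- int N"] x(1) False
            by (auto split: if_splits simp: nat_diff_distrib' nat_add_distrib of_nat_add[symmetric] simp del: of_nat_add)
          then have "a + c + N - 1 = p" using gcomp_hom[of x "a + c + N - 1" p] gcomp_hom[OF x(4), of p] False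
            by (metis (full_types))
          then have "a + c + N = p + 1" using assms(2) by simp
          then show ?thesis using x by (intro span_base) blast
        qed (simp add: span_zero)
      qed
    qed simp
    ultimately show ?thesis by auto
  qed
  then show ?thesis by blast
qed

end

section \<open>Graded modules\<close>

context graded_space
begin

text \<open>Zero modes, the Zhu product and transposed modes are all given on homogeneous vectors by
  a formula \<open>F k\<close> that depends on the weight; these lemmas treat their linear
  extensions together.\<close>

lemma Sum_any_gcomp_hom:
  fixes F :: "nat \<Rightarrow> 'm \<Rightarrow> 'x::comm_monoid_add"
  assumes "u \<in> G j" "\<And>k. F k 0 = 0"
  shows "Sum_any (\<lambda>k. F k (gcomp G u k)) = F j u"
proof -
  have "Sum_any (\<lambda>k. F k (gcomp G u k)) = sum (\<lambda>k. F k (gcomp G u k)) {j}"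
    by (rule Sum_any.expand_superset) (use assms in \<open>auto simp: gcomp_hom split: if_splits\<close>)
  then show ?thesis using assms by (simp add: gcomp_hom)
qed

lemma Sum_any_gcomp_finite:
  fixes F :: "nat \<Rightarrow> 'm \<Rightarrow> 'x::comm_monoid_add"
  assumes "u \<in> W" "\<And>k. F k 0 = 0"
  shows "finite {k. F k (gcomp G u k) \<noteq> 0}"
  by (rule finite_subset[OF _ gcomp_finite[OF assms(1)]]) (use assms(2) in auto)

lemma Sum_any_gcomp_sum:
  fixes F :: "nat \<Rightarrow> 'm \<Rightarrow> 'x::comm_monoid_add"
  assumes "u \<in> W" "\<And>k. F k 0 = 0"
  shows "Sum_any (\<lambda>k. F k (gcomp G u k)) = (\<Sum>k | gcomp G u k \<noteq> 0. F k (gcomp G u k))"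
  by (rule Sum_any.expand_superset[OF gcomp_finite[OF assms(1)]]) (use assms(2) in auto)

lemma Sum_any_gcomp_add:
  fixes F :: "nat \<Rightarrow> 'm \<Rightarrow> 'x::comm_monoid_add"
  assumes "u \<in> W" "v \<in> W" "\<And>k. F k 0 = 0" "\<And>k x y. x \<in> W \<Longrightarrow> y \<in> W \<Longrightarrow> F k (x + y) = F k x + F k y"
  shows "Sum_any (\<lambda>k. F k (gcomp G (u + v) k)) =
    Sum_any (\<lambda>k. F k (gcomp G u k)) + Sum_any (\<lambda>k. F k (gcomp G v k))"
  using assms by (subst Sum_any.distrib[symmetric])
    (auto simp: gcomp_add gcomp_in_space intro!: Sum_any_gcomp_finite)

lemma Sum_any_gcomp_scale:
  fixes F :: "nat \<Rightarrow> 'm \<Rightarrow> 'x::ab_group_add"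
  assumes "vector_space t" and u: "u \<in> W" and F0: "\<And>k. F k 0 = 0"
    and F: "\<And>k x. x \<in> W \<Longrightarrow> F k (s c x) = t c (F k x)"
  shows "Sum_any (\<lambda>k. F k (gcomp G (s c u) k)) = t c (Sum_any (\<lambda>k. F k (gcomp G u k)))"
proof -
  interpret t: vector_space t by fact
  let ?J = "{k. gcomp G u k \<noteq> 0}"
  have "Sum_any (\<lambda>k. F k (gcomp G (s c u) k)) = sum (\<lambda>k. F k (gcomp G (s c u) k)) ?J"
    by (rule Sum_any.expand_superset[OF gcomp_finite[OF u]]) (use u F0 in \<open>auto simp: gcomp_scale\<close>)
  also have "\<dots> = (\<Sum>k\<in>?J. t c (F k (gcomp G u k)))"
    by (rule sum.cong) (simp_all add: gcomp_scale[OF u] F gcomp_in_space[OF u])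
  also have "\<dots> = t c (Sum_any (\<lambda>k. F k (gcomp G u k)))"
    by (simp add: t.scale_sum_right[symmetric] Sum_any_gcomp_sum[where F = F, OF u F0])
  finally show ?thesis .
qed

end

section \<open>Homogeneous parts of cyclic submodules\<close>

locale voa_admissible = voa_weak_module V Z + admissible_module V Z
  for V :: "'v::ab_group_add voa" and Z :: "('v, 'm::ab_group_add) vmod"
begin

sublocale graded_space "mscale Z" "mspace Z" "mgrade Z"
  by unfold_locales (rule grading)

abbreviation "zm \<equiv> zero_mode V Z"

lemma grade_in_space: "w \<in> mgrade Z m \<Longrightarrow> w \<in> mspace Z"
  using grade_subset by blast

lemma mode_degree:
  "v \<in> vgrade V q \<Longrightarrow> w \<in> mgrade Z m \<Longrightarrow> mode v (int q + int m - int d - 1) w \<in> mgrade Z d"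
  using mode_grade[of v q w m "int q + int m - int d - 1"] by simp

lemma mode_homogeneous:
  assumes "v \<in> vgrade V q" "w \<in> mgrade Z m"
  shows "mode v n w = 0 \<or> (\<exists>d. n = int q + int m - int d - 1 \<and> mode v n w \<in> mgrade Z d)"
proof (cases "int m + int q - n - 1 \<ge> 0")
  case True
  then show ?thesis using mode_grade[OF assms True]
    by (intro disjI2 exI[of _ "nat (int m + int q - n - 1)"]) simp
qed (use mode_grade_neg[OF assms] in simp)

text \<open>The index q + m - d - 1 is the one by which a vector of weight q takes degree m to
  degree d; for \<open>w\<close> of degree m this is the part of \<open>gen w\<close> of degree
  d.\<close>

definition gen_part :: "'m \<Rightarrow> nat \<Rightarrow> nat \<Rightarrow> 'm set" where
  "gen_part w m d = span {mode v (int q + int m - int d - 1) w | q v. v \<in> vgrade V q}"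

lemma subspace_gen_part [simp]: "subspace (gen_part w m d)"
  by (simp add: gen_part_def)

lemma gen_homogeneous:
  assumes w: "w \<in> mspace Z"
  shows "gen w = span {mode v n w | v n q. v \<in> vgrade V q}" (is "_ = span ?A")
proof
  have "mode v n w \<in> span ?A" for v n
  proof (induction v rule: V.homogeneous_induct)
    case (hom p v)
    then show ?case by (intro span_base) blast
  qed (simp_all add: w mode_add_left mode_scale_left span_add span_scale)
  then show "gen w \<subseteq> span ?A" unfolding gen_def by (intro span_minimal) auto
  show "span ?A \<subseteq> gen w" unfolding gen_def by (rule span_mono) blast
qed

lemma gen_generators_homogeneous:
  "w \<in> mgrade Z m \<Longrightarrow> {mode v n w | v n q. v \<in> vgrade V q} \<subseteq> (\<Union>d. mgrade Z d)"
proof safe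
  fix v n q assume "w \<in> mgrade Z m" "v \<in> vgrade V q"
  from mode_homogeneous[OF this(2,1), of n] show "mode v n w \<in> (\<Union>d. mgrade Z d)"
    using subspace_0[OF subspace_grade] by auto
qed

lemma gen_Int_grade:
  assumes w: "w \<in> mgrade Z m"
  shows "gen w \<inter> mgrade Z d = gen_part w m d"
proof -
  let ?A = "{mode v n w | v n q. v \<in> vgrade V q}"
  have "gen w \<inter> mgrade Z d = span (?A \<inter> mgrade Z d)"
    using gen_homogeneous[OF grade_in_space[OF w]] span_Int_grade[OF gen_generators_homogeneous[OF w]] by simp
  also have "\<dots> = gen_part w m d"
  proof
    show "span (?A \<inter> mgrade Z d) \<subseteq> gen_part w m d"
    proof (rule span_minimal, safe)
      fix v n q assume v: "v \<in> vgrade V q" and d: "mode v n w \<in> mgrade Z d"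
      consider "mode v n w = 0" | e where "n = int q + int m - int e - 1" "mode v n w \<in> mgrade Z e" "mode v n w \<noteq> 0"
        using mode_homogeneous[OF v w] by blast
      then show "mode v n w \<in> gen_part w m d"
      proof cases
        case 1
        then show ?thesis by (simp add: gen_part_def span_zero)
      next
        case (2 e)
        then have "e = d" using gcomp_hom[OF 2(2), of e] gcomp_hom[OF d, of e] by (metis (full_types))
        then show ?thesis unfolding gen_part_def using 2 v by (intro span_base) blast
      qed
    qed simp
    show "gen_part w m d \<subseteq> span (?A \<inter> mgrade Z d)"
      unfolding gen_part_def by (rule span_mono) (use w mode_degree in blast)
  qed
  finally show ?thesis .
qed

lemma mode_in_gen_part: "v \<in> vgrade V q \<Longrightarrow> mode v (int q + int m - int d - 1) w \<in> gen_part w m d"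
  unfolding gen_part_def by (intro span_base) blast

lemma gen_part_in_grade: "w \<in> mgrade Z m \<Longrightarrow> gen_part w m d \<subseteq> mgrade Z d"
  using gen_Int_grade by blast

lemma admissible_submodule_iff:
  "admissible_submodule Z S \<longleftrightarrow> submodule Z S \<and> (\<forall>x\<in>S. \<forall>k. gcomp (mgrade Z) x k \<in> S)"
  unfolding admissible_submodule_def submodule_def using graded_subspace_iff by blast

lemma admissible_submodule_gen:
  assumes w: "w \<in> mgrade Z m"
  shows "admissible_submodule Z (gen w)"
  unfolding admissible_submodule_iff
proof (intro conjI ballI allI)
  show "submodule Z (gen w)" using submodule_gen grade_in_space[OF w] by blast
  fix x k assume "x \<in> gen w"
  then have "x \<in> span {mode v n w | v n q. v \<in> vgrade V q}" using gen_homogeneous grade_in_space[OF w] by blast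
  from gcomp_span[OF gen_generators_homogeneous[OF w] this, of k]
  show "gcomp (mgrade Z) x k \<in> gen w"
    unfolding gen_homogeneous[OF grade_in_space[OF w]] using span_mono[OF Int_lower1] by blast
qed

text \<open>Since the modes of \<open>u\<close> from index m on kill \<open>w\<close>, half of the
  right side is gone, and \<open>i0\<close> truncates the other half. The choice i0 = 0 gives linear
  relations among iterated modes, for finiteness and for \<open>zhu_O\<close>; i0 = 1 gives the
  product rule for zero modes.\<close>

lemma circle_relation:
  assumes w: "w \<in> mspace Z"
    and u0: "\<And>i. mode u (m + int i) w = 0" and v0: "\<And>i. i \<ge> i0 \<Longrightarrow> mode v (n + int i) w = 0"
  shows "\<exists>K0. \<forall>K\<ge>K0. (\<Sum>i<K. mscale Z (of_int m gchoose i) (mode (vmode V u (l + int i) v) (m + n - int i) w))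
    = (\<Sum>i<i0. mscale Z ((-1) ^ i * (of_int l gchoose i)) (mode u (m + l - int i) (mode v (n + int i) w)))"
proof -
  obtain K0 where K0: "\<And>K. K \<ge> K0 \<Longrightarrow> (\<Sum>i<K. lhs u v w l m n i) = (\<Sum>i<K. rhs u v w l m n i)"
    using borcherds_sums[OF w] by blast
  have r: "rhs u v w l m n i = mscale Z ((-1) ^ i * (of_int l gchoose i)) (mode u (m + l - int i) (mode v (n + int i) w))" for i
    by (simp add: borcherds_rhs_def u0)
  have "(\<Sum>i<K. lhs u v w l m n i) = (\<Sum>i<i0. rhs u v w l m n i)" if "K \<ge> max K0 i0" for K
  proof -
    have "(\<Sum>i<K. rhs u v w l m n i) = (\<Sum>i<i0. rhs u v w l m n i)"
      by (rule sum.mono_neutral_right) (use that v0 in \<open>auto simp: r\<close>)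
    then show ?thesis using K0[of K] that by simp
  qed
  then show ?thesis by (intro exI[of _ "max K0 i0"]) (simp add: borcherds_lhs_def r)
qed

lemma mode_span_left:
  assumes "w \<in> mspace Z" "v \<in> V.span B"
  shows "mode v n w \<in> span ((\<lambda>v. mode v n w) ` B)"
  using assms(2)
  by (induction rule: V.span_induct_alt)
    (simp_all add: assms(1) span_zero mode_add_left mode_scale_left span_add span_scale span_base)

text \<open>A vector of large weight is a combination of vectors u_{-N} y. On \<open>w\<close> their
  modes into degree d are combinations of modes into degree d of u_{-N+i} y with i > 0, which have
  lower weight. Descending in this way, only weights up to P are needed, and these parts of
  \<open>V\<close> have finite dimension.\<close>

lemma gen_part_finite:
  assumes C2: "C2_cofinite V" and w: "w \<in> mgrade Z m"
  shows "\<exists>B. finite B \<and> gen_part w m d = span B"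
proof -
  \<comment> \<open>The relation below concerns the index a + b + 2m, where a + b = q + 1 - N. It
    equals q + m - d - 1, the index leading from degree m to degree d, exactly for this N.\<close>
  define N where "N = m + d + 2"
  note wS = grade_in_space[OF w]
  obtain P where P: "\<And>p v. p > P \<Longrightarrow> v \<in> vgrade V p \<Longrightarrow> v \<in> V.span {vmode V u (- int N) w | u w a b.
            u \<in> vgrade V a \<and> w \<in> vgrade V b \<and> a + b + N = p + 1}"
    using V.large_grades_in_CN[OF C2, of N] by (auto simp: N_def)
  define R where "R = span {mode v (int q + int m - int d - 1) w | q v. v \<in> vgrade V q \<and> q \<le> P}"
  have sR: "subspace R" by (simp add: R_def)
  have "mode v (int q + int m - int d - 1) w \<in> R" if "v \<in> vgrade V q" for q v
    using that
  proof (induction q arbitrary: v rule: less_induct)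
    case (less q)
    show ?case
    proof (cases "q \<le> P")
      case True
      then show ?thesis unfolding R_def using less.prems by (intro span_base) blast
    next
      case False
      let ?A = "{vmode V u (- int N) w | u w a b. u \<in> vgrade V a \<and> w \<in> vgrade V b \<and> a + b + N = q + 1}"
      have A: "mode x (int q + int m - int d - 1) w \<in> R" if xA: "x \<in> ?A" for x
      proof -
        obtain u y a b where x: "x = vmode V u (- int N) y" and u: "u \<in> vgrade V a" and y: "y \<in> vgrade V b"
          and q: "a + b + N = q + 1" using xA by blast
        define f where "f i = mscale Z (of_int (int a + int m) gchoose i)
            (mode (vmode V u (- int N + int i) y) (int a + int m + (int b + int m) - int i) w)" for i
        \<comment> \<open>The right side is empty, since modes of index a + m or more (for
          \<open>u\<close>) and b + m or more (for \<open>y\<close>) would take \<open>w\<close> to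
          a negative degree.\<close>
        have "\<exists>K0. \<forall>K\<ge>K0. sum f {..<K} = (\<Sum>i<0. mscale Z ((-1) ^ i * (of_int (- int N) gchoose i))
            (mode u (int a + int m + - int N - int i) (mode y (int b + int m + int i) w)))"
          unfolding f_def
          by (rule circle_relation[OF wS]) (use mode_grade_neg[OF u w] mode_grade_neg[OF y w] in simp_all)
        then obtain K where "\<forall>K'\<ge>K. sum f {..<K'} = 0" by auto
        then have K: "sum f {..<Suc K} = 0" by (simp del: sum.lessThan_Suc)
        have f0: "f 0 = mode x (int q + int m - int d - 1) w"
        proof -
          have e: "int a + int m + (int b + int m) = int q + int m - int d - 1" using q by (simp add: N_def)
          have "f 0 = mode (vmode V u (- int N) y) (int a + int m + (int b + int m)) w" by (simp add: f_def)
          then show ?thesis by (simp only: e x)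
        qed
        have "f (Suc i) \<in> R" for i
        proof -
          consider "vmode V u (- int N + int (Suc i)) y = 0"
            | "int q - int (Suc i) \<ge> 0" "vmode V u (- int N + int (Suc i)) y \<in> vgrade V (nat (int q - int (Suc i)))"
          proof -
            have e: "int a + int b - (- int N + int (Suc i)) - 1 = int q - int (Suc i)" using q by simp
            show thesis
              using V.vmode_grade[OF u y, of "- int N + int (Suc i)", unfolded e] that
              by (cases "int q - int (Suc i) \<ge> 0") (simp_all only: if_True if_False)
          qed
          then show ?thesis
          proof cases
            case 1
            then show ?thesis using subspace_0[OF sR] wS by (simp add: f_def)
          next
            case 2
            have "int a + int m + (int b + int m) - int (Suc i) = int (nat (int q - int (Suc i))) + int m - int d - 1"
              using q 2(1) by (simp add: N_def)
            moreover have "nat (int q - int (Suc i)) < q" using 2(1) by simp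
            ultimately show ?thesis unfolding f_def
              using less.IH[OF _ 2(2)] by (intro subspace_scale[OF sR]) (simp only:)
          qed
        qed
        then have "(\<Sum>i<K. f (Suc i)) \<in> R" by (intro subspace_sum[OF sR])
        moreover have "f 0 = - (\<Sum>i<K. f (Suc i))"
          using K by (simp only: sum.lessThan_Suc_shift eq_neg_iff_add_eq_0)
        ultimately show ?thesis using f0 subspace_neg[OF sR] by metis
      qed
      have "v \<in> V.span ?A" using P[of q v] False less.prems by simp
      from mode_span_left[OF wS this] have "mode v (int q + int m - int d - 1) w \<in> span ((\<lambda>x. mode x (int q + int m - int d - 1) w) ` ?A)" .
      also have "\<dots> \<subseteq> R" by (rule span_minimal[OF _ sR]) (use A in blast)
      finally show ?thesis .
    qed
  qed
  then have 1: "gen_part w m d \<subseteq> R" unfolding gen_part_def by (intro span_minimal[OF _ sR]) blast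
  obtain B where B: "\<And>q. finite (B q)" "\<And>q. vgrade V q = V.span (B q)"
    using V.grade_finite_dim by metis
  define F where "F = (\<Union>q\<le>P. (\<lambda>v. mode v (int q + int m - int d - 1) w) ` B q)"
  have 2: "R \<subseteq> span F" unfolding R_def
  proof (rule span_minimal, safe)
    fix q v assume "v \<in> vgrade V q" "q \<le> P"
    then have "mode v (int q + int m - int d - 1) w \<in> span ((\<lambda>v. mode v (int q + int m - int d - 1) w) ` B q)"
      using mode_span_left[OF wS] B by blast
    also have "\<dots> \<subseteq> span F" by (rule span_mono) (use \<open>q \<le> P\<close> in \<open>auto simp: F_def\<close>)
    finally show "mode v (int q + int m - int d - 1) w \<in> span F" .
  qed
  have 3: "span F \<subseteq> gen_part w m d"
  proof (rule span_minimal)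
    show "F \<subseteq> gen_part w m d"
    proof
      fix x assume "x \<in> F"
      then obtain q v where "v \<in> B q" "x = mode v (int q + int m - int d - 1) w" by (auto simp: F_def)
      then show "x \<in> gen_part w m d" using mode_in_gen_part[of v q m d w] B(2) V.span_base by simp
    qed
  qed simp
  have "finite F" using B(1) by (simp add: F_def)
  moreover have "gen_part w m d = span F" using 1 2 3 by blast
  ultimately show ?thesis by (intro exI[of _ F] conjI)
qed

end

section \<open>Zero modes on top vectors\<close>

context voa_admissible
begin

text \<open>Lowest weight vectors in any degree, int k - n - 1 being the change of degree under u_n.
  They replace vectors of the top level, as the bottom of a submodule may have positive
  degree.\<close>

definition top_vector :: "nat \<Rightarrow> 'm \<Rightarrow> bool" where
  "top_vector j t \<longleftrightarrow> t \<in> mgrade Z j \<and> (\<forall>k u n. u \<in> vgrade V k \<longrightarrow> int k - n - 1 < 0 \<longrightarrow> mode u n t = 0)"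

lemma top_vector_in_grade: "top_vector j t \<Longrightarrow> t \<in> mgrade Z j"
  by (simp add: top_vector_def)

lemma top_vectorD: "top_vector j t \<Longrightarrow> u \<in> vgrade V k \<Longrightarrow> int k \<le> n \<Longrightarrow> mode u n t = 0"
  by (simp add: top_vector_def)

lemma zm_hom: "u \<in> vgrade V k \<Longrightarrow> w \<in> mspace Z \<Longrightarrow> zm u w = mode u (int k - 1) w"
  unfolding zero_mode_def hcomp_eq_gcomp
  by (rule V.Sum_any_gcomp_hom[where F = "\<lambda>k x. mode x (int k - 1) w"]) simp_all

lemma zm_add_left: "w \<in> mspace Z \<Longrightarrow> zm (u + u') w = zm u w + zm u' w"
  unfolding zero_mode_def hcomp_eq_gcomp
  by (rule V.Sum_any_gcomp_add[where F = "\<lambda>k x. mode x (int k - 1) w"]) (simp_all add: mode_add_left)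

lemma zm_scale_left: "w \<in> mspace Z \<Longrightarrow> zm (vscale V c u) w = mscale Z c (zm u w)"
  unfolding zero_mode_def hcomp_eq_gcomp
  by (rule V.Sum_any_gcomp_scale[where F = "\<lambda>k x. mode x (int k - 1) w", OF vector_space_axioms])
    (simp_all add: mode_scale_left)

lemma zm_zero_left [simp]: "w \<in> mspace Z \<Longrightarrow> zm 0 w = 0"
  using zm_scale_left[of w 0 0] by simp

lemma zm_diff_left: "w \<in> mspace Z \<Longrightarrow> zm (u - u') w = zm u w - zm u' w"
  using zm_add_left[of w "u - u'" u'] by simp

lemma zm_sum_left: "w \<in> mspace Z \<Longrightarrow> zm (sum f A) w = (\<Sum>a\<in>A. zm (f a) w)"
  by (induction A rule: infinite_finite_induct) (simp_all add: zm_add_left)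

lemma zm_in_space: "w \<in> mspace Z \<Longrightarrow> zm u w \<in> mspace Z"
  by (induction u rule: V.homogeneous_induct)
    (simp_all add: zm_add_left zm_scale_left zm_hom mode_closed subspace_add[OF space_subspace] subspace_scale[OF space_subspace])

lemma zm_add: "w \<in> mspace Z \<Longrightarrow> w' \<in> mspace Z \<Longrightarrow> zm u (w + w') = zm u w + zm u w'"
  by (induction u rule: V.homogeneous_induct)
    (simp_all add: zm_add_left zm_scale_left zm_hom mode_add subspace_add[OF space_subspace] scale_right_distrib)

lemma zm_scale: "w \<in> mspace Z \<Longrightarrow> zm u (mscale Z c w) = mscale Z c (zm u w)"
  by (induction u rule: V.homogeneous_induct)
    (simp_all add: zm_add_left zm_scale_left zm_hom mode_scale subspace_scale[OF space_subspace]
      scale_right_distrib scale_left_commute)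

lemma zm_in_gen_part: "w \<in> mgrade Z j \<Longrightarrow> zm u w \<in> gen_part w j j"
proof (induction u rule: V.homogeneous_induct)
  case (hom p u)
  then show ?case using mode_in_gen_part[of u p j j w] by (simp add: zm_hom grade_in_space)
qed (simp_all add: zm_add_left zm_scale_left grade_in_space subspace_add subspace_scale)

text \<open>Zero modes extend linearly in \<open>u\<close>, so the values at \<open>w\<close>
  already form a subspace and no further sums are needed.\<close>

lemma gen_part_eq_zm:
  assumes w: "w \<in> mgrade Z j"
  shows "gen_part w j j = range (\<lambda>u. zm u w)"
proof
  note [simp] = grade_in_space[OF w]
  have "subspace (range (\<lambda>u. zm u w))"
  proof (rule subspaceI)
    show "0 \<in> range (\<lambda>u. zm u w)" using zm_zero_left[of w] by (metis \<open>w \<in> mspace Z\<close> rangeI)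
  next
    fix x y assume "x \<in> range (\<lambda>u. zm u w)" "y \<in> range (\<lambda>u. zm u w)"
    then show "x + y \<in> range (\<lambda>u. zm u w)" by (auto simp: zm_add_left[symmetric])
  next
    fix c x assume "x \<in> range (\<lambda>u. zm u w)"
    then show "mscale Z c x \<in> range (\<lambda>u. zm u w)" by (auto simp: zm_scale_left[symmetric])
  qed
  moreover have "mode v (int q + int j - int j - 1) w \<in> range (\<lambda>u. zm u w)" if "v \<in> vgrade V q" for v q
    using zm_hom[OF that, of w] by (metis \<open>w \<in> mspace Z\<close> add_diff_cancel_right' rangeI)
  ultimately show "gen_part w j j \<subseteq> range (\<lambda>u. zm u w)"
    unfolding gen_part_def by (intro span_minimal) blast+
  show "range (\<lambda>u. zm u w) \<subseteq> gen_part w j j" using zm_in_gen_part[OF w] by blast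
qed

lemma top_vector_gen_part:
  assumes t: "top_vector j t" and d: "d < j"
  shows "gen_part t j d = {0}"
proof -
  have "mode v (int q + int j - int d - 1) t = 0" if "v \<in> vgrade V q" for q v
    using top_vectorD[OF t that] d by simp
  then have "gen_part t j d \<subseteq> {0}" unfolding gen_part_def by (intro span_minimal) auto
  then show ?thesis using subspace_0[OF subspace_gen_part] by blast
qed

text \<open>A mode that lowers the degree of \<open>x\<close> would lead to a part of
  \<open>gen t\<close> below degree \<open>j\<close>, and there is none.\<close>

lemma top_vector_gen_part_top:
  assumes t: "top_vector j t" and x: "x \<in> gen_part t j j"
  shows "top_vector j x"
  unfolding top_vector_def
proof (intro conjI allI impI)
  note tg = top_vector_in_grade[OF t]
  show xj: "x \<in> mgrade Z j" using x gen_part_in_grade[OF tg] by blast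
  fix k u n assume u: "u \<in> vgrade V k" and neg: "int k - n - 1 < 0"
  have "x \<in> gen t" using x gen_Int_grade[OF tg] by blast
  then have g: "mode u n x \<in> gen t" using mode_gen grade_in_space[OF tg] by blast
  show "mode u n x = 0"
  proof (rule ccontr)
    assume "mode u n x \<noteq> 0"
    then obtain d where d: "n = int k + int j - int d - 1" "mode u n x \<in> mgrade Z d"
      using mode_homogeneous[OF u xj] by blast
    then have "mode u n x \<in> gen_part t j d" using g gen_Int_grade[OF tg] by blast
    then show False using top_vector_gen_part[OF t, of d] d neg \<open>mode u n x \<noteq> 0\<close> by simp
  qed
qed

lemma zm_top_vector: "top_vector j t \<Longrightarrow> top_vector j (zm u t)"
  using top_vector_gen_part_top zm_in_gen_part top_vector_in_grade by blast

lemma zhu_prod_hom: "u \<in> vgrade V k \<Longrightarrow>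
    zhu_prod V u v = (\<Sum>i\<le>k. vscale V (of_nat (k choose i)) (vmode V u (int i - 1) v))"
  unfolding zhu_prod_def hcomp_eq_gcomp
  by (rule V.Sum_any_gcomp_hom[where F = "\<lambda>k x. \<Sum>i\<le>k. vscale V (of_nat (k choose i)) (vmode V x (int i - 1) v)"])
     simp_all

lemma zhu_prod_add_left: "zhu_prod V (u + u') v = zhu_prod V u v + zhu_prod V u' v"
  unfolding zhu_prod_def hcomp_eq_gcomp
  by (rule V.Sum_any_gcomp_add[where F = "\<lambda>k x. \<Sum>i\<le>k. vscale V (of_nat (k choose i)) (vmode V x (int i - 1) v)"])
     (simp_all add: V.vmode_add_left V.scale_right_distrib sum.distrib)

lemma zhu_prod_scale_left: "zhu_prod V (vscale V c u) v = vscale V c (zhu_prod V u v)"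
  unfolding zhu_prod_def hcomp_eq_gcomp
  by (rule V.Sum_any_gcomp_scale[where F = "\<lambda>k x. \<Sum>i\<le>k. vscale V (of_nat (k choose i)) (vmode V x (int i - 1) v)",
        OF V.vector_space_axioms])
     (simp_all add: V.vmode_scale_left V.scale_sum_right mult.commute)

lemma zm_vmode:
  assumes t: "t \<in> mspace Z" and u: "u \<in> vgrade V k" and v: "v \<in> vgrade V q"
  shows "zm (vmode V u n v) t = mode (vmode V u n v) (int k + int q - n - 2) t"
proof (cases "int k + int q - n - 1 \<ge> 0")
  case True
  then have "zm (vmode V u n v) t = mode (vmode V u n v) (int (nat (int k + int q - n - 1)) - 1) t"
    using V.vmode_grade[OF u v, of n] t by (intro zm_hom) (simp_all split: if_splits)
  moreover have "int (nat (int k + int q - n - 1)) - 1 = int k + int q - n - 2" using True by simp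
  ultimately show ?thesis by (simp only:)
next
  case False
  then show ?thesis using V.vmode_grade[OF u v, of n] t by simp
qed

text \<open>This brings the sums of the Zhu algebra into the form of the left side of the Borcherds
  identity with exponents (l, k, q - l - 2); beyond \<open>k\<close> the binomial coefficients
  vanish.\<close>

lemma zm_sum_vmode:
  assumes t: "t \<in> mspace Z" and u: "u \<in> vgrade V k" and v: "v \<in> vgrade V q" and K: "Suc k \<le> K"
  shows "zm (\<Sum>i\<le>k. vscale V (of_nat (k choose i)) (vmode V u (int i + l) v)) t =
    (\<Sum>i<K. mscale Z (of_int (int k) gchoose i) (mode (vmode V u (l + int i) v) (int k + (int q - l - 2) - int i) t))"
proof -
  have "zm (\<Sum>i\<le>k. vscale V (of_nat (k choose i)) (vmode V u (int i + l) v)) t =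
    (\<Sum>i\<le>k. mscale Z (of_int (int k) gchoose i) (mode (vmode V u (l + int i) v) (int k + (int q - l - 2) - int i) t))"
    unfolding zm_sum_left[OF t] zm_scale_left[OF t] zm_vmode[OF t u v]
    by (rule sum.cong) (simp_all add: binomial_gbinomial algebra_simps)
  also have "\<dots> = (\<Sum>i<K. mscale Z (of_int (int k) gchoose i) (mode (vmode V u (l + int i) v) (int k + (int q - l - 2) - int i) t))"
    by (rule sum.mono_neutral_left) (use K V.of_nat_gchoose_eq_0[of k] in auto)
  finally show ?thesis .
qed

text \<open>Zhu's computation, for top vectors of any degree. With l = -1 and m = k no product
  starting with a mode of \<open>u\<close> on \<open>t\<close> survives, and with n = q - 1 only i =
  0 is left of the others.\<close>

lemma zm_zhu_prod:
  assumes t: "top_vector j t"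
  shows "zm (zhu_prod V u v) t = zm u (zm v t)"
proof -
  note tS = grade_in_space[OF top_vector_in_grade[OF t]]
  show ?thesis
  proof (induction u rule: V.homogeneous_induct)
    case (add u u')
    then show ?case by (simp add: zhu_prod_add_left zm_add_left zm_in_space tS)
  next
    case (scale c u)
    then show ?case by (simp add: zhu_prod_scale_left zm_scale_left zm_in_space tS)
  next
    case (hom k u)
    have prod: "zm (zhu_prod V u (v + v')) t = zm (zhu_prod V u v) t + zm (zhu_prod V u v') t" for v v'
      by (simp add: zhu_prod_hom[OF hom] V.vmode_add V.scale_right_distrib sum.distrib zm_add_left tS)
    have prods: "zm (zhu_prod V u (vscale V c v)) t = mscale Z c (zm (zhu_prod V u v) t)" for c v
      by (simp add: zhu_prod_hom[OF hom] V.vmode_scale zm_sum_left zm_scale_left scale_sum_right mult.commute tS)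
    show ?case
    proof (induction v rule: V.homogeneous_induct)
      case (hom q v)
      note u = \<open>u \<in> vgrade V k\<close>
      have "\<exists>K0. \<forall>K\<ge>K0. (\<Sum>i<K. mscale Z (of_int (int k) gchoose i) (mode (vmode V u (-1 + int i) v) (int k + (int q - 1) - int i) t))
        = (\<Sum>i<1. mscale Z ((-1) ^ i * (of_int (-1) gchoose i)) (mode u (int k + -1 - int i) (mode v (int q - 1 + int i) t)))"
        by (rule circle_relation[OF tS]) (use top_vectorD[OF t u] top_vectorD[OF t hom] in simp_all)
      then obtain K0 where K0: "\<And>K. K \<ge> K0 \<Longrightarrow> (\<Sum>i<K. mscale Z (of_int (int k) gchoose i) (mode (vmode V u (-1 + int i) v) (int k + (int q - 1) - int i) t))
        = mode u (int k - 1) (mode v (int q - 1) t)" by auto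
      have "zm (zhu_prod V u v) t = mode u (int k - 1) (mode v (int q - 1) t)"
        using zm_sum_vmode[OF tS u hom, of "max K0 (Suc k)" "-1"] K0[of "max K0 (Suc k)"]
        by (simp add: zhu_prod_hom[OF u])
      then show ?case using u hom tS by (simp add: zm_hom mode_closed)
    qed (simp_all add: prod prods zm_add_left zm_scale_left tS zm_add zm_scale zm_in_space)
  qed
qed

text \<open>The computation of \<open>zm_zhu_prod\<close> with l = -2 and n = q leaves no term on
  the right.\<close>

lemma zm_zhu_O:
  assumes t: "top_vector j t" and x: "x \<in> zhu_O V"
  shows "zm x t = 0"
proof -
  note tS = grade_in_space[OF top_vector_in_grade[OF t]]
  have gens: "zm (\<Sum>i\<le>k. vscale V (of_nat (k choose i)) (vmode V u (int i - 2) v)) t = 0"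
    if u: "u \<in> vgrade V k" for k u v
  proof (induction v rule: V.homogeneous_induct)
    case (hom q v)
    have "\<exists>K0. \<forall>K\<ge>K0. (\<Sum>i<K. mscale Z (of_int (int k) gchoose i) (mode (vmode V u (-2 + int i) v) (int k + int q - int i) t))
      = (\<Sum>i<0. mscale Z ((-1) ^ i * (of_int (-2) gchoose i)) (mode u (int k + -2 - int i) (mode v (int q + int i) t)))"
      by (rule circle_relation[OF tS]) (use top_vectorD[OF t u] top_vectorD[OF t hom] in simp_all)
    then obtain K0 where K0: "\<And>K. K \<ge> K0 \<Longrightarrow> (\<Sum>i<K. mscale Z (of_int (int k) gchoose i) (mode (vmode V u (-2 + int i) v) (int k + int q - int i) t)) = 0"
      by auto
    then show ?case
      using zm_sum_vmode[OF tS u hom, of "max K0 (Suc k)" "-2"] K0[of "max K0 (Suc k)"] by simp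
  next
    case (add v v')
    then show ?case by (simp add: V.vmode_add V.scale_right_distrib sum.distrib zm_add_left tS)
  next
    case (scale c v)
    have "zm (\<Sum>i\<le>k. vscale V (of_nat (k choose i)) (vmode V u (int i - 2) (vscale V c v))) t =
        mscale Z c (zm (\<Sum>i\<le>k. vscale V (of_nat (k choose i)) (vmode V u (int i - 2) v)) t)"
      by (simp add: V.vmode_scale zm_sum_left zm_scale_left scale_sum_right mult.commute tS)
    then show ?case using scale by simp
  qed
  show ?thesis
    using x unfolding zhu_O_def
  proof (induction rule: V.span_induct_alt)
    case (step c a y)
    then show ?case using gens tS by (auto simp: zm_add_left zm_scale_left)
  qed (simp add: tS)
qed

end

section \<open>Graded submodules and socles\<close>

lemma restrict_module_simps [simp]:
  "mscale (restrict_module Z S) = mscale Z" "mspace (restrict_module Z S) = S"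
  "mmode (restrict_module Z S) = mmode Z" "mgrade (restrict_module Z S) = (\<lambda>n. S \<inter> mgrade Z n)"
  by (simp_all add: restrict_module_def)

context voa_admissible
begin

abbreviation "adm \<equiv> admissible_submodule Z"

lemma admD:
  assumes "adm S"
  shows adm_subspace: "subspace S" and adm_subset: "S \<subseteq> mspace Z"
    and adm_mode: "w \<in> S \<Longrightarrow> mode u n w \<in> S" and adm_gcomp: "w \<in> S \<Longrightarrow> gcomp (mgrade Z) w k \<in> S"
  using assms by (auto simp: admissible_submodule_iff submodule_def)

lemma admI:
  assumes "subspace S" "S \<subseteq> mspace Z" "\<And>u n w. w \<in> S \<Longrightarrow> mode u n w \<in> S"
    "\<And>w k. w \<in> S \<Longrightarrow> gcomp (mgrade Z) w k \<in> S"
  shows "adm S"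
  using assms by (auto simp: admissible_submodule_iff submodule_def)

lemma admissible_module_restrict:
  assumes S: "adm S"
  shows "admissible_module V (restrict_module Z S)"
proof -
  note sub = subsetD[OF adm_subset[OF S]]
  show ?thesis
  proof unfold_locales
    show "direct_sum_of (mscale (restrict_module Z S)) (mspace (restrict_module Z S)) UNIV (mgrade (restrict_module Z S))"
      using S by (simp add: admissible_submodule_def)
    show "mmode (restrict_module Z S) u m w \<in> mgrade (restrict_module Z S) (nat (int n + int k - m - 1))"
      if "u \<in> vgrade V k" "w \<in> mgrade (restrict_module Z S) n" "int n + int k - m - 1 \<ge> 0" for u k w n m
      using that adm_mode[OF S] mode_grade by auto
    show "mmode (restrict_module Z S) u m w = 0"
      if "u \<in> vgrade V k" "w \<in> mgrade (restrict_module Z S) n" "int n + int k - m - 1 < 0" for u k w n m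
      using that mode_grade_neg by auto
  qed (use S sub in \<open>simp_all add: scale_right_distrib scale_left_distrib adm_subspace adm_mode mode_add mode_scale
        mode_add_left mode_scale_left truncation vacuum_mode borcherds\<close>)
qed

lemma admissible_submodule_restrict:
  assumes S: "adm S"
  shows "admissible_submodule (restrict_module Z S) T \<longleftrightarrow> adm T \<and> T \<subseteq> S"
proof -
  have "(\<lambda>n. T \<inter> (S \<inter> mgrade Z n)) = (\<lambda>n. T \<inter> mgrade Z n)" if "T \<subseteq> S" using that by blast
  then show ?thesis
    unfolding admissible_submodule_def submodule_def restrict_module_simps
    using adm_subset[OF S] by (metis order_trans)
qed

definition irr :: "'m set \<Rightarrow> bool" where
  "irr S \<longleftrightarrow> adm S \<and> irreducible_module V (restrict_module Z S)"

lemma irr_iff: "irr S \<longleftrightarrow> adm S \<and> S \<noteq> {0} \<and> (\<forall>T. adm T \<and> T \<subseteq> S \<longrightarrow> T = {0} \<or> T = S)"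
  unfolding irr_def irreducible_module_def
  using admissible_module_restrict admissible_submodule_restrict by (metis restrict_module_simps(2))

lemma adm_span_Union:
  assumes "\<And>S. S \<in> \<S> \<Longrightarrow> adm S"
  shows "adm (span (\<Union>\<S>))"
proof -
  have sub: "span (\<Union>\<S>) \<subseteq> mspace Z"
    by (rule span_minimal) (use assms adm_subset space_subspace in auto)
  have *: "x \<in> mspace Z \<and> mode u n x \<in> span (\<Union>\<S>) \<and> gcomp (mgrade Z) x k \<in> span (\<Union>\<S>)"
    if "x \<in> span (\<Union>\<S>)" for x u n k
    using that
  proof (induction rule: span_induct_alt)
    case base
    then show ?case by (simp add: span_zero subspace_0[OF space_subspace])
  next
    case (step c x y)
    then obtain S where S: "S \<in> \<S>" "x \<in> S" by blast
    then have "x \<in> mspace Z" "mode u n x \<in> \<Union>\<S>" "gcomp (mgrade Z) x k \<in> \<Union>\<S>"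
      using adm_subset[OF assms[OF S(1)]] adm_mode[OF assms[OF S(1)]] adm_gcomp[OF assms[OF S(1)]] by blast+
    then have "x \<in> mspace Z" "mode u n x \<in> span (\<Union>\<S>)" "gcomp (mgrade Z) x k \<in> span (\<Union>\<S>)"
      by (simp_all add: span_base)
    then show ?case using step
      by (simp add: mode_add mode_scale gcomp_add gcomp_scale span_add span_scale
          subspace_add[OF space_subspace] subspace_scale[OF space_subspace])
  qed
  show ?thesis by (rule admI) (use sub * in simp_all)
qed

lemma adm_Int: "adm S \<Longrightarrow> adm T \<Longrightarrow> adm (S \<inter> T)"
  by (rule admI) (auto simp: adm_subspace subspace_inter adm_mode adm_gcomp dest: adm_subset)

lemma adm_span_Un: "adm S \<Longrightarrow> adm T \<Longrightarrow> adm (span (S \<union> T))"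
  using adm_span_Union[of "{S, T}"] by auto

definition socle :: "'m set" where
  "socle = span (\<Union>{S. irr S})"

lemma adm_socle: "adm socle"
  unfolding socle_def by (rule adm_span_Union) (simp add: irr_iff)

text \<open>The independence clause of \<open>direct_sum_of\<close> for a family indexed by itself,
  split off as the property to which Zorn's lemma is applied.\<close>

definition independent_family :: "'m set set \<Rightarrow> bool" where
  "independent_family \<S> \<longleftrightarrow> (\<forall>J f. finite J \<and> J \<subseteq> \<S> \<and> (\<forall>S\<in>J. f S \<in> S) \<and> (\<Sum>S\<in>J. f S) = 0 \<longrightarrow> (\<forall>S\<in>J. f S = 0))"

lemma independent_familyD:
  assumes "independent_family \<S>" "finite J" "J \<subseteq> \<S>" "\<And>S. S \<in> J \<Longrightarrow> f S \<in> S" "(\<Sum>S\<in>J. f S) = 0" "S \<in> J"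
  shows "f S = 0"
  using assms(1)[unfolded independent_family_def, rule_format, of J f S] assms(2-) by simp

lemma independent_familyI:
  assumes "\<And>J f S. finite J \<Longrightarrow> J \<subseteq> \<S> \<Longrightarrow> (\<And>S. S \<in> J \<Longrightarrow> f S \<in> S) \<Longrightarrow> (\<Sum>S\<in>J. f S) = 0 \<Longrightarrow> S \<in> J \<Longrightarrow> f S = 0"
  shows "independent_family \<S>"
  unfolding independent_family_def by (intro allI impI ballI, elim conjE, rule assms) blast+

lemma independent_family_insert:
  assumes ind: "independent_family \<S>" and sub: "\<And>T. T \<in> insert S \<S> \<Longrightarrow> subspace T"
    and S: "S \<inter> span (\<Union>\<S>) = {0}"
  shows "independent_family (insert S \<S>)"
proof (rule independent_familyI)
  fix J f T0 assume J: "finite J" "J \<subseteq> insert S \<S>" "\<And>T. T \<in> J \<Longrightarrow> f T \<in> T" "(\<Sum>T\<in>J. f T) = 0" "T0 \<in> J"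
  have fS: "f S = 0" if SJ: "S \<in> J"
  proof -
    have sum: "f S + (\<Sum>T\<in>J - {S}. f T) = 0" using J(1,4) SJ by (metis sum.remove)
    have "(\<Sum>T\<in>J - {S}. f T) \<in> span (\<Union>\<S>)"
      by (rule span_sum, rule span_base) (use J in blast)
    then have "f S \<in> span (\<Union>\<S>)" using sum by (metis add_eq_0_iff2 span_neg)
    then show "f S = 0" using S J(3)[OF SJ] by blast
  qed
  have "(\<Sum>T\<in>J - {S}. f T) = 0"
    using J(1,4) fS sum.remove[of J S f] by (cases "S \<in> J") auto
  then have "f T = 0" if "T \<in> J - {S}" for T
    using independent_familyD[OF ind, of "J - {S}" f T] J that by blast
  then show "f T0 = 0" using fS J(5) by blast
qed

text \<open>Independence involves finitely many members at a time, so a maximal independent family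
  of irreducible submodules exists. An irreducible submodule either lies in its span or meets the
  span in 0, and then it would enlarge the family.\<close>

lemma completely_reducible_if_socle:
  assumes "mspace Z \<subseteq> socle"
  shows "completely_reducible V Z"
proof -
  define A where "A = {\<S>. \<S> \<subseteq> {S. irr S} \<and> independent_family \<S>}"
  have "\<exists>M\<in>A. \<forall>X\<in>A. M \<subseteq> X \<longrightarrow> X = M"
  proof (rule subset_Zorn')
    fix C assume C: "subset.chain A C"
    have "independent_family (\<Union>C)"
    proof (rule independent_familyI)
      fix J f S assume J: "finite J" "J \<subseteq> \<Union>C" "\<And>S. S \<in> J \<Longrightarrow> f S \<in> S" "(\<Sum>S\<in>J. f S) = 0" "S \<in> J"
      then have "C \<noteq> {}" by blast
      then obtain \<S> where S: "\<S> \<in> C" "J \<subseteq> \<S>"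
        using finite_subset_Union_chain[OF J(1,2) _ C] by blast
      then have "independent_family \<S>" using C by (auto simp: subset.chain_def A_def)
      from independent_familyD[OF this J(1) S(2) J(3-5)] show "f S = 0" .
    qed
    then show "\<Union>C \<in> A" using C by (auto simp: A_def subset.chain_def)
  qed
  then obtain M where M: "M \<subseteq> {S. irr S}" "independent_family M"
    and max: "\<And>X. X \<in> A \<Longrightarrow> M \<subseteq> X \<Longrightarrow> X = M" by (auto simp: A_def)
  have admM: "adm (span (\<Union>M))" by (rule adm_span_Union) (use M in \<open>auto simp: irr_iff\<close>)
  have "S \<subseteq> span (\<Union>M)" if S: "irr S" for S
  proof (rule ccontr)
    assume n: "\<not> S \<subseteq> span (\<Union>M)"
    have "adm (S \<inter> span (\<Union>M))" using S admM adm_Int by (simp add: irr_iff)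
    then have "S \<inter> span (\<Union>M) = {0}" using S n unfolding irr_iff by (metis inf.orderI inf_le1)
    then have "independent_family (insert S M)"
      by (intro independent_family_insert) (use M S adm_subspace in \<open>auto simp: irr_iff\<close>)
    then have "insert S M \<in> A" using M S by (simp add: A_def)
    then have "S \<in> M" using max[of "insert S M"] by blast
    then show False using n span_superset by blast
  qed
  then have "socle \<subseteq> span (\<Union>M)" unfolding socle_def by (intro span_minimal) auto
  then have eq: "mspace Z = span (\<Union>M)" using assms adm_subset[OF admM] by blast
  have "direct_sum_of (mscale Z) (mspace Z) M (\<lambda>S. S)"
    unfolding direct_sum_of_def
    using eq M(2)[unfolded independent_family_def] M(1) adm_subspace by (auto simp: irr_iff)
  then show ?thesis
    unfolding completely_reducible_def using M(1) by (auto simp: irr_def)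
qed

lemma finite_support_span_Union:
  assumes "x \<in> span (\<Union>\<S>)"
  shows "\<exists>\<T>. finite \<T> \<and> \<T> \<subseteq> \<S> \<and> x \<in> span (\<Union>\<T>)"
  using assms
proof (induction rule: span_induct_alt)
  case base
  show ?case by (rule exI[of _ "{}"]) simp
next
  case (step c x y)
  then obtain S \<T> where "S \<in> \<S>" "x \<in> S" "finite \<T>" "\<T> \<subseteq> \<S>" "y \<in> span (\<Union>\<T>)" by blast
  moreover from this have "mscale Z c x + y \<in> span (\<Union>(insert S \<T>))"
    using span_mono[of "\<Union>\<T>" "\<Union>(insert S \<T>)"] by (intro span_add span_scale) (auto intro: span_base)
  ultimately show ?case by (intro exI[of _ "insert S \<T>"]) simp
qed

text \<open>Induction removes one summand \<open>S\<close>, with \<open>P\<close> the sum of the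
  others. If R + P meets \<open>S\<close> in 0, then \<open>R\<close> lies in \<open>P\<close>.
  Otherwise a nonzero vector of degree \<open>j\<close> in \<open>S\<close> is a sum r + p; the
  component of r of degree \<open>j\<close> vanishes, so the vector lies in \<open>P\<close>, hence
  so does \<open>S\<close>, and again \<open>R\<close> lies in \<open>P\<close>. No sorting by
  isomorphism type is involved.\<close>

lemma sum_of_irr_bottom:
  assumes "finite \<S>" "\<And>S. S \<in> \<S> \<Longrightarrow> irr S \<and> S \<inter> mgrade Z j \<noteq> {0}"
    and "adm R" "R \<subseteq> span (\<Union>\<S>)" "R \<inter> mgrade Z j = {0}"
  shows "R = {0}"
  using assms
proof (induction \<S>)
  case empty
  then show ?case using adm_subspace subspace_0 by auto
next
  case (insert S \<S>)
  define P where "P = span (\<Union>\<S>)"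
  have P: "adm P" unfolding P_def by (rule adm_span_Union) (use insert.prems in \<open>auto simp: irr_iff\<close>)
  have S: "irr S" "S \<inter> mgrade Z j \<noteq> {0}" using insert.prems by auto
  have Ssub: "subspace S" "adm S" using S adm_subspace by (auto simp: irr_iff)
  have dec: "\<exists>s\<in>S. \<exists>p\<in>P. r = s + p" if "r \<in> R" for r
  proof -
    have "r \<in> span (S \<union> \<Union>\<S>)" using that insert.prems by auto
    then show ?thesis unfolding span_Un P_def using Ssub span_eq_iff by blast
  qed
  have "adm (span (R \<union> P) \<inter> S)" using adm_Int adm_span_Un insert.prems P Ssub by blast
  then consider "span (R \<union> P) \<inter> S = {0}" | "S \<subseteq> span (R \<union> P)"
    using S unfolding irr_iff by blast
  then have "R \<subseteq> P"
  proof cases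
    case 1
    show ?thesis
    proof
      fix r assume r: "r \<in> R"
      then obtain s p where sp: "s \<in> S" "p \<in> P" "r = s + p" using dec by blast
      then have "s = r - p" by simp
      also have "\<dots> \<in> span (R \<union> P)" using r sp by (intro span_diff span_base) auto
      finally have "s = 0" using 1 sp by blast
      then show "r \<in> P" using sp by simp
    qed
  next
    case 2
    obtain s where s: "s \<in> S" "s \<in> mgrade Z j" "s \<noteq> 0"
      using S subspace_0[OF Ssub(1)] subspace_0[OF subspace_grade] by blast
    then have "s \<in> span (R \<union> P)" using 2 by blast
    then obtain r p where rp: "r \<in> R" "p \<in> P" "s = r + p"
      unfolding span_Un using adm_subspace[OF P] adm_subspace[OF insert.prems(2)] span_eq_iff by blast
    have inS: "r \<in> mspace Z" "p \<in> mspace Z" using rp adm_subset P insert.prems by blast+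
    have "gcomp (mgrade Z) r j = 0"
      using adm_gcomp[OF insert.prems(2) rp(1)] gcomp_in[OF inS(1)] insert.prems(4) by blast
    then have "s = gcomp (mgrade Z) p j" using gcomp_hom[OF s(2), of j] rp inS by (simp add: gcomp_add)
    then have "s \<in> P" using adm_gcomp[OF P] rp by simp
    then have "S \<inter> P \<noteq> {0}" using s by blast
    moreover have "adm (S \<inter> P)" using adm_Int P Ssub by blast
    ultimately have SP: "S \<subseteq> P" using S unfolding irr_iff by (metis inf.orderE inf_commute inf_le1 inf.cobounded2)
    show ?thesis
    proof
      fix r assume "r \<in> R"
      then obtain s p where "s \<in> S" "p \<in> P" "r = s + p" using dec by blast
      then show "r \<in> P" using SP subspace_add[OF adm_subspace[OF P]] by blast
    qed
  qed
  then show ?case using insert.IH insert.prems by (simp add: P_def)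
qed

end

section \<open>Semisimplicity of the Zhu algebra\<close>

context vertex_operator_algebra
begin

lemma subspace_zhu_O [simp]: "subspace (zhu_O V)"
  by (simp add: zhu_O_def)

lemma zhu_class_eq_iff: "zhu_class V u = zhu_class V v \<longleftrightarrow> u - v \<in> zhu_O V"
proof
  assume "zhu_class V u = zhu_class V v"
  moreover have "u \<in> zhu_class V u" by (simp add: zhu_class_def subspace_0)
  ultimately show "u - v \<in> zhu_O V" by (simp add: zhu_class_def)
next
  assume d: "u - v \<in> zhu_O V"
  show "zhu_class V u = zhu_class V v"
    unfolding zhu_class_def
  proof (intro Collect_cong iffI)
    fix x assume "x - u \<in> zhu_O V"
    from subspace_add[OF subspace_zhu_O this d] show "x - v \<in> zhu_O V" by simp
  next
    fix x assume "x - v \<in> zhu_O V"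
    from subspace_diff[OF subspace_zhu_O this d] show "x - u \<in> zhu_O V" by simp
  qed
qed

lemma self_in_zhu_class: "u \<in> zhu_class V u"
  by (simp add: zhu_class_def subspace_0)

lemma zhu_class_mem: "v \<in> zhu_class V u \<Longrightarrow> zhu_class V v = zhu_class V u"
  by (simp add: zhu_class_eq_iff) (simp add: zhu_class_def)

lemma zhu_add: "zhu_class V u \<oplus>\<^bsub>zhu_algebra V\<^esub> zhu_class V v = zhu_class V (u + v)"
proof -
  have "zhu_class V (x + y) = zhu_class V (u + v)" if "x \<in> zhu_class V u" "y \<in> zhu_class V v" for x y
  proof -
    have "x - u \<in> zhu_O V" "y - v \<in> zhu_O V" using that by (auto simp: zhu_class_def)
    from subspace_add[OF subspace_zhu_O this] show ?thesis by (simp add: zhu_class_eq_iff algebra_simps)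
  qed
  then have "(\<Union>x\<in>zhu_class V u. \<Union>y\<in>zhu_class V v. zhu_class V (x + y)) =
      (\<Union>x\<in>zhu_class V u. \<Union>y\<in>zhu_class V v. zhu_class V (u + v))"
    by (intro SUP_cong refl)
  also have "\<dots> = zhu_class V (u + v)"
    using self_in_zhu_class[of u] self_in_zhu_class[of v] by blast
  finally show ?thesis by (simp add: zhu_algebra_def)
qed

text \<open>That the product is well defined is read off from the ring axioms: a product of classes
  is in the carrier, hence a single class, and it contains the product of the
  representatives.\<close>

lemma zhu_mult:
  assumes "Ring.ring (zhu_algebra V)"
  shows "zhu_class V u \<otimes>\<^bsub>zhu_algebra V\<^esub> zhu_class V v = zhu_class V (zhu_prod V u v)"
proof -
  interpret R: Ring.ring "zhu_algebra V" by fact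
  let ?M = "zhu_class V u \<otimes>\<^bsub>zhu_algebra V\<^esub> zhu_class V v"
  have "?M \<in> carrier (zhu_algebra V)"
    by (rule R.m_closed) (simp_all add: zhu_algebra_def)
  then obtain w where w: "?M = zhu_class V w" by (auto simp: zhu_algebra_def)
  have "zhu_prod V u v \<in> ?M"
    using self_in_zhu_class unfolding zhu_algebra_def by auto
  then show ?thesis using w zhu_class_mem by metis
qed

text \<open>\<open>I\<close> is the preimage of a left ideal. The unit splits along a complement J
  into the classes of \<open>e\<close> in \<open>I\<close> and of \<open>f\<close>; every multiple
  of \<open>f\<close> has its class in J, so this class is 0 as soon as the multiple lies in
  \<open>I\<close>.\<close>

lemma zhu_one_add_decomposition:
  assumes ss: "semisimple_ring (zhu_algebra V)"
    and I: "subspace I" "zhu_O V \<subseteq> I" "\<And>a x. x \<in> I \<Longrightarrow> zhu_prod V a x \<in> I"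
  shows "\<exists>e f. e \<in> I \<and> vacuum V - (e + f) \<in> zhu_O V \<and> (\<forall>a. zhu_prod V a f \<in> I \<longrightarrow> zhu_prod V a f \<in> zhu_O V)"
proof -
  let ?R = "zhu_algebra V" and ?I = "zhu_class V ` I"
  interpret R: Ring.ring ?R using ss by (simp add: semisimple_ring_def)
  have car: "carrier ?R = range (zhu_class V)" by (simp add: zhu_algebra_def)
  have zero: "\<zero>\<^bsub>?R\<^esub> = zhu_class V 0" by (simp add: zhu_algebra_def)
  have inv: "\<ominus>\<^bsub>?R\<^esub> zhu_class V u = zhu_class V (- u)" for u
    by (rule R.minus_equality) (simp_all add: zhu_add zero car)
  have memI: "x \<in> I" if "zhu_class V x \<in> ?I" for x
  proof -
    obtain y where "y \<in> I" "x - y \<in> zhu_O V" using \<open>zhu_class V x \<in> ?I\<close> by (auto simp: zhu_class_eq_iff)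
    then show ?thesis using I(2) subspace_add[OF I(1), of "x - y" y] by auto
  qed
  have "additive_subgroup ?I ?R"
  proof (intro additive_subgroup.intro subgroup.intro)
    show "?I \<subseteq> carrier (add_monoid ?R)" by (auto simp: car)
    show "x \<otimes>\<^bsub>add_monoid ?R\<^esub> y \<in> ?I" if "x \<in> ?I" "y \<in> ?I" for x y
      using that I(1) by (auto simp: zhu_add subspace_add)
    show "\<one>\<^bsub>add_monoid ?R\<^esub> \<in> ?I" using subspace_0[OF I(1)] by (auto simp: zero)
    show "inv\<^bsub>add_monoid ?R\<^esub> x \<in> ?I" if "x \<in> ?I" for x
      using that inv subspace_neg[OF I(1)] by (auto simp: a_inv_def)
  qed
  moreover have "\<forall>a\<in>carrier ?R. \<forall>x\<in>?I. a \<otimes>\<^bsub>?R\<^esub> x \<in> ?I"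
    using I(3) by (auto simp: car zhu_mult[OF R.ring_axioms])
  ultimately have "left_ideal ?I ?R" by (simp add: left_ideal_def)
  then obtain J where J: "left_ideal J ?R" "?I \<inter> J = {\<zero>\<^bsub>?R\<^esub>}" "?I <+>\<^bsub>?R\<^esub> J = carrier ?R"
    using ss by (auto simp: semisimple_ring_def)
  have Jsub: "J \<subseteq> carrier ?R" using J(1) additive_subgroup.a_subset by (auto simp: left_ideal_def)
  have "zhu_class V (vacuum V) \<in> ?I <+>\<^bsub>?R\<^esub> J" using J(3) car by simp
  then obtain x y where "x \<in> ?I" "y \<in> J" "zhu_class V (vacuum V) = x \<oplus>\<^bsub>?R\<^esub> y"
    by (auto simp: set_add_def')
  moreover from this obtain f where "y = zhu_class V f" using Jsub car by blast
  ultimately obtain e f where e: "e \<in> I" and f: "zhu_class V f \<in> J"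
    and ef: "zhu_class V (vacuum V) = zhu_class V (e + f)" by (auto simp: zhu_add)
  have "zhu_prod V a f \<in> zhu_O V" if "zhu_prod V a f \<in> I" for a
  proof -
    have "zhu_class V a \<otimes>\<^bsub>?R\<^esub> zhu_class V f \<in> J" using J(1) f car by (auto simp: left_ideal_def)
    then have "zhu_class V (zhu_prod V a f) \<in> J" by (simp add: zhu_mult[OF R.ring_axioms])
    moreover have "zhu_class V (zhu_prod V a f) \<in> ?I" using that by simp
    ultimately have "zhu_class V (zhu_prod V a f) = zhu_class V 0" using J(2) zero by blast
    then show ?thesis by (simp add: zhu_class_eq_iff)
  qed
  then show ?thesis using e ef by (auto simp: zhu_class_eq_iff)
qed

end

context voa_admissible
begin

text \<open>A complement for a single generator: the vectors whose zero modes take \<open>t\<close>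
  into \<open>W\<close> form the preimage of a left ideal, and the decomposition of the unit is
  applied to \<open>t\<close>. If a zero mode takes x = \<open>zm f t\<close> into \<open>W\<close>,
  the corresponding multiple of \<open>f\<close> lies in \<open>I\<close>, hence in
  \<open>zhu_O V\<close>, and acts by 0.\<close>

lemma top_vector_decomposition:
  assumes ss: "semisimple_ring (zhu_algebra V)" and t: "top_vector j t"
    and W: "subspace W" "\<And>u w. w \<in> W \<Longrightarrow> zm u w \<in> W"
  shows "\<exists>x y. y \<in> W \<and> t = x + y \<and> x \<in> gen_part t j j \<and> y \<in> gen_part t j j \<and> gen_part x j j \<inter> W = {0}"
proof -
  note tS = grade_in_space[OF top_vector_in_grade[OF t]]
  define I where "I = {u. zm u t \<in> W}"
  have I: "V.subspace I"
    by (rule V.subspaceI)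
      (simp_all add: I_def tS zm_add_left zm_scale_left subspace_0[OF W(1)] subspace_add[OF W(1)] subspace_scale[OF W(1)])
  have "\<exists>e f. e \<in> I \<and> vacuum V - (e + f) \<in> zhu_O V \<and> (\<forall>a. zhu_prod V a f \<in> I \<longrightarrow> zhu_prod V a f \<in> zhu_O V)"
    by (rule V.zhu_one_add_decomposition[OF ss I])
      (auto simp: I_def zm_zhu_O[OF t] zm_zhu_prod[OF t] W subspace_0[OF W(1)])
  then obtain e f where e: "e \<in> I" and ef: "vacuum V - (e + f) \<in> zhu_O V"
    and f: "\<And>a. zhu_prod V a f \<in> I \<Longrightarrow> zhu_prod V a f \<in> zhu_O V" by blast
  have "zm (vacuum V) t = t" using zm_hom[OF V.vacuum_grade tS] vacuum_mode[OF tS, of "-1"] by simp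
  moreover have "zm (vacuum V) t - (zm e t + zm f t) = 0"
    using zm_zhu_O[OF t ef] by (simp add: zm_diff_left zm_add_left tS)
  ultimately have tef: "t = zm f t + zm e t" by (simp add: add.commute)
  have ft: "top_vector j (zm f t)" by (rule zm_top_vector[OF t])
  have "x = 0" if x: "x \<in> gen_part (zm f t) j j" "x \<in> W" for x
  proof -
    have "x \<in> range (\<lambda>a. zm a (zm f t))"
      using x(1) unfolding gen_part_eq_zm[OF top_vector_in_grade[OF ft]] .
    then obtain a where a: "x = zm a (zm f t)" by blast
    then have "x = zm (zhu_prod V a f) t" by (simp add: zm_zhu_prod[OF t])
    then show ?thesis using x f[of a] zm_zhu_O[OF t] by (simp add: I_def)
  qed
  then have "gen_part (zm f t) j j \<inter> W = {0}"
    using subspace_0[OF W(1)] subspace_0[OF subspace_gen_part] by blast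
  then show ?thesis using e tef zm_in_gen_part[OF top_vector_in_grade[OF t]]
    by (intro exI[of _ "zm f t"] exI[of _ "zm e t"]) (simp add: I_def)
qed

end

section \<open>Transport to another ambient space\<close>

text \<open>\<open>X\<close> starts in degree \<open>j\<close>, while a module generated by its top
  level starts in degree 0; hence the shift in \<open>image_module\<close>. Injectivity is asked on
  \<open>X\<close> only, as the ambient space may be too large to embed.\<close>

locale embedded_module = voa_admissible V Z + P: vector_space sc
  for V :: "'v::ab_group_add voa" and Z :: "('v, 'm::ab_group_add) vmod"
    and sc :: "complex \<Rightarrow> 'k::ab_group_add \<Rightarrow> 'k" +
  fixes X :: "'m set" and j :: nat and \<pi> :: "'m \<Rightarrow> 'k"
  assumes X: "admissible_submodule Z X"
    and below: "d < j \<Longrightarrow> X \<inter> mgrade Z d = {0}"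
    and lin: "Vector_Spaces.linear (mscale Z) sc \<pi>"
    and inj: "inj_on \<pi> X"
begin

sublocale pi: Vector_Spaces.linear "mscale Z" sc \<pi> by (rule lin)

definition image_module :: "('v, 'k) vmod" where
  "image_module = \<lparr>mscale = sc, mspace = \<pi> ` X,
     mmode = (\<lambda>u n y. \<pi> (mode u n (inv_into X \<pi> y))),
     mgrade = (\<lambda>k. \<pi> ` (X \<inter> mgrade Z (j + k)))\<rparr>"

lemma image_module_simps [simp]:
  "mscale image_module = sc" "mspace image_module = \<pi> ` X"
  "mgrade image_module k = \<pi> ` (X \<inter> mgrade Z (j + k))"
  by (simp_all add: image_module_def)

lemma image_mode [simp]: "x \<in> X \<Longrightarrow> mmode image_module u n (\<pi> x) = \<pi> (mode u n x)"
  by (simp add: image_module_def inv_into_f_f[OF inj])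

lemma X_space: "x \<in> X \<Longrightarrow> x \<in> mspace Z"
  using adm_subset[OF X] by blast

lemma pi_eq_0: "x \<in> X \<Longrightarrow> \<pi> x = 0 \<longleftrightarrow> x = 0"
  using inj_onD[OF inj, of x 0] subspace_0[OF adm_subspace[OF X]] by auto

lemmas X_closed = subspace_0[OF adm_subspace[OF X]] subspace_add[OF adm_subspace[OF X]]
  subspace_scale[OF adm_subspace[OF X]] subspace_diff[OF adm_subspace[OF X]] adm_mode[OF X]

lemma pi_image_eq: "S \<subseteq> X \<Longrightarrow> T \<subseteq> X \<Longrightarrow> \<pi> ` S = \<pi> ` T \<Longrightarrow> S = T"
  using inj by (simp add: inj_on_image_eq_iff)

lemma image_borcherds:
  assumes x: "x \<in> X"
  shows "borcherds_identity (vmode V) sc (mmode image_module) u v (\<pi> x)"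
proof (rule borcherds_identityI)
  fix l m n
  have L: "borcherds_lhs (vmode V) sc (mmode image_module) u v (\<pi> x) l m n i = \<pi> (lhs u v x l m n i)" for i
    by (simp add: borcherds_lhs_def x pi.scale)
  have R: "borcherds_rhs sc (mmode image_module) u v (\<pi> x) l m n i = \<pi> (rhs u v x l m n i)" for i
    by (simp add: borcherds_rhs_def x pi.scale pi.diff X_closed)
  obtain K1 where K1: "\<forall>i\<ge>K1. lhs u v x l m n i = 0 \<and> rhs u v x l m n i = 0"
    using borcherds_support[OF X_space[OF x]] by blast
  obtain K2 where K2: "\<forall>K\<ge>K2. (\<Sum>i<K. lhs u v x l m n i) = (\<Sum>i<K. rhs u v x l m n i)"
    using borcherds_sums[OF X_space[OF x]] by blast
  show "\<exists>K. (\<forall>i\<ge>K. borcherds_lhs (vmode V) sc (mmode image_module) u v (\<pi> x) l m n i = 0) \<and>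
      (\<forall>i\<ge>K. borcherds_rhs sc (mmode image_module) u v (\<pi> x) l m n i = 0) \<and>
      (\<Sum>i<K. borcherds_lhs (vmode V) sc (mmode image_module) u v (\<pi> x) l m n i) =
      (\<Sum>i<K. borcherds_rhs sc (mmode image_module) u v (\<pi> x) l m n i)"
    unfolding L R pi.sum[symmetric] using K1 K2 by (intro exI[of _ "max K1 K2"]) auto
qed

lemma space_above: "X = span (\<Union>k. X \<inter> mgrade Z (j + k))"
proof
  have "X = span (\<Union>n. X \<inter> mgrade Z n)"
    using X by (simp add: admissible_submodule_def direct_sum_of_def)
  also have "\<dots> \<subseteq> span (\<Union>k. X \<inter> mgrade Z (j + k))"
  proof (rule span_minimal, safe)
    fix x n assume x: "x \<in> X" "x \<in> mgrade Z n"
    show "x \<in> span (\<Union>k. X \<inter> mgrade Z (j + k))"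
    proof (cases "n < j")
      case True
      then have "x = 0" using below[OF True] x by blast
      then show ?thesis by (simp add: span_zero)
    next
      case False
      then have "x \<in> X \<inter> mgrade Z (j + (n - j))" using x by simp
      then show ?thesis by (intro span_base) blast
    qed
  qed
  finally show "X \<subseteq> span (\<Union>k. X \<inter> mgrade Z (j + k))" .
  show "span (\<Union>k. X \<inter> mgrade Z (j + k)) \<subseteq> X"
    by (rule span_minimal) (use adm_subspace[OF X] in auto)
qed

lemma image_admissible: "admissible_module V image_module"
proof unfold_locales
  have "direct_sum_of sc (\<pi> ` X) UNIV (\<lambda>k. \<pi> ` (X \<inter> mgrade Z (j + k)))"
  proof (rule direct_sum_ofI)
    show "vector_space sc" by (rule P.vector_space_axioms)
    show "P.subspace (\<pi> ` (X \<inter> mgrade Z (j + k)))" for k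
      by (intro pi.subspace_image subspace_inter adm_subspace[OF X] subspace_grade)
    have "\<pi> ` X = \<pi> ` span (\<Union>k. X \<inter> mgrade Z (j + k))" using space_above by simp
    also have "\<dots> = P.span (\<Union>k. \<pi> ` (X \<inter> mgrade Z (j + k)))"
      unfolding pi.span_image[symmetric] image_UN ..
    finally show "\<pi> ` X = P.span (\<Union>k. \<pi> ` (X \<inter> mgrade Z (j + k)))" .
  next
    fix J :: "nat set" and f k
    assume J: "finite J" "\<And>i. i \<in> J \<Longrightarrow> f i \<in> \<pi> ` (X \<inter> mgrade Z (j + i))" "sum f J = 0" "k \<in> J"
    then have "\<forall>i\<in>J. \<exists>x. x \<in> X \<inter> mgrade Z (j + i) \<and> f i = \<pi> x" by auto
    then obtain g where g: "\<And>i. i \<in> J \<Longrightarrow> g i \<in> X \<inter> mgrade Z (j + i) \<and> f i = \<pi> (g i)" by metis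
    have "\<pi> (sum g J) = sum f J" unfolding pi.sum using g by (intro sum.cong) auto
    then have "sum g J = 0"
      using J(3) g pi_eq_0 subspace_sum[OF adm_subspace[OF X], of J g] by auto
    then have "(\<Sum>i\<in>(+) j ` J. g (i - j)) = 0" by (simp add: sum.reindex)
    then have "g (j + k - j) = 0"
      using J(1,4) g by (intro grade_independent[of "(+) j ` J" "\<lambda>i. g (i - j)"]) auto
    then show "f k = 0" using g[OF J(4)] by simp
  qed
  then show "direct_sum_of (mscale image_module) (mspace image_module) UNIV (mgrade image_module)"
    by (simp add: image_module_def)
next
  fix u k w n m assume u: "u \<in> vgrade V k" and w: "w \<in> mgrade image_module n"
  then obtain x where x: "x \<in> X" "x \<in> mgrade Z (j + n)" "w = \<pi> x" by auto
  show "mmode image_module u m w \<in> mgrade image_module (nat (int n + int k - m - 1))"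
    if "int n + int k - m - 1 \<ge> 0"
  proof -
    have "nat (int (j + n) + int k - m - 1) = j + nat (int n + int k - m - 1)" using that by simp
    then show ?thesis using mode_grade[OF u x(2), of m] that x(1,3) X_closed by simp
  qed
  show "mmode image_module u m w = 0" if neg: "int n + int k - m - 1 < 0"
  proof (cases "int (j + n) + int k - m - 1 \<ge> 0")
    \<comment> \<open>The degree in \<open>Z\<close> may be nonnegative although the shifted degree
      is negative; it is then below \<open>j\<close>, where \<open>X\<close> vanishes.\<close>
    case True
    then have "mode u m x \<in> X \<inter> mgrade Z (nat (int (j + n) + int k - m - 1))"
      using mode_grade[OF u x(2)] x(1) X_closed by simp
    moreover have "nat (int (j + n) + int k - m - 1) < j" using True neg by linarith
    ultimately have "mode u m x = 0" using below by blast
    then show ?thesis using x by simp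
  next
    case False
    then show ?thesis using mode_grade_neg[OF u x(2)] x by simp
  qed
next
  fix w u assume "w \<in> mspace image_module"
  then obtain x where x: "x \<in> X" "w = \<pi> x" by auto
  obtain N where "\<forall>n\<ge>N. mode u n x = 0" using truncation[OF X_space[OF x(1)]] by blast
  then show "\<exists>N. \<forall>n\<ge>N. mmode image_module u n w = 0" using x by (intro exI[of _ N]) simp
qed (auto simp: pi.subspace_image[OF adm_subspace[OF X]] P.scale_right_distrib P.scale_left_distrib pi.add[symmetric] pi.scale[symmetric] X_closed X_space
   mode_add mode_scale mode_add_left mode_scale_left vacuum_mode image_borcherds)

lemma image_admissible_submodule:
  assumes T: "adm T" "T \<subseteq> X"
  shows "admissible_submodule image_module (\<pi> ` T)"
proof -
  \<comment> \<open>The image of \<open>T\<close> is the image module built from \<open>T\<close> in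
    place of \<open>X\<close>, which yields its grading without a second computation.\<close>
  interpret E: embedded_module V Z sc T j \<pi>
  proof unfold_locales
    show "T \<inter> mgrade Z d = {0}" if "d < j" for d
      using below[OF that] T subspace_0[OF adm_subspace[OF T(1)]] subspace_0[OF subspace_grade] by auto
    show "inj_on \<pi> T" using inj T(2) by (rule inj_on_subset)
  qed (rule T)
  have "submodule image_module (\<pi> ` T)"
    unfolding submodule_def using T pi.subspace_image[OF adm_subspace[OF T(1)]] adm_mode[OF T(1)]
    by (auto simp: subset_iff)
  moreover have "(\<lambda>n. \<pi> ` T \<inter> mgrade image_module n) = mgrade E.image_module"
  proof
    fix n
    show "\<pi> ` T \<inter> mgrade image_module n = mgrade E.image_module n"
      using T(2) inj_onD[OF inj] by auto
  qed
  moreover have "direct_sum_of sc (\<pi> ` T) UNIV (mgrade E.image_module)"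
    using admissible_module.grading[OF E.image_admissible] by simp
  ultimately show ?thesis by (simp add: admissible_submodule_def)
qed

lemma irr_if_image_irreducible:
  assumes "irreducible_module V image_module"
  shows "irr X"
  unfolding irr_iff
proof (intro conjI allI impI X)
  show "X \<noteq> {0}" using assms by (auto simp: irreducible_module_def)
  fix T assume T: "adm T \<and> T \<subseteq> X"
  then have "\<pi> ` T = {0} \<or> \<pi> ` T = \<pi> ` X"
    using assms image_admissible_submodule by (auto simp: irreducible_module_def)
  then show "T = {0} \<or> T = X"
    using T pi_image_eq[of T X] pi_image_eq[of T "{0}"] X_closed(1) by auto
qed

lemma image_zero_mode:
  assumes x: "x \<in> X"
  shows "zero_mode V image_module u (\<pi> x) = \<pi> (zm u x)"
proof -
  interpret I: voa_admissible V image_module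
    by (intro voa_admissible.intro voa_weak_module.intro image_admissible V.vertex_operator_algebra_axioms
        admissible_module.axioms(1)[OF image_admissible])
  show ?thesis
    using x by (induction u rule: V.homogeneous_induct)
      (simp_all add: I.zm_add_left zm_add_left I.zm_scale_left zm_scale_left I.zm_hom zm_hom X_space pi.add pi.scale)
qed

end

section \<open>Cyclic submodules inside the polynomials\<close>

lemma vector_space_smult: "vector_space (smult :: complex \<Rightarrow> complex poly \<Rightarrow> complex poly)"
  by unfold_locales (simp_all add: smult_add_right smult_add_left)

lemma independent_monomials:
  "\<not> module.dependent smult (range (monom (1 :: complex)))"
proof -
  interpret P: vector_space "smult :: complex \<Rightarrow> complex poly \<Rightarrow> complex poly" by (rule vector_space_smult)
  have "coeff p n = 0" if "p \<in> P.span (range (monom 1) - {monom 1 n})" for p and n :: nat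
    using that
  proof (induction rule: P.span_induct_alt)
    case (step c x y)
    then obtain k where "x = monom 1 k" "k \<noteq> n" by blast
    then show ?case using step by simp
  qed simp
  then have "monom 1 n \<notin> P.span (range (monom 1) - {monom (1 :: complex) n})" for n
    using coeff_monom[of "1 :: complex" n n] by fastforce
  then show ?thesis unfolding P.dependent_def by blast
qed

context voa_admissible
begin

text \<open>The homogeneous parts of \<open>V\<close> have finite dimension, and only countably many
  weights and indices occur.\<close>

lemma countable_generators:
  assumes w: "w \<in> mspace Z"
  shows "\<exists>A. countable A \<and> gen w = span A"
proof -
  obtain B where B: "\<And>q. finite (B q)" "\<And>q. vgrade V q = V.span (B q)"
    using V.grade_finite_dim by metis
  define A where "A = (\<Union>q. \<Union>n. (\<lambda>v. mode v n w) ` B q)"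
  have "countable A" using B(1) by (auto simp: A_def countable_finite)
  moreover have "gen w = span A"
  proof
    show "gen w \<subseteq> span A"
      unfolding gen_homogeneous[OF w]
    proof (rule span_minimal, safe)
      fix v n q assume "v \<in> vgrade V q"
      then have "mode v n w \<in> span ((\<lambda>v. mode v n w) ` B q)" using B(2) mode_span_left[OF w] by blast
      then show "mode v n w \<in> span A" using span_mono[of "(\<lambda>v. mode v n w) ` B q" A] by (auto simp: A_def)
    qed
    show "span A \<subseteq> gen w" by (rule span_minimal) (auto simp: A_def mode_in_gen)
  qed
  ultimately show ?thesis by blast
qed

text \<open>A countable basis of \<open>gen w\<close> goes to distinct monomials, which are
  independent; outside \<open>gen w\<close> the linear extension is arbitrary.\<close>

lemma embedding_into_polynomials:
  assumes w: "w \<in> mspace Z"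
  shows "\<exists>\<pi>. Vector_Spaces.linear (mscale Z) (smult :: complex \<Rightarrow> complex poly \<Rightarrow> complex poly) \<pi> \<and> inj_on \<pi> (gen w)"
proof -
  interpret P: vector_space "smult :: complex \<Rightarrow> complex poly \<Rightarrow> complex poly" by (rule vector_space_smult)
  interpret VP: vector_space_pair "mscale Z" "smult :: complex \<Rightarrow> complex poly \<Rightarrow> complex poly" ..
  obtain A where A: "countable A" "gen w = span A" using countable_generators[OF w] by blast
  obtain B where B: "B \<subseteq> A" "independent B" "A \<subseteq> span B" by (rule maximal_independent_subset)
  have gB: "gen w = span B" using A B by (metis span_eq span_superset order_trans)
  have cB: "countable B" using A(1) B(1) by (rule countable_subset[rotated])
  define g where "g b = monom (1 :: complex) (to_nat_on B b)" for b
  obtain \<pi> where \<pi>: "Vector_Spaces.linear (mscale Z) smult \<pi>" "\<And>b. b \<in> B \<Longrightarrow> \<pi> b = g b"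
    using VP.linear_independent_extend[OF B(2), of g] by blast
  interpret pi: Vector_Spaces.linear "mscale Z" "smult :: complex \<Rightarrow> complex poly \<Rightarrow> complex poly" \<pi> by (rule \<pi>)
  have "\<pi> ` B \<subseteq> range (monom 1)" using \<pi>(2) by (auto simp: g_def)
  then have "P.independent (\<pi> ` B)" using independent_monomials P.dependent_mono by blast
  moreover have "inj_on \<pi> B"
  proof (rule inj_onI)
    fix x y assume "x \<in> B" "y \<in> B" "\<pi> x = \<pi> y"
    then have "to_nat_on B x = to_nat_on B y" using \<pi>(2) by (simp add: g_def monom_eq_iff')
    then show "x = y" using \<open>x \<in> B\<close> \<open>y \<in> B\<close> cB by simp
  qed
  ultimately have "inj_on \<pi> (span B)" by (rule pi.inj_on_span_independent_image)
  then show ?thesis using gB \<pi>(1) by metis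
qed

text \<open>Inside the polynomials and after the shift, \<open>gen t\<close> is generated by its top
  level, the image of \<open>gen_part t j j\<close>, on which zero modes act as before. The
  hypothesis on generated modules then applies, and irreducibility is pulled back.\<close>

lemma irr_gen:
  assumes H: "\<And>Y :: ('v, complex poly) vmod. generated_by_irreducible_top V Y \<Longrightarrow> irreducible_module V Y"
    and t: "top_vector j t" "t \<noteq> 0"
    and irred: "\<And>S. subspace S \<Longrightarrow> S \<subseteq> gen_part t j j \<Longrightarrow> (\<And>u w. w \<in> S \<Longrightarrow> zm u w \<in> S) \<Longrightarrow>
      S = {0} \<or> S = gen_part t j j"
  shows "irr (gen t)"
proof -
  note tj = top_vector_in_grade[OF t(1)]
  note tS = grade_in_space[OF tj]
  obtain \<pi> where \<pi>: "Vector_Spaces.linear (mscale Z) (smult :: complex \<Rightarrow> complex poly \<Rightarrow> complex poly) \<pi>"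
    "inj_on \<pi> (gen t)" using embedding_into_polynomials[OF tS] by blast
  interpret P: vector_space "smult :: complex \<Rightarrow> complex poly \<Rightarrow> complex poly" by (rule vector_space_smult)
  interpret E: embedded_module V Z "smult :: complex \<Rightarrow> complex poly \<Rightarrow> complex poly" "gen t" j \<pi>
  proof (intro embedded_module.intro embedded_module_axioms.intro)
    show "gen t \<inter> mgrade Z d = {0}" if "d < j" for d
      using gen_Int_grade[OF tj] top_vector_gen_part[OF t(1) that] by simp
  qed (rule voa_admissible_axioms vector_space_smult admissible_submodule_gen[OF tj] \<pi>)+
  have tg: "t \<in> gen t \<inter> mgrade Z j" using self_in_gen[OF tS] tj by simp
  have "irreducible_top_level V E.image_module"
    unfolding irreducible_top_level_def
  proof (intro conjI allI impI)
    show "mgrade E.image_module 0 \<noteq> {0}" using tg t(2) E.pi_eq_0[of t] by auto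
    fix S assume S: "module.subspace (mscale E.image_module) S \<and> S \<subseteq> mgrade E.image_module 0 \<and>
      (\<forall>u. \<forall>w\<in>S. zero_mode V E.image_module u w \<in> S)"
    define T where "T = {x \<in> gen_part t j j. \<pi> x \<in> S}"
    have gp: "gen_part t j j = gen t \<inter> mgrade Z j" using gen_Int_grade[OF tj] by simp
    have ST: "S = \<pi> ` T" using S by (auto simp: T_def gp)
    have "T = {0} \<or> T = gen_part t j j"
    proof (rule irred)
      have "subspace {x. \<pi> x \<in> S}" using S by (intro E.pi.subspace_linear_preimage) simp
      from subspace_inter[OF subspace_gen_part[of t j j] this] show "subspace T" by (simp add: T_def Int_def)
      show "T \<subseteq> gen_part t j j" by (auto simp: T_def)
      fix u w assume w: "w \<in> T"
      then have "zm u w \<in> gen_part w j j" using zm_in_gen_part gp by (auto simp: T_def)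
      moreover have "gen w \<subseteq> gen t" using w gp gen_minimal[OF submodule_gen[OF tS]] by (auto simp: T_def)
      ultimately have "zm u w \<in> gen_part t j j"
        using w gp gen_Int_grade[of w j j] by (auto simp: T_def)
      moreover have "zero_mode V E.image_module u (\<pi> w) \<in> S" using S w by (auto simp: T_def)
      ultimately show "zm u w \<in> T" using E.image_zero_mode[of w u] w by (auto simp: T_def gp)
    qed
    then show "S = {0} \<or> S = mgrade E.image_module 0" using ST by (auto simp: gp)
  qed
  moreover have "S = mspace E.image_module"
    if S: "submodule E.image_module S" "mgrade E.image_module 0 \<subseteq> S" for S
  proof -
    define T where "T = {x \<in> gen t. \<pi> x \<in> S}"
    have "subspace {x. \<pi> x \<in> S}" using S(1) by (intro E.pi.subspace_linear_preimage) (simp add: submodule_def)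
    from subspace_inter[OF subspace_gen[of t] this] have "subspace T" by (simp add: T_def Int_def)
    moreover have "mode u n x \<in> T" if "x \<in> T" for u n x
    proof -
      have "mmode E.image_module u n (\<pi> x) \<in> S"
        using that S(1) by (simp add: submodule_def T_def del: E.image_mode E.image_module_simps)
      then show ?thesis using that mode_gen[OF tS] by (auto simp: T_def)
    qed
    ultimately have "submodule Z T" using gen_subset[OF tS] by (auto simp: submodule_def T_def)
    moreover have "t \<in> T" using tg S(2) by (auto simp: T_def)
    ultimately have "gen t \<subseteq> T" by (rule gen_minimal)
    then show ?thesis using S(1) by (auto simp: T_def submodule_def)
  qed
  ultimately have "generated_by_irreducible_top V E.image_module"
    unfolding generated_by_irreducible_top_def using E.image_admissible by blast
  then show ?thesis using E.irr_if_image_irreducible H by blast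
qed

end

section \<open>Top vectors generate semisimple submodules\<close>

context voa_admissible
begin

text \<open>The finite set \<open>B\<close> is a guard: \<open>dim\<close> is a natural number and
  takes the value 0 on spaces of infinite dimension.\<close>

lemma finite_dim_psubset:
  assumes "finite B" "T \<subseteq> span B" "subspace S" "S \<subset> T" "subspace T"
  shows "dim S < dim T"
proof -
  obtain C where C: "C \<subseteq> S" "independent C" "S \<subseteq> span C" "card C = dim S" by (rule basis_exists)
  obtain x where x: "x \<in> T" "x \<notin> S" using assms by blast
  have "span C \<subseteq> S" using C assms(3) by (intro span_minimal) auto
  then have "x \<notin> span C" using x by blast
  then have ind: "independent (insert x C)" using C by (intro independent_insertI)
  have "insert x C \<subseteq> T" using C x assms by blast
  obtain D where D: "D \<subseteq> T" "insert x C \<subseteq> D" "independent D" "T \<subseteq> span D"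
    using maximal_independent_subset_extend[OF \<open>insert x C \<subseteq> T\<close> ind] by metis
  have "finite D" using independent_span_bound[OF assms(1) D(3)] D(1) assms(2) by blast
  have "dim T = card D" using D basis_card_eq_dim by metis
  moreover have "x \<notin> C" using \<open>x \<notin> span C\<close> span_base by blast
  then have "card (insert x C) = Suc (dim S)" using C \<open>finite D\<close> D(2) finite_subset by fastforce
  moreover have "card (insert x C) \<le> card D" using \<open>finite D\<close> D(2) by (rule card_mono)
  ultimately show ?thesis by simp
qed

definition bottom_socle :: "nat \<Rightarrow> 'm set" where
  "bottom_socle j = span (\<Union>{S. irr S \<and> S \<inter> mgrade Z j \<noteq> {0}})"

lemma bottom_socle_subset: "bottom_socle j \<subseteq> socle"
  unfolding bottom_socle_def socle_def by (rule span_mono) blast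

text \<open>Induction on the dimension of the part of \<open>gen t\<close> of degree
  \<open>j\<close>. If it is irreducible under zero modes, \<open>gen t\<close> is itself one of the
  summands. Otherwise \<open>t\<close> splits along a proper invariant \<open>S\<close>: one summand
  generates a part inside \<open>S\<close>, the other a part meeting \<open>S\<close> in 0, and both
  parts are strictly smaller.\<close>

lemma top_vector_in_bottom_socle:
  assumes H: "\<And>Y :: ('v, complex poly) vmod. generated_by_irreducible_top V Y \<Longrightarrow> irreducible_module V Y"
    and ss: "semisimple_ring (zhu_algebra V)" and C2: "C2_cofinite V"
    and t: "top_vector j t"
  shows "t \<in> bottom_socle j"
  using t
proof (induction "dim (gen_part t j j)" arbitrary: t rule: less_induct)
  case less
  note t = \<open>top_vector j t\<close>
  note tj = top_vector_in_grade[OF t]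
  let ?T = "gen_part t j j"
  have sub: "subspace (bottom_socle j)" by (simp add: bottom_socle_def)
  obtain B where B: "finite B" "?T = span B" using gen_part_finite[OF C2 tj] by blast
  have tT: "t \<in> ?T" using self_in_gen[OF grade_in_space[OF tj]] tj gen_Int_grade[OF tj] by blast
  have part: "gen_part y j j \<subseteq> ?T" if "y \<in> ?T" for y
  proof -
    have y: "y \<in> gen t" "y \<in> mgrade Z j" using that gen_Int_grade[OF tj] by auto
    then have "gen y \<subseteq> gen t" by (intro gen_minimal submodule_gen grade_in_space[OF tj])
    then show ?thesis using gen_Int_grade[OF y(2)] gen_Int_grade[OF tj] by blast
  qed
  show ?case
  proof (cases "t = 0")
    case True
    then show ?thesis using subspace_0[OF sub] by simp
  next
    case t0: False
    show ?thesis
    proof (cases "\<exists>S. subspace S \<and> S \<subseteq> ?T \<and> (\<forall>u. \<forall>w\<in>S. zm u w \<in> S) \<and> S \<noteq> {0} \<and> S \<noteq> ?T")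
      case False
      then have "irr (gen t)" using irr_gen[OF H t t0] by metis
      moreover have "t \<in> gen t \<inter> mgrade Z j" using tT gen_Int_grade[OF tj] by blast
      ultimately have "t \<in> \<Union>{S. irr S \<and> S \<inter> mgrade Z j \<noteq> {0}}" using t0 by blast
      then show ?thesis unfolding bottom_socle_def by (rule span_base)
    next
      case True
      then obtain S where S: "subspace S" "S \<subseteq> ?T" "\<And>u w. w \<in> S \<Longrightarrow> zm u w \<in> S" "S \<noteq> {0}" "S \<noteq> ?T" by blast
      obtain x y where xy: "y \<in> S" "t = x + y" "x \<in> ?T" "y \<in> ?T" "gen_part x j j \<inter> S = {0}"
        using top_vector_decomposition[OF ss t S(1,3)] by metis
      have topx: "top_vector j x" and topy: "top_vector j y" using top_vector_gen_part_top[OF t] xy by blast+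
      have "gen_part x j j \<noteq> ?T"
        using xy(5) S by (metis inf.absorb_iff2)
      then have "dim (gen_part x j j) < dim ?T"
        using part[OF xy(3)] B by (intro finite_dim_psubset[of B]) auto
      then have x: "x \<in> bottom_socle j" using less.hyps topx by blast
      have "gen_part y j j \<subseteq> S"
        using S(3) xy(1) gen_part_eq_zm[OF top_vector_in_grade[OF topy]] by auto
      then have "gen_part y j j \<subset> ?T" using S by blast
      then have "dim (gen_part y j j) < dim ?T"
        using B by (intro finite_dim_psubset[of B]) auto
      then have "y \<in> bottom_socle j" using less.hyps topy by blast
      then show ?thesis using x xy(2) subspace_add[OF sub] by simp
    qed
  qed
qed

text \<open>All vectors of the lowest degree are top vectors, so \<open>g\<close> lies in a finite
  sum of irreducible submodules reaching degree \<open>j\<close>. As \<open>gen g\<close> has no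
  part of degree \<open>j\<close>, it is 0 by \<open>sum_of_irr_bottom\<close>. This is applied to
  the dual module.\<close>

lemma bottom_generated_nondegenerate:
  assumes H: "\<And>Y :: ('v, complex poly) vmod. generated_by_irreducible_top V Y \<Longrightarrow> irreducible_module V Y"
    and ss: "semisimple_ring (zhu_algebra V)" and C2: "C2_cofinite V"
    and below: "\<And>i. i < j \<Longrightarrow> mgrade Z i = {0}"
    and g: "g \<in> span {mode v (int q + int j - int n - 1) f | v q f. v \<in> vgrade V q \<and> f \<in> mgrade Z j}"
    and g0: "g \<in> mgrade Z n" "gen_part g n j = {0}"
  shows "g = 0"
proof -
  have top: "top_vector j f" if f: "f \<in> mgrade Z j" for f
    unfolding top_vector_def
  proof (intro conjI allI impI f)
    fix k u m assume u: "u \<in> vgrade V k" and neg: "int k - m - 1 < 0"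
    show "mode u m f = 0"
    proof (rule ccontr)
      assume nz: "mode u m f \<noteq> 0"
      then obtain d where "m = int k + int j - int d - 1" "mode u m f \<in> mgrade Z d"
        using mode_homogeneous[OF u f] by blast
      then show False using neg below[of d] nz by auto
    qed
  qed
  let ?\<S> = "{S. irr S \<and> S \<inter> mgrade Z j \<noteq> {0}}"
  have adm: "adm (bottom_socle j)"
    unfolding bottom_socle_def by (rule adm_span_Union) (auto simp: irr_iff)
  have "g \<in> bottom_socle j"
    using g
  proof (rule subsetD[OF span_minimal, rotated 2])
    show "subspace (bottom_socle j)" by (rule adm_subspace[OF adm])
    show "{mode v (int q + int j - int n - 1) f | v q f. v \<in> vgrade V q \<and> f \<in> mgrade Z j} \<subseteq> bottom_socle j"
      using top_vector_in_bottom_socle[OF H ss C2 top] adm_mode[OF adm] by blast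
  qed
  then obtain \<T> where T: "finite \<T>" "\<T> \<subseteq> ?\<S>" "g \<in> span (\<Union>\<T>)"
    unfolding bottom_socle_def using finite_support_span_Union[of g ?\<S>] by blast
  have admT: "adm (span (\<Union>\<T>))" by (rule adm_span_Union) (use T in \<open>auto simp: irr_iff\<close>)
  then have "gen g \<subseteq> span (\<Union>\<T>)" using T(3) by (intro gen_minimal) (simp_all add: admissible_submodule_def)
  have "gen g = {0}"
  proof (rule sum_of_irr_bottom[OF T(1) _ admissible_submodule_gen[OF g0(1)]])
    show "irr S \<and> S \<inter> mgrade Z j \<noteq> {0}" if "S \<in> \<T>" for S using that T(2) by blast
    show "gen g \<subseteq> span (\<Union>\<T>)" by fact
    show "gen g \<inter> mgrade Z j = {0}" using gen_Int_grade[OF g0(1)] g0(2) by simp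
  qed
  then show ?thesis using self_in_gen[OF grade_in_space[OF g0(1)]] by simp
qed

end

section \<open>The inversion anti-automorphism\<close>

text \<open>The entries count how often L(1) has raised the mode index, acted on \<open>u\<close>
  and acted on \<open>v\<close>; their sum \<open>r\<close> is the number of applications.\<close>

definition triples :: "nat \<Rightarrow> (nat \<times> nat \<times> nat) set" where
  "triples r = {(a, j, s). a + j + s = r}"

lemma finite_triples [simp]: "finite (triples r)"
  by (rule finite_subset[of _ "{..r} \<times> {..r} \<times> {..r}"]) (auto simp: triples_def)

lemma sum_triples_shift:
  fixes f :: "nat \<Rightarrow> nat \<Rightarrow> nat \<Rightarrow> 'b::comm_monoid_add"
  shows "(\<Sum>(a, j, s)\<in>triples r. f a j (Suc s)) = (\<Sum>(a, j, s)\<in>triples (Suc r). if s = 0 then 0 else f a j s)"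
    and "(\<Sum>(a, j, s)\<in>triples r. f a (Suc j) s) = (\<Sum>(a, j, s)\<in>triples (Suc r). if j = 0 then 0 else f a j s)"
    and "(\<Sum>(a, j, s)\<in>triples r. f (Suc a) j s) = (\<Sum>(a, j, s)\<in>triples (Suc r). if a = 0 then 0 else f a j s)"
proof -
  have shift: "(\<Sum>t\<in>triples r. g (up t)) = (\<Sum>t\<in>triples (Suc r). if P t then 0 else g t)"
    if "\<And>t. t \<in> triples r \<Longrightarrow> up t \<in> triples (Suc r) \<and> \<not> P (up t) \<and> down (up t) = t"
      and "\<And>t. t \<in> triples (Suc r) \<Longrightarrow> \<not> P t \<Longrightarrow> down t \<in> triples r \<and> up (down t) = t"
    for g :: "nat \<times> nat \<times> nat \<Rightarrow> 'b" and up down P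
  proof -
    have "(\<Sum>t\<in>triples (Suc r). if P t then 0 else g t) = (\<Sum>t\<in>{t \<in> triples (Suc r). \<not> P t}. g t)"
      by (rule sum.mono_neutral_cong_right) (auto split: if_splits)
    also have "\<dots> = (\<Sum>t\<in>triples r. g (up t))"
      by (rule sum.reindex_bij_witness[where i = up and j = down]) (use that in auto)
    finally show ?thesis ..
  qed
  note [simp] = case_prod_unfold triples_def
  show "(\<Sum>(a, j, s)\<in>triples r. f a j (Suc s)) = (\<Sum>(a, j, s)\<in>triples (Suc r). if s = 0 then 0 else f a j s)"
    using shift[of "\<lambda>(a, j, s). (a, j, Suc s)" "\<lambda>(a, j, s). s = 0" "\<lambda>(a, j, s). (a, j, s - 1)" "\<lambda>t. f (fst t) (fst (snd t)) (snd (snd t))"]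
    by simp
  show "(\<Sum>(a, j, s)\<in>triples r. f a (Suc j) s) = (\<Sum>(a, j, s)\<in>triples (Suc r). if j = 0 then 0 else f a j s)"
    using shift[of "\<lambda>(a, j, s). (a, Suc j, s)" "\<lambda>(a, j, s). j = 0" "\<lambda>(a, j, s). (a, j - 1, s)" "\<lambda>t. f (fst t) (fst (snd t)) (snd (snd t))"]
    by simp
  show "(\<Sum>(a, j, s)\<in>triples r. f (Suc a) j s) = (\<Sum>(a, j, s)\<in>triples (Suc r). if a = 0 then 0 else f a j s)"
    using shift[of "\<lambda>(a, j, s). (Suc a, j, s)" "\<lambda>(a, j, s). a = 0" "\<lambda>(a, j, s). (a - 1, j, s)" "\<lambda>t. f (fst t) (fst (snd t)) (snd (snd t))"]
    by simp
qed

text \<open>The coefficient of y^a in (1 - y)^(x + a + j). It comes from conjugating Y(u,t) by the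
  exponential of zL(1), which replaces t by t / (1 - zt): here y = zt and x = n + 1 - 2p, and the
  exponent collects the contributions of the mode index, of the weight and of L(1)^j.\<close>

definition inv_coeff :: "int \<Rightarrow> nat \<Rightarrow> nat \<Rightarrow> complex" where
  "inv_coeff x a j = (-1) ^ a * (of_int (x + int a + int j) gchoose a)"

text \<open>Pascal's rule and absorption. The two terms belong to the last L(1) acting on
  \<open>u\<close> and to its raising the mode index; the factor a + j is the total number of
  applications less those to \<open>v\<close>.\<close>

lemma inv_coeff_recursion:
  "of_nat (a + j) * inv_coeff x a j =
    (if j = 0 then 0 else of_nat j * inv_coeff x a (j - 1)) +
    (if a = 0 then 0 else - of_int (x + 2 * int j + int a) * inv_coeff x (a - 1) j)"
proof (cases a)
  case 0
  then show ?thesis by (cases j) (simp_all add: inv_coeff_def)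
next
  case (Suc b)
  define y :: complex where "y = of_int x + of_nat b + of_nat j"
  have e: "of_int (x + int a + int j) = y + 1" "of_int (x + int b + int j) = y" by (simp_all add: y_def Suc)
  have pas: "(y + 1) gchoose (Suc b) = (y gchoose b) + (y gchoose Suc b)" by (rule gbinomial_Suc_Suc)
  have abs: "of_nat (Suc b) * (y gchoose Suc b) = (y - of_nat b) * (y gchoose b)"
    using gbinomial_mult_1[of y b] by (simp add: algebra_simps)
  have key: "of_nat (Suc b + j) * ((y + 1) gchoose Suc b) = of_nat j * (y gchoose Suc b) + (y + 1 + of_nat j) * (y gchoose b)"
    unfolding pas using abs by (simp add: algebra_simps)
  have j1: "(if j = 0 then 0 else of_nat j * inv_coeff x a (j - 1)) = of_nat j * ((-1) ^ a * (y gchoose a))"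
    by (auto simp: inv_coeff_def y_def Suc of_nat_diff algebra_simps)
  have x: "of_int (x + 2 * int j + int a) = y + 1 + of_nat j" by (simp add: y_def Suc)
  have a0: "(if a = 0 then 0 else - of_int (x + 2 * int j + int a) * inv_coeff x (a - 1) j) =
      (-1) ^ a * ((y + 1 + of_nat j) * (y gchoose b))"
    unfolding x by (simp add: Suc inv_coeff_def y_def algebra_simps)
  have l: "inv_coeff x a j = (-1) ^ a * ((y + 1) gchoose Suc b)"
    by (simp only: inv_coeff_def e) (simp only: Suc)
  have "of_nat (a + j) * inv_coeff x a j = (-1) ^ a * (of_nat (Suc b + j) * ((y + 1) gchoose Suc b))"
    unfolding l unfolding Suc by (simp only: mult.left_commute)
  also have "\<dots> = of_nat j * ((-1) ^ a * (y gchoose a)) + (-1) ^ a * ((y + 1 + of_nat j) * (y gchoose b))"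
    unfolding key distrib_left unfolding Suc by (simp only: mult.left_commute)
  finally show ?thesis unfolding j1 a0 .
qed

section \<open>Divided powers of L(1) on products\<close>

context vertex_operator_algebra
begin

abbreviation L1 :: "'v \<Rightarrow> 'v" where
  "L1 \<equiv> vmode V (conformal V) 2"

text \<open>The divided powers L(1)^k / k!, the terms of the exponential of L(1).\<close>

primrec Ld :: "nat \<Rightarrow> 'v \<Rightarrow> 'v" where
  "Ld 0 v = v"
| "Ld (Suc k) v = vscale V (1 / of_nat (Suc k)) (L1 (Ld k v))"

lemma L1_Ld: "L1 (Ld k v) = vscale V (of_nat (Suc k)) (Ld (Suc k) v)"
  by (simp del: of_nat_Suc)

lemma Ld_add: "Ld k (u + v) = Ld k u + Ld k v"
  by (induction k) (simp_all add: vmode_add scale_right_distrib)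

lemma Ld_scale: "Ld k (vscale V c v) = vscale V c (Ld k v)"
  by (induction k) (simp_all add: vmode_scale mult.commute)

lemma Ld_zero [simp]: "Ld k 0 = 0"
  by (induction k) simp_all

lemma Ld_grade: "v \<in> vgrade V p \<Longrightarrow> Ld k v \<in> vgrade V (p - k)"
proof (induction k)
  case (Suc k)
  have "L1 (Ld k v) \<in> vgrade V (nat (int 2 + int (p - k) - 2 - 1))"
    by (rule vmode_grade'[OF conformal_grade Suc.IH[OF Suc.prems]])
  moreover have "nat (int 2 + int (p - k) - 2 - 1) = p - Suc k" by simp
  ultimately show ?case by (simp add: subspace_scale[OF subspace_grade])
qed simp

lemma Ld_eq_0: "v \<in> vgrade V p \<Longrightarrow> p < k \<Longrightarrow> Ld k v = 0"
proof (induction k)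
  case (Suc k)
  show ?case
  proof (cases "p < k")
    case False
    then have "Ld k v \<in> vgrade V 0" using Ld_grade[OF Suc.prems(1), of k] Suc.prems by simp
    then have "L1 (Ld k v) = 0" using vmode_grade[OF conformal_grade, of "Ld k v" 0 2] by simp
    then show ?thesis by simp
  qed (use Suc in simp)
qed simp

text \<open>The commutator formula with index 2 has three terms, from L(-1), L(0) and L(1) acting on
  \<open>v\<close>; the first two contribute -(n + 2) and 2p to the mode of index n + 1.\<close>

lemma L1_commutator:
  assumes v: "v \<in> vgrade V p"
  shows "L1 (vmode V v n w) = vmode V v n (L1 w) + vmode V (L1 v) n w
    + vscale V (of_int (2 * int p - n - 2)) (vmode V v (n + 1) w)"
proof -
  interpret A: voa_weak_module V adjoint_module by (rule adjoint_voa_weak_module)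
  obtain K0 where K0: "\<And>K. K \<ge> K0 \<Longrightarrow>
      vmode V (conformal V) 2 (vmode V v n w) - vmode V v n (vmode V (conformal V) 2 w) =
      (\<Sum>i<K. vscale V (of_int 2 gchoose i) (vmode V (vmode V (conformal V) (int i) v) (2 + n - int i) w))"
    using A.commutator[of w "conformal V" 2 v n] by auto
  define f where "f i = vscale V (of_int 2 gchoose i) (vmode V (vmode V (conformal V) (int i) v) (2 + n - int i) w)" for i
  have f: "f i = 0" if "i \<ge> 3" for i
    using of_nat_gchoose_eq_0[of 2 i] that by (simp add: f_def)
  have g2: "(2 gchoose Suc (Suc 0) :: complex) = 1"
    using binomial_gbinomial[of 2 2, where 'a = complex] by (simp add: numeral_2_eq_2)
  have "L1 (vmode V v n w) - vmode V v n (L1 w) = sum f {..<3 + K0}"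
    using K0[of "3 + K0"] by (simp add: f_def)
  also have "\<dots> = sum f {..<3}" by (rule sum.mono_neutral_right) (auto intro: f)
  also have "\<dots> = f 0 + f 1 + f 2" by (simp add: eval_nat_numeral)
  also have "f 0 = vscale V (- of_int (n + 2)) (vmode V v (n + 1) w)"
    by (simp add: f_def L_minus1_derivative algebra_simps)
  also have "f 1 = vscale V (2 * of_nat p) (vmode V v (n + 1) w)"
    by (simp add: f_def L0_grade[OF v] vmode_scale_left algebra_simps)
  also have "f 2 = vmode V (L1 v) n w" by (simp add: f_def g2 numeral_2_eq_2)
  finally have "L1 (vmode V v n w) - vmode V v n (L1 w) =
      vscale V (- of_int (n + 2) + 2 * of_nat p) (vmode V v (n + 1) w) + vmode V (L1 v) n w"
    by (simp only: scale_left_distrib add.assoc)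
  moreover have "- of_int (n + 2) + 2 * of_nat p = (of_int (2 * int p - n - 2) :: complex)" by simp
  ultimately have "L1 (vmode V v n w) - vmode V v n (L1 w) =
      vscale V (of_int (2 * int p - n - 2)) (vmode V v (n + 1) w) + vmode V (L1 v) n w"
    by (simp only:)
  then show ?thesis unfolding diff_eq_eq by (simp only: ac_simps)
qed

text \<open>One more L(1) acts on \<open>v\<close>, acts on \<open>u\<close> or raises the mode
  index, so each triple passes to three triples of the next size, and
  \<open>inv_coeff_recursion\<close> adds up what arrives at each of them.\<close>

lemma Ld_vmode:
  assumes u: "u \<in> vgrade V p"
  shows "Ld r (vmode V u n v) = (\<Sum>(a, j, s)\<in>triples r.
    vscale V (inv_coeff (n + 1 - 2 * int p) a j) (vmode V (Ld j u) (n + int a) (Ld s v)))"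
proof (induction r)
  case 0
  have "triples 0 = {(0, 0, 0)}" by (auto simp: triples_def)
  then show ?case by (simp add: inv_coeff_def)
next
  case (Suc r)
  interpret A: voa_weak_module V adjoint_module by (rule adjoint_voa_weak_module)
  define c where "c = inv_coeff (n + 1 - 2 * int p)"
  define G where "G a j s = vmode V (Ld j u) (n + int a) (Ld s v)" for a j s
  have L1G: "L1 (G a j s) = vscale V (of_nat (Suc s)) (G a j (Suc s)) + vscale V (of_nat (Suc j)) (G a (Suc j) s)
      + vscale V (- of_int ((n + 1 - 2 * int p) + 2 * int j + int (Suc a))) (G (Suc a) j s)" for a j s
  proof (cases "j \<le> p")
    case True
    have "of_int (2 * int (p - j) - (n + int a) - 2) = - (of_int ((n + 1 - 2 * int p) + 2 * int j + int (Suc a)) :: complex)"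
      using True by (simp add: of_nat_diff)
    then show ?thesis
      unfolding G_def using L1_commutator[OF Ld_grade[OF u, of j], of "n + int a" "Ld s v"]
      by (simp only: L1_Ld vmode_scale vmode_scale_left) (simp add: algebra_simps)
  next
    \<comment> \<open>For j > p the truncated difference p - j is not the weight the formula wants,
      but all vectors involved are 0.\<close>
    case False
    then have "Ld j u = 0" "Ld (Suc j) u = 0" using Ld_eq_0[OF u] by auto
    then show ?thesis by (simp add: G_def)
  qed
  have "vscale V (of_nat (Suc r)) (Ld (Suc r) (vmode V u n v)) = L1 (Ld r (vmode V u n v))"
    by (rule L1_Ld[symmetric])
  also have "\<dots> = (\<Sum>(a, j, s)\<in>triples r. vscale V (c a j) (L1 (G a j s)))"
    unfolding Suc.IH using A.mode_sum[of "triples r" "\<lambda>(a, j, s). vscale V (c a j) (G a j s)" "conformal V" 2]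
    by (simp add: c_def G_def case_prod_unfold vmode_scale)
  \<comment> \<open>Writing \<open>Suc j - 1\<close> and \<open>Suc a - 1\<close> presents the
    summands as functions of the raised index, as \<open>sum_triples_shift\<close> requires.\<close>
  also have "\<dots> = (\<Sum>(a, j, s)\<in>triples r. vscale V (of_nat (Suc s) * c a j) (G a j (Suc s)))
      + (\<Sum>(a, j, s)\<in>triples r. vscale V (of_nat (Suc j) * c a (Suc j - 1)) (G a (Suc j) s))
      + (\<Sum>(a, j, s)\<in>triples r. vscale V (- of_int ((n + 1 - 2 * int p) + 2 * int j + int (Suc a)) * c (Suc a - 1) j) (G (Suc a) j s))"
    unfolding L1G by (simp add: sum.distrib[symmetric] scale_right_distrib case_prod_unfold mult.commute)
  also have "\<dots> = (\<Sum>(a, j, s)\<in>triples (Suc r). if s = 0 then 0 else vscale V (of_nat s * c a j) (G a j s))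
      + (\<Sum>(a, j, s)\<in>triples (Suc r). if j = 0 then 0 else vscale V (of_nat j * c a (j - 1)) (G a j s))
      + (\<Sum>(a, j, s)\<in>triples (Suc r). if a = 0 then 0 else vscale V (- of_int ((n + 1 - 2 * int p) + 2 * int j + int a) * c (a - 1) j) (G a j s))"
    by (simp only: sum_triples_shift(1)[of "\<lambda>a j s. vscale V (of_nat s * c a j) (G a j s)"]
        sum_triples_shift(2)[of "\<lambda>a j s. vscale V (of_nat j * c a (j - 1)) (G a j s)"]
        sum_triples_shift(3)[of "\<lambda>a j s. vscale V (- of_int ((n + 1 - 2 * int p) + 2 * int j + int a) * c (a - 1) j) (G a j s)"])
  also have "\<dots> = (\<Sum>(a, j, s)\<in>triples (Suc r). vscale V (of_nat (Suc r) * c a j) (G a j s))"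
    unfolding sum.distrib[symmetric]
  proof (rule sum.cong[OF refl], clarify)
    fix a j s assume "(a, j, s) \<in> triples (Suc r)"
    then have r: "Suc r = s + (a + j)" by (simp add: triples_def)
    have "of_nat (Suc r) * c a j = of_nat s * c a j + of_nat (a + j) * c a j"
      unfolding r by (simp only: of_nat_add distrib_right)
    also have "\<dots> = (if s = 0 then 0 else of_nat s * c a j) + (if j = 0 then 0 else of_nat j * c a (j - 1))
      + (if a = 0 then 0 else - of_int ((n + 1 - 2 * int p) + 2 * int j + int a) * c (a - 1) j)"
      unfolding c_def inv_coeff_recursion by simp
    finally show "(if s = 0 then 0 else vscale V (of_nat s * c a j) (G a j s))
      + (if j = 0 then 0 else vscale V (of_nat j * c a (j - 1)) (G a j s))
      + (if a = 0 then 0 else vscale V (- of_int ((n + 1 - 2 * int p) + 2 * int j + int a) * c (a - 1) j) (G a j s))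
      = vscale V (of_nat (Suc r) * c a j) (G a j s)"
      by (simp only: scale_left_distrib) (simp split del: if_split add: if_distrib[of "\<lambda>x. vscale V x _"] cong: if_cong)
  qed
  also have "\<dots> = vscale V (of_nat (Suc r)) (\<Sum>(a, j, s)\<in>triples (Suc r). vscale V (c a j) (G a j s))"
    by (simp add: scale_sum_right case_prod_unfold del: of_nat_Suc)
  finally show ?case by (simp add: c_def G_def del: of_nat_Suc Ld.simps)
qed

end

section \<open>Transposed modes\<close>

context voa_admissible
begin

text \<open>
  \<open>inv_mode u n\<close> is the transpose of the mode $u_n$ of the contragredient module: it is the coefficient
  of $z^{-n-1}$ in $Y(e^{zL(1)}(-z^{-2})^{L(0)}u,z^{-1})$.
\<close>

definition inv_mode_hom :: "nat \<Rightarrow> 'v \<Rightarrow> int \<Rightarrow> 'm \<Rightarrow> 'm" where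
  "inv_mode_hom p u n x = mscale Z ((-1) ^ p) (\<Sum>j\<le>p. mode (V.Ld j u) (2 * int p - int j - 2 - n) x)"

definition inv_mode :: "'v \<Rightarrow> int \<Rightarrow> 'm \<Rightarrow> 'm" where
  "inv_mode u n x = Sum_any (\<lambda>p. inv_mode_hom p (gcomp (vgrade V) u p) n x)"

lemma inv_mode_hom_zero [simp]: "x \<in> mspace Z \<Longrightarrow> inv_mode_hom p 0 n x = 0"
  by (simp add: inv_mode_hom_def)

lemma inv_mode_hom_add: "x \<in> mspace Z \<Longrightarrow> inv_mode_hom p (u + u') n x = inv_mode_hom p u n x + inv_mode_hom p u' n x"
  by (simp add: inv_mode_hom_def V.Ld_add mode_add_left sum.distrib scale_right_distrib)

lemma inv_mode_hom_scale: "x \<in> mspace Z \<Longrightarrow> inv_mode_hom p (vscale V c u) n x = mscale Z c (inv_mode_hom p u n x)"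
  by (simp add: inv_mode_hom_def V.Ld_scale mode_scale_left scale_sum_right mult.commute)

lemma inv_mode_eq: "u \<in> vgrade V p \<Longrightarrow> x \<in> mspace Z \<Longrightarrow> inv_mode u n x = inv_mode_hom p u n x"
  unfolding inv_mode_def
  by (rule V.Sum_any_gcomp_hom[where F = "\<lambda>p u. inv_mode_hom p u n x"]) simp_all

lemma inv_mode_add_left: "x \<in> mspace Z \<Longrightarrow> inv_mode (u + u') n x = inv_mode u n x + inv_mode u' n x"
  unfolding inv_mode_def
  by (rule V.Sum_any_gcomp_add[where F = "\<lambda>p u. inv_mode_hom p u n x"]) (simp_all add: inv_mode_hom_add)

lemma inv_mode_scale_left: "x \<in> mspace Z \<Longrightarrow> inv_mode (vscale V c u) n x = mscale Z c (inv_mode u n x)"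
  unfolding inv_mode_def
  by (rule V.Sum_any_gcomp_scale[where F = "\<lambda>p u. inv_mode_hom p u n x", OF vector_space_axioms])
    (simp_all add: inv_mode_hom_scale)

lemma inv_mode_zero_left [simp]: "x \<in> mspace Z \<Longrightarrow> inv_mode 0 n x = 0"
  using inv_mode_scale_left[of x 0 0 n] by simp

lemma inv_mode_closed: "x \<in> mspace Z \<Longrightarrow> inv_mode u n x \<in> mspace Z"
proof (induction u rule: V.homogeneous_induct)
  case (hom p u)
  have "inv_mode_hom p u n x \<in> mspace Z"
    unfolding inv_mode_hom_def
    by (intro subspace_scale[OF space_subspace] subspace_sum[OF space_subspace] mode_closed hom)
  then show ?case by (simp add: inv_mode_eq[OF hom])
qed (simp_all add: inv_mode_add_left inv_mode_scale_left subspace_add[OF space_subspace] subspace_scale[OF space_subspace])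

lemma inv_mode_add: "x \<in> mspace Z \<Longrightarrow> y \<in> mspace Z \<Longrightarrow> inv_mode u n (x + y) = inv_mode u n x + inv_mode u n y"
proof (induction u rule: V.homogeneous_induct)
  case (hom p u)
  then show ?case
    by (simp add: inv_mode_eq subspace_add[OF space_subspace] inv_mode_hom_def mode_add sum.distrib scale_right_distrib)
qed (simp_all add: inv_mode_add_left inv_mode_scale_left subspace_add[OF space_subspace] scale_right_distrib)

lemma inv_mode_scale: "x \<in> mspace Z \<Longrightarrow> inv_mode u n (mscale Z c x) = mscale Z c (inv_mode u n x)"
proof (induction u rule: V.homogeneous_induct)
  case (hom p u)
  then show ?case
    by (simp add: inv_mode_eq subspace_scale[OF space_subspace] inv_mode_hom_def mode_scale scale_sum_right mult.commute)
qed (simp_all add: inv_mode_add_left inv_mode_scale_left subspace_scale[OF space_subspace] scale_right_distrib mult.commute)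

text \<open>All summands of \<open>inv_mode_hom\<close> change the degree alike, since
  \<open>Ld j u\<close> has weight p - j and the index drops by j as well. The shift is opposite to
  that of u_n.\<close>

lemma inv_mode_degree:
  assumes u: "u \<in> vgrade V p" and x: "x \<in> mgrade Z e"
  shows "int e - int p + n + 1 \<ge> 0 \<Longrightarrow> inv_mode u n x \<in> mgrade Z (nat (int e - int p + n + 1))"
    and "int e - int p + n + 1 < 0 \<Longrightarrow> inv_mode u n x = 0"
proof -
  have d: "int e + int (p - j) - (2 * int p - int j - 2 - n) - 1 = int e - int p + n + 1" if "j \<le> p" for j
    using that by (simp add: of_nat_diff)
  have eq: "inv_mode u n x = inv_mode_hom p u n x" by (rule inv_mode_eq[OF u grade_in_space[OF x]])
  show "inv_mode u n x \<in> mgrade Z (nat (int e - int p + n + 1))" if "int e - int p + n + 1 \<ge> 0"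
    unfolding eq inv_mode_hom_def
  proof (intro subspace_scale[OF subspace_grade] subspace_sum[OF subspace_grade])
    fix j assume "j \<in> {..p}"
    then show "mode (V.Ld j u) (2 * int p - int j - 2 - n) x \<in> mgrade Z (nat (int e - int p + n + 1))"
      using mode_grade[OF V.Ld_grade[OF u, of j] x, of "2 * int p - int j - 2 - n"] d[of j] that
      by (simp only: atMost_iff)
  qed
  show "inv_mode u n x = 0" if "int e - int p + n + 1 < 0"
  proof -
    have "mode (V.Ld j u) (2 * int p - int j - 2 - n) x = 0" if "j \<in> {..p}" for j
      using mode_grade_neg[OF V.Ld_grade[OF u, of j] x, of "2 * int p - int j - 2 - n"] d[of j] that
        \<open>int e - int p + n + 1 < 0\<close> by (simp only: atMost_iff)
    then show ?thesis by (simp add: eq inv_mode_hom_def)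
  qed
qed

text \<open>Bounds on the three indices turn the sum by total size, as it comes from
  \<open>Ld_vmode\<close>, into independent sums that can be interchanged.\<close>

lemma sum_triples_box:
  fixes h :: "nat \<Rightarrow> nat \<Rightarrow> nat \<Rightarrow> 'b::comm_monoid_add"
  assumes h: "\<And>a j s. a \<ge> A \<or> j > p \<or> s > q \<Longrightarrow> h a j s = 0" and R: "R > A + p + q"
  shows "(\<Sum>r<R. \<Sum>(a, j, s)\<in>triples r. h a j s) = (\<Sum>a<A. \<Sum>j\<le>p. \<Sum>s\<le>q. h a j s)"
proof -
  have "(\<Sum>r<R. \<Sum>(a, j, s)\<in>triples r. h a j s) = (\<Sum>(a, j, s)\<in>(\<Union>r<R. triples r). h a j s)"
  proof (rule sum.UNION_disjoint[symmetric])
    show "\<forall>i\<in>{..<R}. \<forall>k\<in>{..<R}. i \<noteq> k \<longrightarrow> triples i \<inter> triples k = {}" by (auto simp: triples_def)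
  qed simp_all
  also have "\<dots> = (\<Sum>(a, j, s)\<in>{..<A} \<times> {..p} \<times> {..q}. h a j s)"
  proof (rule sum.mono_neutral_right)
    show "finite (\<Union>r<R. triples r)" by simp
    show "{..<A} \<times> {..p} \<times> {..q} \<subseteq> (\<Union>r<R. triples r)" using R by (auto simp: triples_def)
    show "\<forall>i\<in>(\<Union>r<R. triples r) - {..<A} \<times> {..p} \<times> {..q}. (case i of (a, j, s) \<Rightarrow> h a j s) = 0"
    proof
      fix t assume t: "t \<in> (\<Union>r<R. triples r) - {..<A} \<times> {..p} \<times> {..q}"
      obtain a j s where ajs: "t = (a, j, s)" by (cases t)
      then have "a \<ge> A \<or> j > p \<or> s > q" using t by auto
      then show "(case t of (a, j, s) \<Rightarrow> h a j s) = 0" using h ajs by simp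
    qed
  qed
  also have "\<dots> = (\<Sum>a<A. \<Sum>j\<le>p. \<Sum>s\<le>q. h a j s)"
    by (simp add: sum.cartesian_product case_prod_unfold)
  finally show ?thesis .
qed

text \<open>\<open>Ld_vmode\<close> inserted into the definition. The sign is a \<open>powi\<close>
  because the weight p + q - k - 1 of u_k v may be negative; u_k v is then 0.\<close>

lemma inv_mode_vmode:
  assumes u: "u \<in> vgrade V p" and v: "v \<in> vgrade V q" and x: "x \<in> mspace Z"
    and A: "\<And>a j s. a \<ge> A \<Longrightarrow> vmode V (V.Ld j u) (k + int a) (V.Ld s v) = 0"
  shows "inv_mode (vmode V u k v) n x = mscale Z ((-1) powi (int p + int q - k - 1))
    (\<Sum>a<A. \<Sum>j\<le>p. \<Sum>s\<le>q. mscale Z (inv_coeff (k + 1 - 2 * int p) a j)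
       (mode (vmode V (V.Ld j u) (k + int a) (V.Ld s v)) (2 * (int p + int q - k - 1) - 2 - n - int a - int j - int s) x))"
proof -
  define r where "r = int p + int q - k - 1"
  define y where "y = vmode V u k v"
  define h where "h a j s = mscale Z (inv_coeff (k + 1 - 2 * int p) a j)
       (mode (vmode V (V.Ld j u) (k + int a) (V.Ld s v)) (2 * r - 2 - n - int a - int j - int s) x)" for a j s
  \<comment> \<open>Large enough both for the box of indices and for all powers of L(1) on u_k v,
    whose weight is \<open>r\<close>.\<close>
  define R where "R = Suc (A + p + q + nat r)"
  have h0: "h a j s = 0" if "a \<ge> A \<or> j > p \<or> s > q" for a j s
    using that A V.Ld_eq_0[OF u] V.Ld_eq_0[OF v] x by (auto simp: h_def)
  have "inv_mode y n x = mscale Z ((-1) powi r) (\<Sum>i<R. mode (V.Ld i y) (2 * r - int i - 2 - n) x)"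
  proof (cases "r \<ge> 0")
    case True
    then have y: "y \<in> vgrade V (nat r)" using V.vmode_grade[OF u v, of k] by (simp add: y_def r_def)
    have "(\<Sum>i<R. mode (V.Ld i y) (2 * r - int i - 2 - n) x) = (\<Sum>i\<le>nat r. mode (V.Ld i y) (2 * r - int i - 2 - n) x)"
      by (rule sum.mono_neutral_right) (use V.Ld_eq_0[OF y] x in \<open>auto simp: R_def\<close>)
    then show ?thesis
      using inv_mode_eq[OF y x, of n] True by (simp add: inv_mode_hom_def power_int_def)
  next
    case False
    then have "y = 0" using V.vmode_grade[OF u v, of k] by (simp add: y_def r_def)
    then show ?thesis using x by simp
  qed
  also have "(\<Sum>i<R. mode (V.Ld i y) (2 * r - int i - 2 - n) x) = (\<Sum>i<R. \<Sum>(a, j, s)\<in>triples i. h a j s)"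
  proof (rule sum.cong[OF refl])
    fix i
    have "mode (V.Ld i y) (2 * r - int i - 2 - n) x = (\<Sum>t\<in>triples i. mode (case t of (a, j, s) \<Rightarrow>
        vscale V (inv_coeff (k + 1 - 2 * int p) a j) (vmode V (V.Ld j u) (k + int a) (V.Ld s v))) (2 * r - int i - 2 - n) x)"
      unfolding y_def V.Ld_vmode[OF u] by (rule mode_sum_left[OF x])
    also have "\<dots> = (\<Sum>(a, j, s)\<in>triples i. h a j s)"
    proof (rule sum.cong[OF refl], clarify)
      fix a j s assume "(a, j, s) \<in> triples i"
      then have "2 * r - int i - 2 - n = 2 * r - 2 - n - int a - int j - int s" by (auto simp: triples_def)
      then show "mode (vscale V (inv_coeff (k + 1 - 2 * int p) a j) (vmode V (V.Ld j u) (k + int a) (V.Ld s v)))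
          (2 * r - int i - 2 - n) x = h a j s"
        using x by (simp only: h_def mode_scale_left)
    qed
    finally show "mode (V.Ld i y) (2 * r - int i - 2 - n) x = (\<Sum>(a, j, s)\<in>triples i. h a j s)" .
  qed
  also have "\<dots> = (\<Sum>a<A. \<Sum>j\<le>p. \<Sum>s\<le>q. h a j s)"
    by (rule sum_triples_box[OF h0]) (simp_all add: R_def)
  finally show ?thesis unfolding h_def y_def r_def .
qed

text \<open>Once the signs are merged this is Vandermonde's convolution followed by negation of the
  upper argument. It is the origin of the exponent 2p - j - m - l - 2 in the transformed
  identity.\<close>

lemma inv_coeff_convolution:
  "(\<Sum>i\<le>b. (of_int m gchoose i) * ((-1) ^ i * inv_coeff (l + int i + 1 - 2 * p) (b - i) j)) =
    (of_int (2 * p - int j - m - l - 2) gchoose b :: complex)"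
proof -
  define z :: complex where "z = of_int (l + int b + 1 - 2 * p + int j)"
  have "(\<Sum>i\<le>b. (of_int m gchoose i) * ((-1) ^ i * inv_coeff (l + int i + 1 - 2 * p) (b - i) j)) =
      (\<Sum>i\<le>b. (-1) ^ b * ((of_int m gchoose i) * (z gchoose (b - i))))"
  proof (rule sum.cong[OF refl])
    fix i assume "i \<in> {..b}"
    then have i: "i \<le> b" by simp
    have "l + int i + 1 - 2 * p + int (b - i) + int j = l + int b + 1 - 2 * p + int j" using i by simp
    then have "inv_coeff (l + int i + 1 - 2 * p) (b - i) j = (-1) ^ (b - i) * (z gchoose (b - i))"
      unfolding inv_coeff_def z_def by (simp only:)
    moreover have "(-1 :: complex) ^ i * (-1) ^ (b - i) = (-1) ^ b" using i by (simp add: power_add[symmetric])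
    ultimately show "(of_int m gchoose i) * ((-1) ^ i * inv_coeff (l + int i + 1 - 2 * p) (b - i) j) =
        (-1) ^ b * ((of_int m gchoose i) * (z gchoose (b - i)))"
      by (metis (no_types, lifting) mult.assoc mult.left_commute)
  qed
  also have "\<dots> = (-1) ^ b * ((of_int m + z) gchoose b)"
    by (simp add: sum_distrib_left[symmetric] gbinomial_Vandermonde[symmetric] atLeast0AtMost)
  also have "\<dots> = (of_int (2 * p - int j - m - l - 2) gchoose b)"
    unfolding gbinomial_negated_upper[of "of_int (2 * p - int j - m - l - 2)" b]
    by (simp add: z_def algebra_simps)
  finally show ?thesis .
qed

text \<open>
  The substitution $z \mapsto z^{-1}$ turns the left hand side of the Borcherds identity with exponents
  $(l, m, n)$ into left hand sides with exponents $(l, 2p-j-m-l-2, 2q-s-n-l-2)$ for the components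
  of $e^{L(1)}u$ and $e^{L(1)}v$ of weights $p - j$ and $q - s$.
\<close>

lemma inv_mode_borcherds_lhs:
  assumes u: "u \<in> vgrade V p" and v: "v \<in> vgrade V q" and x: "x \<in> mspace Z"
    and B: "\<And>b j s. b \<ge> B \<Longrightarrow> vmode V (V.Ld j u) (l + int b) (V.Ld s v) = 0"
  shows "(\<Sum>i<B. mscale Z (of_int m gchoose i) (inv_mode (vmode V u (l + int i) v) (m + n - int i) x)) =
    mscale Z ((-1) powi (int p + int q - l - 1)) (\<Sum>j\<le>p. \<Sum>s\<le>q. \<Sum>b<B.
      lhs (V.Ld j u) (V.Ld s v) x l (2 * int p - int j - m - l - 2) (2 * int q - int s - n - l - 2) b)"
proof -
  let ?lhs = "\<lambda>j s. lhs (V.Ld j u) (V.Ld s v) x l (2 * int p - int j - m - l - 2) (2 * int q - int s - n - l - 2)"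
  let ?c = "\<lambda>i a j. (of_int m gchoose i) * ((-1) ^ i * inv_coeff (l + int i + 1 - 2 * int p) a j)"
  define \<sigma> :: complex where "\<sigma> = (-1) powi (int p + int q - l - 1)"
  define E where "E j s b = mode (vmode V (V.Ld j u) (l + int b) (V.Ld s v))
      (2 * (int p + int q - l - 1) - 2 - m - n - int b - int j - int s) x" for j s b
  have E0: "E j s b = 0" if "b \<ge> B" for j s b using B[OF that] x by (simp add: E_def)
  define h where "h i a = (\<Sum>j\<le>p. \<Sum>s\<le>q. mscale Z (?c i a j) (E j s (i + a)))" for i a
  have summand: "mscale Z (of_int m gchoose i) (inv_mode (vmode V u (l + int i) v) (m + n - int i) x) =
      mscale Z \<sigma> (\<Sum>a<B. h i a)" for i
  proof -
    have sg: "(-1) powi (int p + int q - (l + int i) - 1) = \<sigma> * (-1) ^ i"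
    proof -
      have "int p + int q - (l + int i) - 1 = (int p + int q - l - 1) - int i" by simp
      moreover have "(-1 :: complex) powi ((int p + int q - l - 1) - int i) = \<sigma> / (-1) powi (int i)"
        unfolding \<sigma>_def by (rule power_int_diff) simp
      ultimately have "(-1 :: complex) powi (int p + int q - (l + int i) - 1) = \<sigma> / (-1) powi (int i)"
        by (simp only:)
      then show ?thesis by (cases "even i") simp_all
    qed
    have "inv_mode (vmode V u (l + int i) v) (m + n - int i) x =
      mscale Z (\<sigma> * (-1) ^ i) (\<Sum>a<B. \<Sum>j\<le>p. \<Sum>s\<le>q. mscale Z (inv_coeff (l + int i + 1 - 2 * int p) a j)
       (mode (vmode V (V.Ld j u) (l + int i + int a) (V.Ld s v))
         (2 * (int p + int q - (l + int i) - 1) - 2 - (m + n - int i) - int a - int j - int s) x))"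
      unfolding sg[symmetric]
      by (rule inv_mode_vmode[OF u v x]) (use B in \<open>simp add: add.assoc flip: of_nat_add\<close>)
    moreover have "mode (vmode V (V.Ld j u) (l + int i + int a) (V.Ld s v))
         (2 * (int p + int q - (l + int i) - 1) - 2 - (m + n - int i) - int a - int j - int s) x = E j s (i + a)" for j s a
      unfolding E_def by (rule arg_cong2[where f = "\<lambda>y k. mode y k x"]) (simp_all add: algebra_simps)
    ultimately show ?thesis
      by (simp add: h_def scale_sum_right mult.assoc mult.left_commute)
  qed
  have "(\<Sum>i<B. mscale Z (of_int m gchoose i) (inv_mode (vmode V u (l + int i) v) (m + n - int i) x)) =
      mscale Z \<sigma> (\<Sum>i<B. \<Sum>a<B. h i a)"
    by (simp add: summand scale_sum_right)
  \<comment> \<open>\<open>E\<close> depends on i and a only through i + a, so the sum is collected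
    along the diagonals i + a = b; on each of them \<open>inv_coeff_convolution\<close>
    applies.\<close>
  also have "(\<Sum>i<B. \<Sum>a<B. h i a) = (\<Sum>(i, a)\<in>{(i, a). i + a < B}. h i a)"
  proof -
    have "(\<Sum>i<B. \<Sum>a<B. h i a) = (\<Sum>(i, a)\<in>{..<B} \<times> {..<B}. h i a)" by (rule sum.cartesian_product)
    also have "\<dots> = (\<Sum>(i, a)\<in>{(i, a). i + a < B}. h i a)"
    proof (rule sum.mono_neutral_right)
      have "h i a = 0" if "\<not> i + a < B" for i a using that by (simp add: h_def E0)
      then show "\<forall>t\<in>{..<B} \<times> {..<B} - {(i, a). i + a < B}. (case t of (i, a) \<Rightarrow> h i a) = 0" by auto
    qed auto
    finally show ?thesis .
  qed
  also have "\<dots> = (\<Sum>b<B. \<Sum>i\<le>b. h i (b - i))" by (rule sum.triangle_reindex)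
  also have "\<dots> = (\<Sum>b<B. \<Sum>j\<le>p. \<Sum>s\<le>q. ?lhs j s b)"
  proof (rule sum.cong[OF refl])
    fix b
    have "(\<Sum>i\<le>b. h i (b - i)) = (\<Sum>i\<le>b. \<Sum>j\<le>p. \<Sum>s\<le>q. mscale Z (?c i (b - i) j) (E j s b))"
      by (rule sum.cong[OF refl]) (simp add: h_def)
    also have "\<dots> = (\<Sum>j\<le>p. \<Sum>i\<le>b. \<Sum>s\<le>q. mscale Z (?c i (b - i) j) (E j s b))"
      by (rule sum.swap)
    also have "\<dots> = (\<Sum>j\<le>p. \<Sum>s\<le>q. ?lhs j s b)"
    proof (rule sum.cong[OF refl])
      fix j
      have "(\<Sum>i\<le>b. \<Sum>s\<le>q. mscale Z (?c i (b - i) j) (E j s b)) =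
        (\<Sum>s\<le>q. \<Sum>i\<le>b. mscale Z (?c i (b - i) j) (E j s b))" by (rule sum.swap)
      also have "\<dots> = (\<Sum>s\<le>q. ?lhs j s b)"
      proof (rule sum.cong[OF refl])
        fix s
        have "E j s b = mode (vmode V (V.Ld j u) (l + int b) (V.Ld s v))
           ((2 * int p - int j - m - l - 2) + (2 * int q - int s - n - l - 2) - int b) x"
          unfolding E_def by (rule arg_cong2[where f = "\<lambda>y k. mode y k x"]) simp_all
        then show "(\<Sum>i\<le>b. mscale Z (?c i (b - i) j) (E j s b)) =
          ?lhs j s b"
          by (simp only: scale_sum_left[symmetric] inv_coeff_convolution borcherds_lhs_def)
      qed
      finally show "(\<Sum>i\<le>b. \<Sum>s\<le>q. mscale Z (?c i (b - i) j) (E j s b)) =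
        (\<Sum>s\<le>q. ?lhs j s b)" .
    qed
    finally show "(\<Sum>i\<le>b. h i (b - i)) = (\<Sum>j\<le>p. \<Sum>s\<le>q. ?lhs j s b)" .
  qed
  also have "\<dots> = (\<Sum>j\<le>p. \<Sum>b<B. \<Sum>s\<le>q. ?lhs j s b)"
    by (rule sum.swap)
  also have "\<dots> = (\<Sum>j\<le>p. \<Sum>s\<le>q. \<Sum>b<B. ?lhs j s b)"
    by (rule sum.cong[OF refl], rule sum.swap)
  finally show ?thesis by (simp only: \<sigma>_def)
qed

text \<open>The sign equals - (-1)^l times (-1)^(p + q). Its first factor interchanges the roles of
  the two products on the right side, as it must, since transposition reverses the order of
  operators; the second is the sign in two transposed modes.\<close>

lemma inv_mode_borcherds_rhs:
  assumes u: "u \<in> vgrade V p" and v: "v \<in> vgrade V q" and x: "x \<in> mspace Z"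
  shows "mscale Z ((-1) powi (int p + int q - l - 1)) (\<Sum>j\<le>p. \<Sum>s\<le>q.
      rhs (V.Ld j u) (V.Ld s v) x l (2 * int p - int j - m - l - 2) (2 * int q - int s - n - l - 2) b) =
    mscale Z ((-1) ^ b * (of_int l gchoose b)) (inv_mode v (n + int b) (inv_mode u (m + l - int b) x)
      - mscale Z ((-1) powi l) (inv_mode u (m + int b) (inv_mode v (n + l - int b) x)))"
proof -
  define \<tau> :: complex where "\<tau> = (-1) ^ b * (of_int l gchoose b)"
  define P where "P j s = mode (V.Ld j u) (2 * int p - int j - 2 - (m + int b))
      (mode (V.Ld s v) (2 * int q - int s - 2 - (n + l - int b)) x)" for j s
  define Q where "Q j s = mode (V.Ld s v) (2 * int q - int s - 2 - (n + int b))
      (mode (V.Ld j u) (2 * int p - int j - 2 - (m + l - int b)) x)" for j s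
  have r: "rhs (V.Ld j u) (V.Ld s v) x l (2 * int p - int j - m - l - 2) (2 * int q - int s - n - l - 2) b
      = mscale Z \<tau> (P j s - mscale Z ((-1) powi l) (Q j s))" for j s
  proof -
    have "2 * int p - int j - m - l - 2 + l - int b = 2 * int p - int j - 2 - (m + int b)"
      "2 * int q - int s - n - l - 2 + int b = 2 * int q - int s - 2 - (n + l - int b)"
      "2 * int q - int s - n - l - 2 + l - int b = 2 * int q - int s - 2 - (n + int b)"
      "2 * int p - int j - m - l - 2 + int b = 2 * int p - int j - 2 - (m + l - int b)" by simp_all
    then show ?thesis unfolding borcherds_rhs_def \<tau>_def P_def Q_def by (simp only:)
  qed
  have uv: "inv_mode u (m + int b) (inv_mode v (n + l - int b) x) = mscale Z ((-1) ^ (p + q)) (\<Sum>j\<le>p. \<Sum>s\<le>q. P j s)"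
    unfolding inv_mode_eq[OF v x] inv_mode_eq[OF u inv_mode_closed[OF x, of v, unfolded inv_mode_eq[OF v x]]]
    unfolding inv_mode_hom_def P_def
    by (simp add: mode_scale mode_sum mode_closed x subspace_sum[OF space_subspace] subspace_scale[OF space_subspace] scale_sum_right power_add)
  have vu: "inv_mode v (n + int b) (inv_mode u (m + l - int b) x) = mscale Z ((-1) ^ (p + q)) (\<Sum>j\<le>p. \<Sum>s\<le>q. Q j s)"
  proof -
    have "inv_mode v (n + int b) (inv_mode u (m + l - int b) x) = mscale Z ((-1) ^ (p + q)) (\<Sum>s\<le>q. \<Sum>j\<le>p. Q j s)"
      unfolding inv_mode_eq[OF u x] inv_mode_eq[OF v inv_mode_closed[OF x, of u, unfolded inv_mode_eq[OF u x]]]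
      unfolding inv_mode_hom_def Q_def
      by (simp add: mode_scale mode_sum mode_closed x subspace_sum[OF space_subspace] subspace_scale[OF space_subspace] scale_sum_right power_add mult.commute)
    then show ?thesis by (simp only: sum.swap[of _ "{..q}"])
  qed
  have sgn: "(-1 :: complex) powi (int p + int q - l - 1) = - ((-1) powi l) * (-1) ^ (p + q)"
  proof -
    have "int p + int q - l - 1 = int (p + q) - (l + 1)" by simp
    moreover have "(-1 :: complex) powi (int (p + q) - (l + 1)) = (-1) powi int (p + q) / (-1) powi (l + 1)"
      by (rule power_int_diff) simp
    ultimately have "(-1 :: complex) powi (int p + int q - l - 1) = (-1) powi int (p + q) / (-1) powi (l + 1)"
      by (simp only:)
    also have "\<dots> = - ((-1) powi l) * (-1) ^ (p + q)"
      by (cases "even l") (simp_all add: power_int_add power_add)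
    finally show ?thesis .
  qed
  have sq: "((-1 :: complex) powi l) * ((-1) powi l) = 1" by (cases "even l") simp_all
  have "(\<Sum>j\<le>p. \<Sum>s\<le>q. rhs (V.Ld j u) (V.Ld s v) x l (2 * int p - int j - m - l - 2) (2 * int q - int s - n - l - 2) b)
      = mscale Z \<tau> ((\<Sum>j\<le>p. \<Sum>s\<le>q. P j s) - mscale Z ((-1) powi l) (\<Sum>j\<le>p. \<Sum>s\<le>q. Q j s))"
    by (simp only: r sum_subtractf scale_sum_right scale_right_diff_distrib)
  moreover have "mscale Z (- e * d) (mscale Z t (X - mscale Z e Y)) = mscale Z t (mscale Z d Y - mscale Z e (mscale Z d X))"
    if e: "e * e = 1" for e d t X Y
  proof -
    have "- e * d * t * e = - ((e * e) * (t * d))" by (simp add: ac_simps)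
    then have c: "- e * d * t * e = - (t * d)" by (simp only: e mult_1)
    have "mscale Z (- e * d) (mscale Z t (X - mscale Z e Y)) = mscale Z (- e * d * t) X - mscale Z (- e * d * t * e) Y"
      by (simp only: scale_right_diff_distrib scale_scale mult.assoc)
    also have "\<dots> = mscale Z (t * d) Y - mscale Z (t * (e * d)) X"
      unfolding c by (simp add: mult.commute mult.left_commute)
    finally show ?thesis by (simp only: scale_right_diff_distrib scale_scale mult.assoc)
  qed
  ultimately show ?thesis
    unfolding uv vu sgn \<tau>_def[symmetric] using sq by (simp only:)
qed

text \<open>The products appear in the order opposite to the Borcherds identity; composing
  functionals with them restores the order.\<close>

lemma inv_mode_borcherds:
  assumes x: "x \<in> mspace Z"
  shows "\<exists>B0. \<forall>B\<ge>B0. (\<Sum>i<B. mscale Z (of_int m gchoose i) (inv_mode (vmode V u (l + int i) v) (m + n - int i) x)) =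
    (\<Sum>b<B. mscale Z ((-1) ^ b * (of_int l gchoose b)) (inv_mode v (n + int b) (inv_mode u (m + l - int b) x)
      - mscale Z ((-1) powi l) (inv_mode u (m + int b) (inv_mode v (n + l - int b) x))))"
    (is "\<exists>B0. \<forall>B\<ge>B0. ?L u v B = ?R u v B")
proof (induction u rule: V.homogeneous_induct)
  case (add u u')
  then obtain B1 B2 where "\<forall>B\<ge>B1. ?L u v B = ?R u v B" "\<forall>B\<ge>B2. ?L u' v B = ?R u' v B" by blast
  moreover have "?L (u + u') v B = ?L u v B + ?L u' v B" for B
    by (simp add: V.vmode_add_left inv_mode_add_left x scale_right_distrib sum.distrib)
  moreover have "?R (u + u') v B = ?R u v B + ?R u' v B" for B
    by (simp add: inv_mode_add_left inv_mode_add inv_mode_closed x scale_right_distrib sum.distrib[symmetric] algebra_simps)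
  ultimately show ?case by (intro exI[of _ "max B1 B2"]) simp
next
  case (scale c u)
  then obtain B1 where "\<forall>B\<ge>B1. ?L u v B = ?R u v B" by blast
  moreover have "?L (vscale V c u) v B = mscale Z c (?L u v B)" for B
    by (simp add: V.vmode_scale_left inv_mode_scale_left x scale_sum_right mult.commute)
  moreover have "?R (vscale V c u) v B = mscale Z c (?R u v B)" for B
    by (simp add: inv_mode_scale_left inv_mode_scale inv_mode_closed x scale_sum_right scale_right_diff_distrib mult.assoc mult.left_commute mult.commute)
  ultimately show ?case by (intro exI[of _ B1]) simp
next
  case (hom p u)
  note u = hom
  show ?case
  proof (induction v rule: V.homogeneous_induct)
    case (add v v')
    then obtain B1 B2 where "\<forall>B\<ge>B1. ?L u v B = ?R u v B" "\<forall>B\<ge>B2. ?L u v' B = ?R u v' B" by blast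
    moreover have "?L u (v + v') B = ?L u v B + ?L u v' B" for B
      by (simp add: V.vmode_add inv_mode_add_left x scale_right_distrib sum.distrib)
    moreover have "?R u (v + v') B = ?R u v B + ?R u v' B" for B
      by (simp add: inv_mode_add_left inv_mode_add inv_mode_closed x scale_right_distrib sum.distrib[symmetric] algebra_simps)
    ultimately show ?case by (intro exI[of _ "max B1 B2"]) simp
  next
    case (scale c v)
    then obtain B1 where "\<forall>B\<ge>B1. ?L u v B = ?R u v B" by blast
    moreover have "?L u (vscale V c v) B = mscale Z c (?L u v B)" for B
      by (simp add: V.vmode_scale inv_mode_scale_left x scale_sum_right mult.commute)
    moreover have "?R u (vscale V c v) B = mscale Z c (?R u v B)" for B
      by (simp add: inv_mode_scale_left inv_mode_scale inv_mode_closed x scale_sum_right scale_right_diff_distrib mult.assoc mult.left_commute mult.commute)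
    ultimately show ?case by (intro exI[of _ B1]) simp
  next
    case (hom q v)
    note v = hom
    let ?lhs = "\<lambda>j s. lhs (V.Ld j u) (V.Ld s v) x l (2 * int p - int j - m - l - 2) (2 * int q - int s - n - l - 2)"
    let ?rhs = "\<lambda>j s. rhs (V.Ld j u) (V.Ld s v) x l (2 * int p - int j - m - l - 2) (2 * int q - int s - n - l - 2)"
    have "\<exists>K0. \<forall>K\<ge>K0. (\<forall>b\<ge>K. vmode V (V.Ld j u) (l + int b) (V.Ld s v) = 0) \<and>
       (\<Sum>b<K. ?lhs j s b) = (\<Sum>b<K. ?rhs j s b)" for j s
    proof -
      obtain N where N: "\<forall>k\<ge>N. vmode V (V.Ld j u) k (V.Ld s v) = 0" using V.truncation by blast
      obtain K1 where K1: "\<forall>K\<ge>K1. (\<Sum>b<K. ?lhs j s b) = (\<Sum>b<K. ?rhs j s b)"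
        using borcherds_sums[OF x] by blast
      show ?thesis using N K1 by (intro exI[of _ "max K1 (nat (N - l))"]) auto
    qed
    then obtain K0 where K0: "\<And>j s K. K \<ge> K0 j s \<Longrightarrow> (\<forall>b\<ge>K. vmode V (V.Ld j u) (l + int b) (V.Ld s v) = 0) \<and>
       (\<Sum>b<K. ?lhs j s b) = (\<Sum>b<K. ?rhs j s b)" by metis
    \<comment> \<open>A common bound for the finitely many instances of the Borcherds identity, one
      for each pair of divided powers; beyond \<open>p\<close> and \<open>q\<close> these
      vanish.\<close>
    define B0 where "B0 = Max ((\<lambda>(j, s). K0 j s) ` ({..p} \<times> {..q}))"
    have B0: "K0 j s \<le> B0" if "j \<le> p" "s \<le> q" for j s
      unfolding B0_def by (rule Max_ge) (use that in auto)
    have "?L u v B = ?R u v B" if B: "B \<ge> B0" for B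
    proof -
      have z: "vmode V (V.Ld j u) (l + int b) (V.Ld s v) = 0" if "b \<ge> B" for b j s
      proof (cases "j \<le> p \<and> s \<le> q")
        case True
        then show ?thesis using K0[of j s B] B0[of j s] B that by auto
      next
        case False
        then have "V.Ld j u = 0 \<or> V.Ld s v = 0" using V.Ld_eq_0[OF u] V.Ld_eq_0[OF v] by (meson not_le)
        then show ?thesis by auto
      qed
      have "?L u v B = mscale Z ((-1) powi (int p + int q - l - 1)) (\<Sum>j\<le>p. \<Sum>s\<le>q. \<Sum>b<B. ?lhs j s b)"
        by (rule inv_mode_borcherds_lhs[OF u v x z])
      also have "(\<Sum>j\<le>p. \<Sum>s\<le>q. \<Sum>b<B. ?lhs j s b) =
        (\<Sum>j\<le>p. \<Sum>s\<le>q. \<Sum>b<B. ?rhs j s b)"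
      proof (rule sum.cong[OF refl], rule sum.cong[OF refl])
        fix j s assume "j \<in> {..p}" "s \<in> {..q}"
        then have "B \<ge> K0 j s" using B0[of j s] B by simp
        then show "(\<Sum>b<B. ?lhs j s b) = (\<Sum>b<B. ?rhs j s b)"
          using K0[of j s B] by blast
      qed
      also have "\<dots> = (\<Sum>j\<le>p. \<Sum>b<B. \<Sum>s\<le>q. ?rhs j s b)"
        by (rule sum.cong[OF refl], rule sum.swap)
      also have "\<dots> = (\<Sum>b<B. \<Sum>j\<le>p. \<Sum>s\<le>q. ?rhs j s b)"
        by (rule sum.swap)
      finally show ?thesis
        unfolding scale_sum_right[of _ _ "{..<B}"] inv_mode_borcherds_rhs[OF u v x] .
    qed
    then show ?case by blast
  qed
qed

end

section \<open>Contragredient modules\<close>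

lemma sum_fun_apply: "(\<Sum>a\<in>A. f a) x = (\<Sum>a\<in>A. f a x)"
  by (induction A rule: infinite_finite_induct) simp_all

abbreviation fun_scale :: "complex \<Rightarrow> ('m \<Rightarrow> complex) \<Rightarrow> 'm \<Rightarrow> complex" where
  "fun_scale \<equiv> (\<lambda>c f x. c * f x)"

lemma vector_space_fun_scale: "vector_space (fun_scale :: complex \<Rightarrow> ('m \<Rightarrow> complex) \<Rightarrow> _)"
  by unfold_locales (auto simp: algebra_simps)

context voa_admissible
begin

text \<open>Extension by 0 outside \<open>mspace Z\<close> makes equality of functionals an equality
  of functions.\<close>

definition functionals :: "('m \<Rightarrow> complex) set" where
  "functionals = {f. (\<forall>x. x \<notin> mspace Z \<longrightarrow> f x = 0) \<and>
     (\<forall>x\<in>mspace Z. \<forall>y\<in>mspace Z. f (x + y) = f x + f y) \<and>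
     (\<forall>c. \<forall>x\<in>mspace Z. f (mscale Z c x) = c * f x)}"

text \<open>The restricted dual: full duals of the homogeneous parts, nonzero in finitely many
  degrees.\<close>

definition dual_space :: "('m \<Rightarrow> complex) set" where
  "dual_space = {f \<in> functionals. \<exists>K. \<forall>k\<ge>K. \<forall>x\<in>mgrade Z k. f x = 0}"

definition dual_module :: "('v, 'm \<Rightarrow> complex) vmod" where
  "dual_module = \<lparr>mscale = fun_scale, mspace = dual_space,
     mmode = (\<lambda>u n f x. if x \<in> mspace Z then f (inv_mode u n x) else 0),
     mgrade = (\<lambda>d. {f \<in> functionals. \<forall>k. k \<noteq> d \<longrightarrow> (\<forall>x\<in>mgrade Z k. f x = 0)})\<rparr>"

lemma dual_module_simps [simp]:
  "mscale dual_module = fun_scale" "mspace dual_module = dual_space"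
  "mmode dual_module u n f x = (if x \<in> mspace Z then f (inv_mode u n x) else 0)"
  "mgrade dual_module d = {f \<in> functionals. \<forall>k. k \<noteq> d \<longrightarrow> (\<forall>x\<in>mgrade Z k. f x = 0)}"
  by (simp_all add: dual_module_def)

lemma functionals_add: "f \<in> functionals \<Longrightarrow> x \<in> mspace Z \<Longrightarrow> y \<in> mspace Z \<Longrightarrow> f (x + y) = f x + f y"
  and functionals_scale: "f \<in> functionals \<Longrightarrow> x \<in> mspace Z \<Longrightarrow> f (mscale Z c x) = c * f x"
  and functionals_outside: "f \<in> functionals \<Longrightarrow> x \<notin> mspace Z \<Longrightarrow> f x = 0"
  by (simp_all add: functionals_def)

lemma functionals_zero: "f \<in> functionals \<Longrightarrow> f 0 = 0"
  using functionals_scale[of f 0 0] subspace_0[OF space_subspace] by simp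

lemma functionals_diff: "f \<in> functionals \<Longrightarrow> x \<in> mspace Z \<Longrightarrow> y \<in> mspace Z \<Longrightarrow> f (x - y) = f x - f y"
  using functionals_add[of f "x - y" y] by (simp add: subspace_diff[OF space_subspace])

lemma functionals_sum:
  assumes "f \<in> functionals" "\<And>a. a \<in> A \<Longrightarrow> g a \<in> mspace Z"
  shows "f (sum g A) = (\<Sum>a\<in>A. f (g a))"
  using assms(2)
  by (induction A rule: infinite_finite_induct)
    (simp_all add: functionals_zero[OF assms(1)] functionals_add[OF assms(1)] subspace_sum[OF space_subspace])

lemma functionals_eqI:
  assumes f: "f \<in> functionals" and g: "g \<in> functionals" and eq: "\<And>k x. x \<in> mgrade Z k \<Longrightarrow> f x = g x"
  shows "f = g"
proof
  fix x
  show "f x = g x"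
  proof (cases "x \<in> mspace Z")
    case True
    have "h x = (\<Sum>k | gcomp (mgrade Z) x k \<noteq> 0. h (gcomp (mgrade Z) x k))" if "h \<in> functionals" for h
      using functionals_sum[OF that, of "{k. gcomp (mgrade Z) x k \<noteq> 0}" "gcomp (mgrade Z) x"]
      by (simp add: gcomp_in_space[OF True] gcomp_sum[OF True])
    from this[OF f] this[OF g] show ?thesis by (simp add: eq[OF gcomp_in[OF True]])
  qed (use f g in \<open>simp add: functionals_outside\<close>)
qed

lemma functionals_compose_inv_mode:
  "f \<in> functionals \<Longrightarrow> (\<lambda>x. if x \<in> mspace Z then f (inv_mode u n x) else 0) \<in> functionals"
  by (auto simp: functionals_def subspace_add[OF space_subspace] subspace_scale[OF space_subspace]
      inv_mode_add inv_mode_scale inv_mode_closed)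

lemma fun_scale_subspace_functionals:
  "0 \<in> functionals" "f \<in> functionals \<Longrightarrow> g \<in> functionals \<Longrightarrow> f + g \<in> functionals"
  "f \<in> functionals \<Longrightarrow> fun_scale c f \<in> functionals"
  by (auto simp: functionals_def algebra_simps)

lemma subspace_dual_space: "module.subspace fun_scale dual_space"
proof -
  interpret F: vector_space "fun_scale :: complex \<Rightarrow> ('m \<Rightarrow> complex) \<Rightarrow> _" by (rule vector_space_fun_scale)
  show ?thesis
  proof (rule F.subspaceI)
    show "0 \<in> dual_space" by (simp add: dual_space_def fun_scale_subspace_functionals)
    show "f + g \<in> dual_space" if fg: "f \<in> dual_space" "g \<in> dual_space" for f g
    proof -
      obtain K1 K2 where "\<forall>k\<ge>K1. \<forall>x\<in>mgrade Z k. f x = 0" "\<forall>k\<ge>K2. \<forall>x\<in>mgrade Z k. g x = 0"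
        using fg by (auto simp: dual_space_def)
      then have "\<forall>k\<ge>max K1 K2. \<forall>x\<in>mgrade Z k. (f + g) x = 0" by auto
      then show ?thesis using fg fun_scale_subspace_functionals unfolding dual_space_def by blast
    qed
    show "fun_scale c f \<in> dual_space" if f: "f \<in> dual_space" for c f
      using f fun_scale_subspace_functionals(3)[of f c] by (auto simp: dual_space_def)
  qed
qed

lemma subspace_dual_grade: "module.subspace fun_scale (mgrade dual_module d)"
proof -
  interpret F: vector_space "fun_scale :: complex \<Rightarrow> ('m \<Rightarrow> complex) \<Rightarrow> _" by (rule vector_space_fun_scale)
  show ?thesis
    by (rule F.subspaceI) (auto simp: fun_scale_subspace_functionals)
qed

lemma dual_grade_subset: "mgrade dual_module d \<subseteq> dual_space"
proof
  fix f assume "f \<in> mgrade dual_module d"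
  then have "f \<in> functionals" "\<forall>k. k \<noteq> d \<longrightarrow> (\<forall>x\<in>mgrade Z k. f x = 0)" by auto
  moreover from this(2) have "\<forall>k\<ge>Suc d. \<forall>x\<in>mgrade Z k. f x = 0" by (metis Suc_n_not_le_n)
  ultimately show "f \<in> dual_space" unfolding dual_space_def by blast
qed

lemma dual_mode_degree:
  assumes f: "f \<in> mgrade dual_module d" and u: "u \<in> vgrade V p"
  shows "int d + int p - n - 1 \<ge> 0 \<Longrightarrow> mmode dual_module u n f \<in> mgrade dual_module (nat (int d + int p - n - 1))"
    and "int d + int p - n - 1 < 0 \<Longrightarrow> mmode dual_module u n f = 0"
proof -
  have ff: "f \<in> functionals" and fd: "\<And>k x. k \<noteq> d \<Longrightarrow> x \<in> mgrade Z k \<Longrightarrow> f x = 0" using f by auto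
  have mf: "mmode dual_module u n f \<in> functionals"
    using functionals_compose_inv_mode[OF ff, of u n] by (simp add: dual_module_def)
  have z: "mmode dual_module u n f x = 0" if x: "x \<in> mgrade Z e" and e: "int e \<noteq> int d + int p - n - 1" for x e
  proof (cases "int e - int p + n + 1 \<ge> 0")
    case True
    then have "nat (int e - int p + n + 1) \<noteq> d" using e by linarith
    then show ?thesis using fd inv_mode_degree(1)[OF u x True] by simp
  next
    case False
    then show ?thesis using inv_mode_degree(2)[OF u x] functionals_zero[OF ff] by simp
  qed
  show "mmode dual_module u n f \<in> mgrade dual_module (nat (int d + int p - n - 1))" if "int d + int p - n - 1 \<ge> 0"
  proof -
    have "mmode dual_module u n f x = 0" if "k \<noteq> nat (int d + int p - n - 1)" "x \<in> mgrade Z k" for k x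
      by (rule z[OF that(2)]) (use that(1) in linarith)
    then show ?thesis using mf unfolding dual_module_simps(4) by blast
  qed
  show "mmode dual_module u n f = 0" if "int d + int p - n - 1 < 0"
    by (rule functionals_eqI[OF mf fun_scale_subspace_functionals(1)]) (use z that in simp)
qed

text \<open>For large n the transposed mode moves every vector past the degrees in which
  \<open>f\<close> is supported.\<close>

lemma dual_truncation:
  assumes f: "f \<in> dual_space"
  shows "\<exists>N. \<forall>n\<ge>N. mmode dual_module u n f = 0"
proof (induction u rule: V.homogeneous_induct)
  case (add u v)
  then obtain N1 N2 where "\<forall>n\<ge>N1. mmode dual_module u n f = 0" "\<forall>n\<ge>N2. mmode dual_module v n f = 0" by blast
  moreover have "mmode dual_module (u + v) n f = mmode dual_module u n f + mmode dual_module v n f" for n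
    using f by (auto simp: fun_eq_iff dual_space_def inv_mode_add_left functionals_add inv_mode_closed)
  ultimately show ?case by (intro exI[of _ "max N1 N2"]) simp
next
  case (scale c u)
  then obtain N where N: "\<forall>n\<ge>N. mmode dual_module u n f = 0" by blast
  have "mmode dual_module (vscale V c u) n f = fun_scale c (mmode dual_module u n f)" for n
    using f by (auto simp: fun_eq_iff dual_space_def inv_mode_scale_left functionals_scale inv_mode_closed)
  then show ?case using N by (intro exI[of _ N]) (simp add: fun_eq_iff)
next
  case (hom p u)
  have ff: "f \<in> functionals" using f by (simp add: dual_space_def)
  obtain K where K: "\<forall>k\<ge>K. \<forall>x\<in>mgrade Z k. f x = 0" using f by (auto simp: dual_space_def)
  have "mmode dual_module u n f = 0" if n: "n \<ge> int K + int p" for n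
  proof (rule functionals_eqI)
    show "mmode dual_module u n f \<in> functionals"
      using functionals_compose_inv_mode[OF ff, of u n] by (simp add: dual_module_def)
    show "0 \<in> functionals" by (rule fun_scale_subspace_functionals(1))
    fix k x assume x: "x \<in> mgrade Z k"
    have "int k - int p + n + 1 \<ge> int K" using n by simp
    then have "int k - int p + n + 1 \<ge> 0" "nat (int k - int p + n + 1) \<ge> K" by linarith+
    then have "f (inv_mode u n x) = 0" using inv_mode_degree(1)[OF hom x] K by blast
    then show "mmode dual_module u n f x = 0 x" by simp
  qed
  then show ?case by blast
qed

lemma dual_mode_closed:
  assumes f: "f \<in> dual_space"
  shows "mmode dual_module u n f \<in> dual_space"
proof -
  interpret F: vector_space "fun_scale :: complex \<Rightarrow> ('m \<Rightarrow> complex) \<Rightarrow> _" by (rule vector_space_fun_scale)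
  have ff: "f \<in> functionals" using f by (simp add: dual_space_def)
  show ?thesis
  proof (induction u rule: V.homogeneous_induct)
    case (add u v)
    have "mmode dual_module (u + v) n f = mmode dual_module u n f + mmode dual_module v n f"
      using ff by (auto simp: fun_eq_iff inv_mode_add_left functionals_add inv_mode_closed)
    then show ?case using F.subspace_add[OF subspace_dual_space add] by (simp only:)
  next
    case (scale c u)
    have "mmode dual_module (vscale V c u) n f = fun_scale c (mmode dual_module u n f)"
      using ff by (auto simp: fun_eq_iff inv_mode_scale_left functionals_scale inv_mode_closed)
    then show ?case using F.subspace_scale[OF subspace_dual_space scale] by (simp only:)
  next
    case (hom p u)
    obtain K where K: "\<forall>k\<ge>K. \<forall>x\<in>mgrade Z k. f x = 0" using f by (auto simp: dual_space_def)
    have "mmode dual_module u n f x = 0" if "k \<ge> K + p + nat (- n)" "x \<in> mgrade Z k" for k x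
    proof -
      have "int k - int p + n + 1 \<ge> int K" using that(1) by linarith
      then have "int k - int p + n + 1 \<ge> 0" "nat (int k - int p + n + 1) \<ge> K" by linarith+
      then have "f (inv_mode u n x) = 0" using inv_mode_degree(1)[OF hom that(2)] K by blast
      then show ?thesis by simp
    qed
    moreover have "mmode dual_module u n f \<in> functionals"
      using functionals_compose_inv_mode[OF ff, of u n] by (simp add: dual_module_def)
    ultimately show ?case unfolding dual_space_def by blast
  qed
qed

lemma dual_grading: "direct_sum_of fun_scale dual_space UNIV (mgrade dual_module)"
proof (rule direct_sum_ofI)
  interpret F: vector_space "fun_scale :: complex \<Rightarrow> ('m \<Rightarrow> complex) \<Rightarrow> _" by (rule vector_space_fun_scale)
  show "vector_space (fun_scale :: complex \<Rightarrow> ('m \<Rightarrow> complex) \<Rightarrow> _)" by (rule vector_space_fun_scale)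
  show "F.subspace (mgrade dual_module i)" for i by (rule subspace_dual_grade)
  show "dual_space = F.span (\<Union>i. mgrade dual_module i)"
  proof
    show "F.span (\<Union>i. mgrade dual_module i) \<subseteq> dual_space"
      by (rule F.span_minimal[OF _ subspace_dual_space]) (use dual_grade_subset in blast)
    show "dual_space \<subseteq> F.span (\<Union>i. mgrade dual_module i)"
    proof
      fix f assume f: "f \<in> dual_space"
      then have ff: "f \<in> functionals" by (simp add: dual_space_def)
      obtain K where K: "\<forall>k\<ge>K. \<forall>x\<in>mgrade Z k. f x = 0" using f by (auto simp: dual_space_def)
      define g where "g d = (\<lambda>x. if x \<in> mspace Z then f (gcomp (mgrade Z) x d) else 0)" for d
      have gf: "g d \<in> functionals" for d
        using ff by (auto simp: functionals_def g_def gcomp_add gcomp_scale gcomp_in_space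
            subspace_add[OF space_subspace] subspace_scale[OF space_subspace])
      have gd: "g d x = (if k = d then f x else 0)" if "x \<in> mgrade Z k" for d k x
        using that grade_in_space[OF that] functionals_zero[OF ff] by (auto simp: g_def gcomp_hom)
      have "f = (\<Sum>d<K. g d)"
      proof (rule functionals_eqI[OF ff])
        have "F.subspace functionals" by (rule F.subspaceI) (simp_all add: fun_scale_subspace_functionals)
        then show "(\<Sum>d<K. g d) \<in> functionals" by (rule F.subspace_sum) (rule gf)
        fix k x assume x: "x \<in> mgrade Z k"
        have "(\<Sum>d<K. g d) x = (\<Sum>d<K. if k = d then f x else 0)"
          unfolding sum_fun_apply gd[OF x] ..
        then show "f x = (\<Sum>d<K. g d) x" using K x by (simp add: not_less)
      qed
      moreover have "g d \<in> mgrade dual_module d" for d using gf gd by auto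
      ultimately show "f \<in> F.span (\<Union>i. mgrade dual_module i)"
        by (metis (no_types, lifting) F.span_base F.span_sum UN_I UNIV_I)
    qed
  qed
next
  fix J and f :: "nat \<Rightarrow> 'm \<Rightarrow> complex" and j
  assume J: "finite J" "\<And>j. j \<in> J \<Longrightarrow> f j \<in> mgrade dual_module j" "sum f J = 0" "j \<in> J"
  show "f j = 0"
  proof (rule functionals_eqI[OF _ fun_scale_subspace_functionals(1)])
    show "f j \<in> functionals" using J by auto
    fix k x assume x: "x \<in> mgrade Z k"
    show "f j x = 0 x"
    proof (cases "k = j")
      case True
      have "0 = (\<Sum>i\<in>J. f i x)" using J(3) by (metis sum_fun_apply zero_fun_apply)
      also have "\<dots> = (\<Sum>i\<in>J. if i = j then f j x else 0)"
      proof (rule sum.cong[OF refl])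
        fix i assume "i \<in> J"
        then show "f i x = (if i = j then f j x else 0)" using J(2)[of i] x True by (cases "i = j") auto
      qed
      also have "\<dots> = f j x" using J(1,4) by simp
      finally show ?thesis by simp
    next
      case False
      then show ?thesis using J(2)[OF J(4)] x by simp
    qed
  qed
qed

text \<open>At a vector \<open>x\<close> the two sides become the values of \<open>f\<close> on the
  two sides of \<open>inv_mode_borcherds\<close>.\<close>

lemma dual_borcherds:
  assumes f: "f \<in> dual_space"
  shows "borcherds_identity (vmode V) fun_scale (mmode dual_module) u v f"
proof (rule borcherds_identityI)
  fix l m n
  let ?L = "borcherds_lhs (vmode V) fun_scale (mmode dual_module) u v f l m n"
  let ?R = "borcherds_rhs fun_scale (mmode dual_module) u v f l m n"
  have ff: "f \<in> functionals" using f by (simp add: dual_space_def)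
  have zero: "mmode dual_module u n 0 = 0" for u n by (simp add: fun_eq_iff)
  have zero_left: "mmode dual_module 0 n f = 0" for n by (simp add: fun_eq_iff functionals_zero[OF ff])
  obtain N1 where N1: "\<forall>k\<ge>N1. vmode V u k v = 0" using V.truncation by blast
  obtain N2 where N2: "\<forall>k\<ge>N2. mmode dual_module v k f = 0" using dual_truncation[OF f] by blast
  obtain N3 where N3: "\<forall>k\<ge>N3. mmode dual_module u k f = 0" using dual_truncation[OF f] by blast
  define K where "K = nat (max (N1 - l) (max (N2 - n) (N3 - m)))"
  have LR: "?L i = 0 \<and> ?R i = 0" if "i \<ge> K" for i
  proof -
    have "l + int i \<ge> N1" "n + int i \<ge> N2" "m + int i \<ge> N3" using that by (auto simp: K_def)
    then have "vmode V u (l + int i) v = 0" "mmode dual_module v (n + int i) f = 0" "mmode dual_module u (m + int i) f = 0"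
      using N1 N2 N3 by blast+
    then show ?thesis
      unfolding borcherds_lhs_def borcherds_rhs_def by (simp only: zero zero_left) (simp add: fun_eq_iff)
  qed
  have "(\<Sum>i<K. ?L i) = (\<Sum>i<K. ?R i)"
  proof
    fix x
    show "(\<Sum>i<K. ?L i) x = (\<Sum>i<K. ?R i) x"
    proof (cases "x \<in> mspace Z")
      case True
      note x = True
      have L: "?L i x = f (mscale Z (of_int m gchoose i) (inv_mode (vmode V u (l + int i) v) (m + n - int i) x))" for i
        using x by (simp add: borcherds_lhs_def functionals_scale[OF ff] inv_mode_closed)
      have R: "?R i x = f (mscale Z ((-1) ^ i * (of_int l gchoose i)) (inv_mode v (n + int i) (inv_mode u (m + l - int i) x)
          - mscale Z ((-1) powi l) (inv_mode u (m + int i) (inv_mode v (n + l - int i) x))))" for i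
        using x by (simp add: borcherds_rhs_def functionals_scale[OF ff] functionals_diff[OF ff] inv_mode_closed
            subspace_diff[OF space_subspace] subspace_scale[OF space_subspace])
      obtain B0 where B0: "\<And>B. B \<ge> B0 \<Longrightarrow> (\<Sum>i<B. mscale Z (of_int m gchoose i) (inv_mode (vmode V u (l + int i) v) (m + n - int i) x)) =
          (\<Sum>b<B. mscale Z ((-1) ^ b * (of_int l gchoose b)) (inv_mode v (n + int b) (inv_mode u (m + l - int b) x)
            - mscale Z ((-1) powi l) (inv_mode u (m + int b) (inv_mode v (n + l - int b) x))))"
        using inv_mode_borcherds[OF x, of m u l v n] by blast
      \<comment> \<open>\<open>B0\<close> depends on \<open>x\<close>, while \<open>K\<close> bounds
        both supports for every \<open>x\<close>; so the sums up to \<open>B\<close> agree with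
        those up to \<open>K\<close>.\<close>
      define B where "B = max B0 K"
      have "(\<Sum>i<K. ?L i) x = (\<Sum>i<B. ?L i x)"
        unfolding sum_fun_apply by (rule sum.mono_neutral_left) (use LR in \<open>auto simp: B_def\<close>)
      also have "\<dots> = f (\<Sum>i<B. mscale Z (of_int m gchoose i) (inv_mode (vmode V u (l + int i) v) (m + n - int i) x))"
        unfolding L by (rule functionals_sum[OF ff, symmetric])
          (simp add: inv_mode_closed x subspace_scale[OF space_subspace])
      also have "\<dots> = f (\<Sum>b<B. mscale Z ((-1) ^ b * (of_int l gchoose b)) (inv_mode v (n + int b) (inv_mode u (m + l - int b) x)
            - mscale Z ((-1) powi l) (inv_mode u (m + int b) (inv_mode v (n + l - int b) x))))"
        using B0[of B] by (simp add: B_def)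
      also have "\<dots> = (\<Sum>i<B. ?R i x)"
        unfolding R by (rule functionals_sum[OF ff])
          (simp add: inv_mode_closed x subspace_scale[OF space_subspace] subspace_diff[OF space_subspace])
      also have "\<dots> = (\<Sum>i<K. ?R i) x"
        unfolding sum_fun_apply by (rule sum.mono_neutral_right) (use LR in \<open>auto simp: B_def\<close>)
      finally show ?thesis .
    next
      case False
      then show ?thesis unfolding sum_fun_apply by (simp add: borcherds_lhs_def borcherds_rhs_def)
    qed
  qed
  then show "\<exists>K. (\<forall>i\<ge>K. ?L i = 0) \<and> (\<forall>i\<ge>K. ?R i = 0) \<and> (\<Sum>i<K. ?L i) = (\<Sum>i<K. ?R i)"
    using LR by blast
qed

text \<open>The vacuum has weight 0, so its transposed mode is the single mode of index -2 - n, and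
  this index is -1 exactly for n = -1.\<close>

lemma dual_vacuum:
  assumes f: "f \<in> dual_space"
  shows "mmode dual_module (vacuum V) n f = (if n = -1 then f else 0)"
proof
  fix x
  have ff: "f \<in> functionals" using f by (simp add: dual_space_def)
  show "mmode dual_module (vacuum V) n f x = (if n = -1 then f else 0) x"
  proof (cases "x \<in> mspace Z")
    case True
    have "inv_mode (vacuum V) n x = (if n = -1 then x else 0)"
      using inv_mode_eq[OF V.vacuum_grade True, of n] vacuum_mode[OF True] by (auto simp: inv_mode_hom_def)
    then show ?thesis using True functionals_zero[OF ff] by simp
  next
    case False
    then show ?thesis using functionals_outside[OF ff] by simp
  qed
qed

lemma dual_admissible: "admissible_module V dual_module"
proof -
  interpret F: vector_space "fun_scale :: complex \<Rightarrow> ('m \<Rightarrow> complex) \<Rightarrow> _" by (rule vector_space_fun_scale)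
  have lin: "f (x + y) = f x + f y" "f (mscale Z c x) = c * f x" if "f \<in> dual_space" "x \<in> mspace Z" "y \<in> mspace Z" for f x y c
    using that functionals_add functionals_scale by (auto simp: dual_space_def)
  have "weak_module V dual_module"
  proof (intro weak_module.intro weak_module_axioms.intro)
    show "vector_space (mscale dual_module)" by (simp add: F.vector_space_axioms)
    show "mmode dual_module (u + u') n f = mmode dual_module u n f + mmode dual_module u' n f"
      if "f \<in> mspace dual_module" for f u u' n
      using that lin by (auto simp: fun_eq_iff inv_mode_add_left inv_mode_closed)
    show "mmode dual_module (vscale V a u) n f = mscale dual_module a (mmode dual_module u n f)"
      if "f \<in> mspace dual_module" for f u n a
      using that lin by (auto simp: fun_eq_iff inv_mode_scale_left inv_mode_closed)
    show "mmode dual_module u n (f + g) = mmode dual_module u n f + mmode dual_module u n g"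
      "mmode dual_module u n (mscale dual_module a f) = mscale dual_module a (mmode dual_module u n f)" for f g u n a
      by (auto simp: fun_eq_iff)
  qed (simp_all add: subspace_dual_space dual_mode_closed dual_truncation dual_vacuum dual_borcherds)
  moreover have "admissible_module_axioms V dual_module"
  proof (rule admissible_module_axioms.intro)
    show "direct_sum_of (mscale dual_module) (mspace dual_module) UNIV (mgrade dual_module)"
      using dual_grading by simp
  qed (use dual_mode_degree in blast)+
  ultimately show ?thesis by (rule admissible_module.intro)
qed

lemma dual_voa_admissible: "voa_admissible V dual_module"
  by (intro voa_admissible.intro voa_weak_module.intro V.vertex_operator_algebra_axioms dual_admissible
      admissible_module.axioms(1)[OF dual_admissible])

end

section \<open>Complete reducibility\<close>

context voa_admissible
begin

lemma functional_exists:
  assumes y: "y \<in> mgrade Z d" "y \<noteq> 0"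
  shows "\<exists>f\<in>mgrade dual_module d. f y \<noteq> 0"
proof -
  interpret C: vector_space "(*) :: complex \<Rightarrow> complex \<Rightarrow> complex" by unfold_locales (simp_all add: algebra_simps)
  interpret P: vector_space_pair "mscale Z" "(*) :: complex \<Rightarrow> complex \<Rightarrow> complex" ..
  have "independent {y}" using y(2) by simp
  then obtain g where g: "Vector_Spaces.linear (mscale Z) (*) g" "g y = (1 :: complex)"
    using P.linear_independent_extend[of "{y}" "\<lambda>_. 1"] by auto
  interpret g: Vector_Spaces.linear "mscale Z" "(*) :: complex \<Rightarrow> complex \<Rightarrow> complex" g by (rule g)
  \<comment> \<open>The projection to degree \<open>d\<close> comes first, so that the functional is
    supported in one degree.\<close>
  define f where "f x = (if x \<in> mspace Z then g (gcomp (mgrade Z) x d) else 0)" for x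
  have "f \<in> functionals"
    by (auto simp: functionals_def f_def gcomp_add gcomp_scale g.add g.scale
        subspace_add[OF space_subspace] subspace_scale[OF space_subspace])
  moreover have "f x = 0" if "k \<noteq> d" "x \<in> mgrade Z k" for k x
    using that by (simp add: f_def gcomp_hom)
  moreover have "f y = 1" using y g grade_in_space by (simp add: f_def gcomp_hom)
  ultimately show ?thesis by (intro bexI[of _ f]) auto
qed

text \<open>Evaluation at \<open>x\<close> factors through the finitely many evaluations at
  \<open>B\<close>, hence is a combination of them, however large \<open>\<G>\<close> is. The
  induction disposes of a further vector \<open>q\<close> either because its evaluation follows from
  the others or by subtracting a multiple of \<open>q\<close> from \<open>x\<close>.\<close>

lemma functional_separation:
  assumes "finite B" "B \<subseteq> mspace Z" "x \<in> mspace Z"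
    and G: "\<G> \<subseteq> functionals" "\<And>g h c. g \<in> \<G> \<Longrightarrow> h \<in> \<G> \<Longrightarrow> (\<lambda>x. g x - c * h x) \<in> \<G>"
    and "\<And>g. g \<in> \<G> \<Longrightarrow> (\<And>b. b \<in> B \<Longrightarrow> g b = 0) \<Longrightarrow> g x = 0"
  shows "\<exists>w\<in>span B. \<forall>g\<in>\<G>. g w = g x"
  using assms(1-3,6)
proof (induction B arbitrary: x)
  case empty
  then have "g 0 = g x" if "g \<in> \<G>" for g using that empty.prems functionals_zero[OF subsetD[OF G(1) that]] by simp
  then show ?case by simp
next
  case (insert q B)
  have inS: "q \<in> mspace Z" "B \<subseteq> mspace Z" "span B \<subseteq> mspace Z"
    using insert.prems span_minimal[OF _ space_subspace] by auto
  show ?case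
  proof (cases "\<forall>g\<in>\<G>. (\<forall>b\<in>B. g b = 0) \<longrightarrow> g q = 0")
    case True
    have "\<exists>w\<in>span B. \<forall>g\<in>\<G>. g w = g x"
    proof (rule insert.IH[OF inS(2) insert.prems(2)])
      fix g assume g: "g \<in> \<G>" "\<And>b. b \<in> B \<Longrightarrow> g b = 0"
      have gq: "g q = 0" by (rule True[rule_format, OF g(1)]) (rule g(2))
      show "g x = 0"
      proof (rule insert.prems(3)[OF g(1)])
        fix b assume "b \<in> insert q B"
        then show "g b = 0" using g(2) gq by blast
      qed
    qed
    then obtain w where "w \<in> span B" "\<forall>g\<in>\<G>. g w = g x" by (rule bexE)
    then show ?thesis using subsetD[OF span_mono[of B "insert q B"]] by (intro bexI[of _ w]) auto
  next
    case False
    then obtain h where h: "h \<in> \<G>" "\<And>b. b \<in> B \<Longrightarrow> h b = 0" "h q \<noteq> 0" by blast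
    \<comment> \<open>The coefficient makes \<open>h\<close>, which separates \<open>q\<close> from
      \<open>B\<close>, vanish on x'.\<close>
    define x' where "x' = x - mscale Z (h x / h q) q"
    have sq: "mscale Z c q \<in> mspace Z" for c using inS subspace_scale[OF space_subspace] by blast
    have x': "x' \<in> mspace Z" using sq insert.prems subspace_diff[OF space_subspace] by (simp add: x'_def)
    have "g x' = 0" if g: "g \<in> \<G>" "\<And>b. b \<in> B \<Longrightarrow> g b = 0" for g
    proof -
      have "g x - (g q / h q) * h x = 0"
        by (rule insert.prems(3)[OF G(2)[OF g(1) h(1)]]) (use g h in auto)
      moreover have "g x' = g x - h x / h q * g q"
        using G(1) g(1) sq insert.prems inS by (auto simp: x'_def functionals_diff functionals_scale subset_iff)
      ultimately show ?thesis by (simp add: field_simps)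
    qed
    then obtain w where w: "w \<in> span B" "\<forall>g\<in>\<G>. g w = g x'"
      using insert.IH[OF inS(2) x'] by blast
    have "g (w + mscale Z (h x / h q) q) = g x" if g: "g \<in> \<G>" for g
    proof -
      have gf: "g \<in> functionals" using g G(1) by blast
      have "g (w + mscale Z (h x / h q) q) = g x' + g (mscale Z (h x / h q) q)"
        using w g sq inS by (auto simp: functionals_add[OF gf])
      also have "\<dots> = g x" using sq insert.prems by (simp add: x'_def functionals_diff[OF gf])
      finally show ?thesis .
    qed
    moreover have "w + mscale Z (h x / h q) q \<in> span (insert q B)"
      using w span_mono[of B "insert q B"] by (intro span_add span_scale) (auto intro: span_base)
    ultimately show ?thesis by blast
  qed
qed

text \<open>\<open>span B\<close> contains what is generated in degree \<open>n\<close> from degree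
  \<open>j\<close>, so all modes into degree \<open>j\<close> kill a functional in
  \<open>\<G>\<close> that vanishes on \<open>B\<close>, and it is 0 by
  \<open>bottom_generated_nondegenerate\<close>. Hence some \<open>w\<close> has the same values as
  \<open>x\<close> under \<open>\<G>\<close>, and unwinding the transposes turns this into a
  statement on modes of x - w.\<close>

lemma lift_from_bottom:
  assumes H: "\<And>Y :: ('v, complex poly) vmod. generated_by_irreducible_top V Y \<Longrightarrow> irreducible_module V Y"
    and ss: "semisimple_ring (zhu_algebra V)" and C2: "C2_cofinite V"
    and below: "\<And>i. i < j \<Longrightarrow> mgrade Z i = {0}"
    and x: "x \<in> mgrade Z n" and B: "finite B" "B \<subseteq> mgrade Z n"
    and gens: "\<And>v q t. v \<in> vgrade V q \<Longrightarrow> t \<in> mgrade Z j \<Longrightarrow> mode v (int q + int j - int n - 1) t \<in> span B"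
  shows "\<exists>w\<in>span B. \<forall>q. \<forall>v\<in>vgrade V q. mode v (int q + int n - int j - 1) (x - w) = 0"
proof -
  interpret D: voa_admissible V dual_module by (rule dual_voa_admissible)
  define \<G> where "\<G> = D.span {D.mode v (int q + int j - int n - 1) f | v q f. v \<in> vgrade V q \<and> f \<in> mgrade dual_module j}"
  have subG: "D.subspace \<G>" by (simp only: \<G>_def D.subspace_span)
  have Gn: "\<G> \<subseteq> mgrade dual_module n"
    unfolding \<G>_def by (rule D.span_minimal[OF _ D.subspace_grade]) (use D.mode_degree in blast)
  have GF: "\<G> \<subseteq> functionals" using Gn by auto
  have BS: "B \<subseteq> mspace Z" "span B \<subseteq> mgrade Z n" "span B \<subseteq> mspace Z"
    using B grade_subset span_minimal[OF B(2) subspace_grade] by blast+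
  have Dbelow: "mgrade dual_module i = {0}" if "i < j" for i
  proof -
    have "f = 0" if f: "f \<in> mgrade dual_module i" for f
    proof (rule functionals_eqI[OF _ fun_scale_subspace_functionals(1)])
      show "f \<in> functionals" using f by simp
      then have "f 0 = 0" by (rule functionals_zero)
      then show "f x = 0 x" if "x \<in> mgrade Z k" for k x
        using that f below[OF \<open>i < j\<close>] by (cases "k = i") auto
    qed
    then show ?thesis using D.subspace_0[OF D.subspace_grade] by blast
  qed
  have "g x = 0" if g: "g \<in> \<G>" "\<And>b. b \<in> B \<Longrightarrow> g b = 0" for g
  proof -
    have gF: "g \<in> functionals" using g GF by blast
    have gB: "g y = 0" if "y \<in> span B" for y
    proof -
      have "y \<in> mspace Z \<and> g y = 0"
        using that by (induction rule: span_induct_alt)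
          (use BS(1) g(2) functionals_zero[OF gF] in \<open>auto simp: functionals_add[OF gF] functionals_scale[OF gF]
             subspace_0[OF space_subspace] subspace_add[OF space_subspace] subspace_scale[OF space_subspace]\<close>)
      then show ?thesis ..
    qed
    have "D.mode v (int q + int n - int j - 1) g = 0" if v: "v \<in> vgrade V q" for v q
    proof (rule functionals_eqI[OF _ fun_scale_subspace_functionals(1)])
      have gn: "g \<in> mgrade dual_module n" using g Gn by blast
      have Dj: "D.mode v (int q + int n - int j - 1) g \<in> mgrade dual_module j" by (rule D.mode_degree[OF v gn])
      then show "D.mode v (int q + int n - int j - 1) g \<in> functionals" unfolding dual_module_simps(4) by blast
      fix k t assume t: "t \<in> mgrade Z k"
      show "D.mode v (int q + int n - int j - 1) g t = 0 t"
      proof (cases "k = j")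
        case False
        then show ?thesis using Dj t unfolding dual_module_simps(4) by simp
      next
        case True
        \<comment> \<open>The value of a mode of \<open>g\<close> at \<open>t\<close> is the value
          of \<open>g\<close> at a transposed mode of \<open>t\<close>, and this is a combination of
          the modes in \<open>gens\<close>.\<close>
        have "mode (V.Ld i v) (2 * int q - int i - 2 - (int q + int n - int j - 1)) t \<in> span B" if "i \<le> q" for i
        proof -
          have e: "2 * int q - int i - 2 - (int q + int n - int j - 1) = int (q - i) + int j - int n - 1"
            using that by (simp add: of_nat_diff)
          show ?thesis unfolding e by (rule gens[OF V.Ld_grade[OF v] t[unfolded True]])
        qed
        then have "inv_mode v (int q + int n - int j - 1) t \<in> span B"
          unfolding inv_mode_eq[OF v grade_in_space[OF t]] inv_mode_hom_def
          by (intro span_scale span_sum) simp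
        then show ?thesis using gB by simp
      qed
    qed
    then have "{D.mode v (int q + int n - int j - 1) g |q v. v \<in> vgrade V q} \<subseteq> {0}" by blast
    then have "D.gen_part g n j \<subseteq> {0}"
      unfolding D.gen_part_def by (rule D.span_minimal) (rule D.subspace_single_0)
    then have "D.gen_part g n j = {0}" using D.subspace_0[OF D.subspace_gen_part] by blast
    then have "g = 0"
      using D.bottom_generated_nondegenerate[OF H ss C2 Dbelow g(1)[unfolded \<G>_def]] g(1) Gn by blast
    then show ?thesis by simp
  qed
  moreover have "(\<lambda>x. g x - c * h x) \<in> \<G>" if "g \<in> \<G>" "h \<in> \<G>" for g h c
  proof -
    have "g - fun_scale c h \<in> \<G>"
      using that D.subspace_diff[OF subG] D.subspace_scale[OF subG, of h c] by (simp add: dual_module_def)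
    then show ?thesis by (simp add: fun_diff_def)
  qed
  ultimately obtain w where w: "w \<in> span B" and gw: "\<And>g. g \<in> \<G> \<Longrightarrow> g w = g x"
    using functional_separation[OF B(1) BS(1) grade_in_space[OF x] GF] by blast
  define z where "z = x - w"
  have zn: "z \<in> mgrade Z n" using x w BS(2) subspace_diff[OF subspace_grade] by (auto simp: z_def)
  note zS = grade_in_space[OF zn]
  have gz: "g z = 0" if "g \<in> \<G>" for g
    using gw[OF that] functionals_diff[of g x w] that GF grade_in_space[OF x] w BS(3) by (auto simp: z_def)
  \<comment> \<open>The transpose of a mode of \<open>v\<close> involves all divided powers
    \<open>Ld i v\<close>. Those with i > 0 have smaller weight, so induction on the weight isolates
    the mode of \<open>v\<close> itself.\<close>
  have fz: "f (mode v (int q + int n - int j - 1) z) = 0" if f: "f \<in> mgrade dual_module j" and "v \<in> vgrade V q" for f v q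
    using that(2)
  proof (induction q arbitrary: v rule: less_induct)
    case (less q)
    note v = less.prems
    have fF: "f \<in> functionals" using f by simp
    let ?t = "\<lambda>i. f (mode (V.Ld i v) (int (q - i) + int n - int j - 1) z)"
    have "D.mode v (int q + int j - int n - 1) f \<in> \<G>"
      unfolding \<G>_def using v f by (intro D.span_base) blast
    from gz[OF this] have "f (inv_mode_hom q v (int q + int j - int n - 1) z) = 0"
      using zS by (simp add: inv_mode_eq[OF v])
    moreover have "f (inv_mode_hom q v (int q + int j - int n - 1) z) = (-1) ^ q * (\<Sum>i\<le>q. ?t i)"
    proof -
      have e: "2 * int q - int i - 2 - (int q + int j - int n - 1) = int (q - i) + int n - int j - 1" if "i \<in> {..q}" for i
        using that by (simp add: of_nat_diff)
      have "(\<Sum>i\<le>q. mode (V.Ld i v) (2 * int q - int i - 2 - (int q + int j - int n - 1)) z) =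
          (\<Sum>i\<le>q. mode (V.Ld i v) (int (q - i) + int n - int j - 1) z)"
        by (rule sum.cong[OF refl]) (simp only: e)
      then show ?thesis
        unfolding inv_mode_hom_def
        by (simp add: functionals_scale[OF fF] functionals_sum[OF fF] subspace_sum[OF space_subspace] mode_closed zS)
    qed
    ultimately have "(\<Sum>i\<le>q. ?t i) = 0" by simp
    moreover have "(\<Sum>i\<le>q. ?t i) = ?t 0"
    proof -
      have "?t i = 0" if "i \<in> {..q} - {0}" for i
        by (rule less.IH) (use that V.Ld_grade[OF v] in auto)
      then have "(\<Sum>i\<in>{..q} - {0}. ?t i) = 0" by (rule sum.neutral[rule_format])
      then show ?thesis using sum.remove[of "{..q}" 0 ?t] by simp
    qed
    ultimately show ?case by simp
  qed
  have "mode v (int q + int n - int j - 1) z = 0" if v: "v \<in> vgrade V q" for v q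
    using functional_exists[OF mode_degree[OF v zn]] fz[OF _ v] by blast
  then show ?thesis using w by (auto simp: z_def)
qed

text \<open>\<open>lift_from_bottom\<close> wants a module that starts in degree \<open>j\<close>,
  so it is applied to \<open>gen x\<close> in place of \<open>Z\<close>. The finite set
  \<open>F\<close> spans what is generated in degree \<open>n\<close> from degree \<open>j\<close>
  of \<open>gen x\<close>, and it lies in the socle because the vectors of degree \<open>j\<close>
  are top vectors.\<close>

lemma split_at_degree:
  assumes H: "\<And>Y :: ('v, complex poly) vmod. generated_by_irreducible_top V Y \<Longrightarrow> irreducible_module V Y"
    and ss: "semisimple_ring (zhu_algebra V)" and C2: "C2_cofinite V"
    and x: "x \<in> mgrade Z n" and low: "\<And>k. k < j \<Longrightarrow> gen_part x n k = {0}"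
  shows "\<exists>w\<in>socle \<inter> mgrade Z n. \<forall>k\<le>j. gen_part (x - w) n k = {0}"
proof -
  note xS = grade_in_space[OF x]
  define X where "X = gen x"
  have X: "adm X" unfolding X_def by (rule admissible_submodule_gen[OF x])
  have XZ: "X \<inter> mgrade Z k = gen_part x n k" for k unfolding X_def by (rule gen_Int_grade[OF x])
  obtain B1 where B1: "finite B1" "gen_part x n j = span B1" using gen_part_finite[OF C2 x] by blast
  have top: "top_vector j t" if t: "t \<in> gen_part x n j" for t
    unfolding top_vector_def
  proof (intro conjI allI impI)
    have tX: "t \<in> X" "t \<in> mgrade Z j" using t XZ by blast+
    then show "t \<in> mgrade Z j" by simp
    fix k u m assume u: "u \<in> vgrade V k" and neg: "int k - m - 1 < 0"
    show "mode u m t = 0"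
    proof (rule ccontr)
      assume nz: "mode u m t \<noteq> 0"
      then obtain d where d: "m = int k + int j - int d - 1" "mode u m t \<in> mgrade Z d"
        using mode_homogeneous[OF u tX(2)] by blast
      then have "mode u m t \<in> gen_part x n d" using XZ adm_mode[OF X tX(1)] by blast
      then show False using low[of d] d(1) neg nz by simp
    qed
  qed
  have b1: "b \<in> gen_part x n j" if "b \<in> B1" for b using that B1 span_base by simp
  have b1j: "b \<in> mgrade Z j" if "b \<in> B1" for b using b1[OF that] XZ by blast
  have "\<forall>b\<in>B1. \<exists>B. finite B \<and> gen_part b j n = span B" using gen_part_finite[OF C2 b1j] by blast
  then obtain B2 where B2: "\<And>b. b \<in> B1 \<Longrightarrow> finite (B2 b) \<and> gen_part b j n = span (B2 b)"
    by metis
  define F where "F = (\<Union>b\<in>B1. B2 b)"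
  have F: "finite F" using B1(1) B2 by (simp add: F_def)
  have Fp: "\<exists>b\<in>B1. y \<in> gen_part b j n" if y: "y \<in> F" for y
  proof -
    obtain b where "b \<in> B1" "y \<in> B2 b" using y by (auto simp: F_def)
    then show ?thesis using B2[of b] span_base[of y "B2 b"] by auto
  qed
  have Fn: "F \<subseteq> mgrade Z n" using Fp gen_part_in_grade[OF b1j] by blast
  have genb: "gen_part b j n \<subseteq> X \<inter> socle" if b: "b \<in> B1" for b
  proof -
    have "b \<in> socle" using top_vector_in_bottom_socle[OF H ss C2 top[OF b1[OF b]]] bottom_socle_subset by blast
    moreover have "b \<in> X" using b1[OF b] XZ by blast
    ultimately have "gen b \<subseteq> socle" "gen b \<subseteq> X"
      using gen_minimal adm_socle X by (auto simp: admissible_submodule_def)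
    then show ?thesis using gen_Int_grade[OF b1j[OF b]] by blast
  qed
  then have FX: "F \<subseteq> X \<inter> socle" using Fp by blast
  have "mode v (int q + int j - int n - 1) t \<in> span F" if v: "v \<in> vgrade V q" and t: "t \<in> X \<inter> mgrade Z j" for v q t
  proof -
    have "t \<in> span B1" using t XZ B1 by simp
    then have "t \<in> mspace Z \<and> mode v (int q + int j - int n - 1) t \<in> span F"
    proof (induction rule: span_induct_alt)
      case base
      then show ?case by (simp add: subspace_0[OF space_subspace] span_zero)
    next
      case (step c b y)
      have "b \<in> mspace Z" using b1j[OF step(1)] grade_in_space by blast
      moreover have "mode v (int q + int j - int n - 1) b \<in> span F"
        using mode_in_gen_part[OF v, of j n b] B2[OF step(1)] span_mono[of "B2 b" F] step(1) by (auto simp: F_def)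
      ultimately show ?case using step
        by (simp add: mode_add mode_scale subspace_add[OF space_subspace] subspace_scale[OF space_subspace] span_add span_scale)
    qed
    then show ?thesis ..
  qed
  moreover have "voa_admissible V (restrict_module Z X)"
    by (intro voa_admissible.intro voa_weak_module.intro V.vertex_operator_algebra_axioms
        admissible_module_restrict[OF X] admissible_module.axioms(1)[OF admissible_module_restrict[OF X]])
  moreover have "X \<inter> mgrade Z i = {0}" if "i < j" for i using XZ low[OF that] by simp
  moreover have "x \<in> X \<inter> mgrade Z n" using x self_in_gen[OF xS] by (simp add: X_def)
  ultimately obtain w where w: "w \<in> span F" "\<And>q v. v \<in> vgrade V q \<Longrightarrow> mode v (int q + int n - int j - 1) (x - w) = 0"
    using voa_admissible.lift_from_bottom[of V "restrict_module Z X" j x n F, OF _ H ss C2] F Fn FX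
    unfolding restrict_module_simps by (metis Int_greatest le_inf_iff)
  have wX: "w \<in> X \<inter> socle" and wn: "w \<in> mgrade Z n"
    using w(1) span_minimal[OF FX subspace_inter[OF adm_subspace[OF X] adm_subspace[OF adm_socle]]]
      span_minimal[OF Fn subspace_grade] by blast+
  have xw: "x - w \<in> X" "x - w \<in> mgrade Z n"
    using wX wn x self_in_gen[OF xS] subspace_diff[OF adm_subspace[OF X]] subspace_diff[OF subspace_grade]
    by (auto simp: X_def)
  have "gen_part (x - w) n k = {0}" if k: "k \<le> j" for k
  proof -
    have "mode v (int q + int n - int k - 1) (x - w) = 0" if v: "v \<in> vgrade V q" for v q
    proof (cases "k = j")
      case True
      then show ?thesis using w(2)[OF v] by simp
    next
      \<comment> \<open>Degrees below \<open>j\<close> stay empty because x - w still lies in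
        \<open>gen x\<close>.\<close>
      case False
      then have "gen_part x n k = {0}" using low k by simp
      moreover have "mode v (int q + int n - int k - 1) (x - w) \<in> X \<inter> mgrade Z k"
        using adm_mode[OF X xw(1)] mode_degree[OF v xw(2)] by blast
      ultimately show ?thesis using XZ by blast
    qed
    then have "{mode v (int q + int n - int k - 1) (x - w) |q v. v \<in> vgrade V q} \<subseteq> {0}" by blast
    then have "gen_part (x - w) n k \<subseteq> {0}" unfolding gen_part_def by (rule span_minimal) simp
    then show ?thesis using subspace_0[OF subspace_gen_part] by blast
  qed
  then show ?thesis using wX wn by blast
qed

lemma socle_eq_space:
  assumes H: "\<And>Y :: ('v, complex poly) vmod. generated_by_irreducible_top V Y \<Longrightarrow> irreducible_module V Y"
    and ss: "semisimple_ring (zhu_algebra V)" and C2: "C2_cofinite V"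
  shows "mspace Z \<subseteq> socle"
proof -
  have sub: "subspace socle" by (rule adm_subspace[OF adm_socle])
  have "x \<in> socle" if x: "x \<in> mgrade Z n" for x n
  proof -
    \<comment> \<open>Induction on the first degree not yet cleared; the corrections add up inside
      the socle.\<close>
    have "\<exists>w\<in>socle \<inter> mgrade Z n. \<forall>k<j. gen_part (x - w) n k = {0}" for j
    proof (induction j)
      case 0
      show ?case using subspace_0[OF sub] subspace_0[OF subspace_grade] by blast
    next
      case (Suc j)
      then obtain w where w: "w \<in> socle \<inter> mgrade Z n" "\<And>k. k < j \<Longrightarrow> gen_part (x - w) n k = {0}" by blast
      have "x - w \<in> mgrade Z n" using x w subspace_diff[OF subspace_grade] by blast
      from split_at_degree[OF H ss C2 this w(2)]
      obtain w' where w': "w' \<in> socle \<inter> mgrade Z n" "\<forall>k\<le>j. gen_part (x - w - w') n k = {0}" by blast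
      have "w + w' \<in> socle \<inter> mgrade Z n"
        using w(1) w'(1) subspace_add[OF sub, of w w'] subspace_add[OF subspace_grade, of w n w'] by simp
      moreover have "\<forall>k<Suc j. gen_part (x - (w + w')) n k = {0}"
        using w'(2) by (simp add: diff_diff_eq less_Suc_eq_le)
      ultimately show ?case by (rule bexI[rotated])
    qed
    then obtain w where w: "w \<in> socle" "w \<in> mgrade Z n" "\<And>k. k < n \<Longrightarrow> gen_part (x - w) n k = {0}" by blast
    have xw: "x - w \<in> mgrade Z n" using x w subspace_diff[OF subspace_grade] by blast
    have "top_vector n (x - w)"
      unfolding top_vector_def
    proof (intro conjI allI impI xw)
      fix k u m assume u: "u \<in> vgrade V k" and neg: "int k - m - 1 < 0"
      show "mode u m (x - w) = 0"
      proof (rule ccontr)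
        assume nz: "mode u m (x - w) \<noteq> 0"
        then obtain d where d: "m = int k + int n - int d - 1" "mode u m (x - w) \<in> mgrade Z d"
          using mode_homogeneous[OF u xw] by blast
        then have "mode u m (x - w) \<in> gen_part (x - w) n d" using mode_in_gen_part[OF u] by simp
        then show False using w(3)[of d] d(1) neg nz by simp
      qed
    qed
    then have "x - w \<in> socle" using top_vector_in_bottom_socle[OF H ss C2] bottom_socle_subset by blast
    then show ?thesis using w(1) subspace_add[OF sub, of "x - w" w] by simp
  qed
  then show ?thesis unfolding space_eq by (intro span_minimal[OF _ sub]) blast
qed

end

theorem proposition5p11:
  fixes V :: "'v::ab_group_add voa"
  assumes "vertex_operator_algebra V"
    and "C2_cofinite V"
    and "vector_space.dim (vscale V) (vgrade V 0) = 1"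
    and "semisimple_ring (zhu_algebra V)"
    and "\<And>Z :: ('v, complex poly) vmod.
           generated_by_irreducible_top V Z \<Longrightarrow> irreducible_module V Z"
  shows "rational TYPE('m::ab_group_add) V"
  unfolding rational_def
proof (intro allI impI)
  fix Z :: "('v, 'm) vmod" assume Z: "admissible_module V Z"
  interpret voa_admissible V Z
    by (intro voa_admissible.intro voa_weak_module.intro assms(1) Z admissible_module.axioms(1)[OF Z])
  show "completely_reducible V Z"
    by (rule completely_reducible_if_socle[OF socle_eq_space[OF assms(5,4,2)]])
qed

end
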